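(* Let $I\subset\mathbb R$ be a compact interval, $\mu\ge0$, $\sigma>0$, $\alpha\in(0,1]$, and let $H(t)$, $t\in I$, be a family of operators such that: (1) for every $r\ge0$, $t\mapsto H(t)$ is norm-continuous as a map $I\to\mathcal L(\mathcal H^{r+\mu},\mathcal H^r)$; (2) with $r=\mu+\sigma$ there is $c_r\in L^1(I)$, $c_r\ge0$, such that $$\left|\mathrm i\left(\langle H(t)v,\Lambda^{2r}v\rangle-\langle\Lambda^{2r}v,H(t)v\rangle\right)\right|\le c_r(t)\|v\|_r^2\qquad\text{for every }v\in\mathcal H^\infty\text{ and almost every }t\in I;$$ (3) each $H(t)$ is symmetric on $\mathcal H^\infty$; (4) $t\mapsto H(t)$ is H\"older continuous of exponent $\alpha$ as a map $I\to\mathcal L(\mathcal H^\mu,\mathcal H)$. Let $U(t,s)$ be the unitary propagator given by $U(t,s)u=\lim_{N\to\infty}U_N(t,s)P_Nu$ (which exists under these hypotheses). Then there is a constant $C_{I,\mu,\sigma,\alpha}>0$, independent of $N$ and $M$, such that for the uniform partition of $[s,t]$ into $M$ subintervals, $$\|U_{N,M}(t,s)P_Nu-U(t,s)u\|\le C_{I,\mu,\sigma,\alpha}\left((1+N)^{-\sigma}+(1+N)^\mu M^{-\alpha}\right)\|u\|_{\mu+\sigma}$$ for all $u\in\mathcal H^{\mu+\sigma}$, $s,t\in I$. In particular, if $M(N)/(1+N)^{\mu/\alpha}\to+\infty$ as $N\to\infty$, then $U_{N,M(N)}(t,s)P_Nu\to U(t,s)u$ in $\mathcal H$ for every $u\in\mathcal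 H^{\mu+\sigma}$, uniformly for $(t,s)\in I\times I$.
   Context: $\mathcal H$ is a complex separable Hilbert space, $H_0$ a positive self-adjoint operator on $\mathcal H$ with compact resolvent (spectrum contained in $[0,\infty)$), and $\Lambda=1+H_0$. For $N>0$, $P_N=\mathbf 1_{[0,N]}(H_0)$ and $\mathcal H_N=P_N\mathcal H$ (finite-dimensional). For $r\ge0$, $\mathcal H^r=D(\Lambda^r)$ with norm $\|u\|_r=\|\Lambda^ru\|$, and $\mathcal H^\infty=\bigcap_{r\ge0}\mathcal H^r$. $H_N(t)=P_NH(t)P_N$ is viewed as a self-adjoint operator on $\mathcal H_N$, and $U_N(t,s)$ is its unitary propagator: $\mathrm i\partial_tU_N(t,s)=H_N(t)U_N(t,s)$, $U_N(s,s)=\mathbf 1_{\mathcal H_N}$. For $s<t$ and an integer $M\ge1$, with $t_j=s+j(t-s)/M$, $$U_{N,M}(t,s)=\mathrm e^{-\mathrm i\frac{t-s}{M}H_N(t_{M-1})}\cdots\mathrm e^{-\mathrm i\frac{t-s}{M}H_N(t_0)}$$ on $\mathcal H_N$. For $t<s$, $U_{N,M}(t,s):=U_{N,M}(s,t)^{-1}$, and $U_{N,M}(s,s)=\mathbf 1_{\mathcal H_N}$. *)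

theory Defs
  imports "HOL-Analysis.Analysis"
begin

section \<open>Complex Hilbert spaces\<close>

text \<open>
  The inner product is linear in the first and conjugate-linear in the second argument. Positivity
  and definiteness follow from the last axiom, because \<open>sqrt\<close> is negative on negative reals and
  the norm vanishes only at 0.
\<close>

class complex_hilbert = banach +
  fixes scaleC :: "complex \<Rightarrow> 'a \<Rightarrow> 'a" (infixr "*\<^sub>C" 75)
    and cinner :: "'a \<Rightarrow> 'a \<Rightarrow> complex"
  assumes scaleC_add_right: "z *\<^sub>C (x + y) = z *\<^sub>C x + z *\<^sub>C y"
    and scaleC_add_left: "(z + w) *\<^sub>C x = z *\<^sub>C x + w *\<^sub>C x"
    and scaleC_scaleC: "z *\<^sub>C w *\<^sub>C x = (z * w) *\<^sub>C x"
    and scaleR_scaleC: "r *\<^sub>R x = complex_of_real r *\<^sub>C x"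
    and cinner_commute: "cinner x y = cnj (cinner y x)"
    and cinner_add_left: "cinner (x + y) v = cinner x v + cinner y v"
    and cinner_scaleC_left: "cinner (z *\<^sub>C x) y = z * cinner x y"
    and norm_eq_sqrt_cinner: "norm x = sqrt (Re (cinner x x))"

definition csubspace :: "'a::complex_hilbert set \<Rightarrow> bool" where
  "csubspace V \<longleftrightarrow> 0 \<in> V \<and> (\<forall>x\<in>V. \<forall>y\<in>V. x + y \<in> V) \<and> (\<forall>z. \<forall>x\<in>V. z *\<^sub>C x \<in> V)"

definition clinear_on :: "'a::complex_hilbert set \<Rightarrow> ('a \<Rightarrow> 'a) \<Rightarrow> bool" where
  "clinear_on V T \<longleftrightarrow> (\<forall>x\<in>V. \<forall>y\<in>V. T (x + y) = T x + T y) \<and> (\<forall>z. \<forall>x\<in>V. T (z *\<^sub>C x) = z *\<^sub>C T x)"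

definition unitary :: "('a::complex_hilbert \<Rightarrow> 'a) \<Rightarrow> bool" where
  "unitary T \<longleftrightarrow> clinear_on UNIV T \<and> surj T \<and> (\<forall>x y. cinner (T x) (T y) = cinner x y)"

definition orth_proj :: "'a::complex_hilbert set \<Rightarrow> 'a \<Rightarrow> 'a" where
  "orth_proj V u = (THE v. v \<in> V \<and> (\<forall>w\<in>V. cinner (u - v) w = 0))"


section \<open>Unbounded operators\<close>

text \<open>An unbounded operator is a pair of its domain and its action, only the values of the latter
  on the domain being relevant.\<close>

type_synonym 'a uop = "'a set \<times> ('a \<Rightarrow> 'a)"

definition adjoint_graph :: "'a::complex_hilbert uop \<Rightarrow> ('a \<times> 'a) set" where
  "adjoint_graph A = {(y, z). \<forall>x\<in>fst A. cinner (snd A x) y = cinner x z}"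

definition self_adjoint_op :: "'a::complex_hilbert uop \<Rightarrow> bool" where
  "self_adjoint_op A \<longleftrightarrow> csubspace (fst A) \<and> clinear_on (fst A) (snd A) \<and> closure (fst A) = UNIV
     \<and> adjoint_graph A = {(x, snd A x) |x. x \<in> fst A}"

definition positive_op :: "'a::complex_hilbert uop \<Rightarrow> bool" where
  "positive_op A \<longleftrightarrow> (\<forall>x\<in>fst A. 0 \<le> Re (cinner (snd A x) x))"

text \<open>Mapping the unit ball to a relatively compact set makes the inverse bounded, so the
  \<open>z\<close> below lies in the resolvent set.\<close>

definition compact_resolvent :: "'a::complex_hilbert uop \<Rightarrow> bool" where
  "compact_resolvent A \<longleftrightarrow> (\<exists>z. bij_betw (\<lambda>x. snd A x - z *\<^sub>C x) (fst A) UNIV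
     \<and> compact (closure (inv_into (fst A) (\<lambda>x. snd A x - z *\<^sub>C x) ` cball 0 1)))"

text \<open>
  The spectrum of a self-adjoint operator with compact resolvent consists of eigenvalues, and its
  spectral measure assigns to \<open>B\<close> the sum of the projections onto the eigenspaces with eigenvalue
  in \<open>B\<close>. The functional calculus and its natural domain are therefore given by sums over all
  reals, where the terms that do not belong to an eigenvalue vanish.
\<close>

definition eigenspace :: "'a::complex_hilbert uop \<Rightarrow> real \<Rightarrow> 'a set" where
  "eigenspace A l = {x \<in> fst A. snd A x = l *\<^sub>R x}"

definition fc_dom :: "'a::complex_hilbert uop \<Rightarrow> (real \<Rightarrow> real) \<Rightarrow> 'a set" where
  "fc_dom A f = {u. (\<lambda>l. (f l)\<^sup>2 * (norm (orth_proj (eigenspace A l) u))\<^sup>2) summable_on UNIV}"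

definition fc :: "'a::complex_hilbert uop \<Rightarrow> (real \<Rightarrow> real) \<Rightarrow> 'a \<Rightarrow> 'a" where
  "fc A f u = (\<Sum>\<^sub>\<infinity>l. f l *\<^sub>R orth_proj (eigenspace A l) u)"


section \<open>The scale of spaces\<close>

text \<open>\<open>Lambda_pow H0 r\<close> is $(1 + H_0)^r$, with domain \<open>sob H0 r\<close>.\<close>

definition Lambda_pow :: "'a::complex_hilbert uop \<Rightarrow> real \<Rightarrow> 'a \<Rightarrow> 'a" where
  "Lambda_pow H0 r = fc H0 (\<lambda>l. (1 + l) powr r)"

definition sob :: "'a::complex_hilbert uop \<Rightarrow> real \<Rightarrow> 'a set" where
  "sob H0 r = fc_dom H0 (\<lambda>l. (1 + l) powr r)"

definition sob_norm :: "'a::complex_hilbert uop \<Rightarrow> real \<Rightarrow> 'a \<Rightarrow> real" where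
  "sob_norm H0 r u = norm (Lambda_pow H0 r u)"

definition sob_inf :: "'a::complex_hilbert uop \<Rightarrow> 'a set" where
  "sob_inf H0 = (\<Inter>r\<in>{0..}. sob H0 r)"

definition bounded_sob :: "'a::complex_hilbert uop \<Rightarrow> real \<Rightarrow> real \<Rightarrow> ('a \<Rightarrow> 'a) \<Rightarrow> bool" where
  "bounded_sob H0 p q T \<longleftrightarrow> clinear_on (sob H0 p) T \<and> T ` sob H0 p \<subseteq> sob H0 q
     \<and> (\<exists>C. \<forall>u\<in>sob H0 p. sob_norm H0 q (T u) \<le> C * sob_norm H0 p u)"

definition sob_opnorm :: "'a::complex_hilbert uop \<Rightarrow> real \<Rightarrow> real \<Rightarrow> ('a \<Rightarrow> 'a) \<Rightarrow> real" where
  "sob_opnorm H0 p q T = Sup {sob_norm H0 q (T u) |u. u \<in> sob H0 p \<and> sob_norm H0 p u \<le> 1}"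

definition norm_continuous_sob ::
    "'a::complex_hilbert uop \<Rightarrow> real set \<Rightarrow> real \<Rightarrow> real \<Rightarrow> (real \<Rightarrow> 'a \<Rightarrow> 'a) \<Rightarrow> bool" where
  "norm_continuous_sob H0 J p q H \<longleftrightarrow> (\<forall>t\<in>J. bounded_sob H0 p q (H t))
     \<and> (\<forall>t\<in>J. ((\<lambda>t'. sob_opnorm H0 p q (\<lambda>u. H t' u - H t u)) \<longlongrightarrow> 0) (at t within J))"

definition holder_continuous_sob ::
    "real \<Rightarrow> 'a::complex_hilbert uop \<Rightarrow> real set \<Rightarrow> real \<Rightarrow> real \<Rightarrow> (real \<Rightarrow> 'a \<Rightarrow> 'a) \<Rightarrow> bool" where
  "holder_continuous_sob \<alpha> H0 J p q H \<longleftrightarrow> (\<forall>t\<in>J. bounded_sob H0 p q (H t))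
     \<and> (\<exists>L. \<forall>t\<in>J. \<forall>t'\<in>J. sob_opnorm H0 p q (\<lambda>u. H t' u - H t u) \<le> L * \<bar>t' - t\<bar> powr \<alpha>)"


section \<open>Spectral truncation and propagators\<close>

definition cutoff :: "'a::complex_hilbert uop \<Rightarrow> real \<Rightarrow> 'a \<Rightarrow> 'a" where
  "cutoff H0 N = fc H0 (indicator {0..N})"

definition cutoff_space :: "'a::complex_hilbert uop \<Rightarrow> real \<Rightarrow> 'a set" where
  "cutoff_space H0 N = range (cutoff H0 N)"

definition truncation ::
    "'a::complex_hilbert uop \<Rightarrow> (real \<Rightarrow> 'a \<Rightarrow> 'a) \<Rightarrow> real \<Rightarrow> real \<Rightarrow> 'a \<Rightarrow> 'a" where
  "truncation H0 H N t u = cutoff H0 N (H t (cutoff H0 N u))"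

text \<open>
  The propagator on the time interval \<open>J\<close> of a continuous family \<open>A\<close> of operators on a
  finite-dimensional subspace \<open>V\<close>: \<open>propagator J V A t s u\<close>, for \<open>u \<in> V\<close>, is the value at time
  \<open>t\<close> of the unique solution in \<open>V\<close> of $\mathrm i x' = A x$, $x(s) = u$. The derivative is one-sided
  at the end points of \<open>J\<close>. Since \<open>V\<close> is finite-dimensional, this pointwise equation is equivalent
  to the operator equation for $U(\cdot, s)$.
\<close>

definition propagator ::
    "real set \<Rightarrow> 'a::complex_hilbert set \<Rightarrow> (real \<Rightarrow> 'a \<Rightarrow> 'a) \<Rightarrow> real \<Rightarrow> real \<Rightarrow> 'a \<Rightarrow> 'a" where
  "propagator J V A t s u = (THE y. \<exists>x. x s = u \<and> x t = y
     \<and> (\<forall>\<tau>\<in>J. x \<tau> \<in> V \<and> (x has_vector_derivative (- \<i>) *\<^sub>C A \<tau> (x \<tau>)) (at \<tau> within J)))"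

definition galerkin ::
    "'a::complex_hilbert uop \<Rightarrow> (real \<Rightarrow> 'a \<Rightarrow> 'a) \<Rightarrow> real set \<Rightarrow> real \<Rightarrow> real \<Rightarrow> real \<Rightarrow> 'a \<Rightarrow> 'a" where
  "galerkin H0 H J N = propagator J (cutoff_space H0 N) (truncation H0 H N)"

definition unitary_propagator :: "real set \<Rightarrow> (real \<Rightarrow> real \<Rightarrow> 'a::complex_hilbert \<Rightarrow> 'a) \<Rightarrow> bool" where
  "unitary_propagator J U \<longleftrightarrow> (\<forall>t\<in>J. \<forall>s\<in>J. unitary (U t s)) \<and> (\<forall>s\<in>J. U s s = id)
     \<and> (\<forall>t\<in>J. \<forall>r\<in>J. \<forall>s\<in>J. U t r \<circ> U r s = U t s)
     \<and> (\<forall>u. continuous_on (J \<times> J) (\<lambda>(t, s). U t s u))"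

definition full_propagator ::
    "'a::complex_hilbert uop \<Rightarrow> (real \<Rightarrow> 'a \<Rightarrow> 'a) \<Rightarrow> real set \<Rightarrow> real \<Rightarrow> real \<Rightarrow> 'a \<Rightarrow> 'a" where
  "full_propagator H0 H J t s u = Lim at_top (\<lambda>N. galerkin H0 H J N t s (cutoff H0 N u))"

definition op_exp :: "('a::complex_hilbert \<Rightarrow> 'a) \<Rightarrow> 'a \<Rightarrow> 'a" where
  "op_exp A u = (\<Sum>n. (A ^^ n) u /\<^sub>R fact n)"

text \<open>The ordered product of the first \<open>j\<close> exponential factors with step \<open>h\<close>, starting at time
  \<open>s\<close>; later times stand to the left.\<close>

primrec exp_product ::
    "(real \<Rightarrow> 'a::complex_hilbert \<Rightarrow> 'a) \<Rightarrow> real \<Rightarrow> real \<Rightarrow> nat \<Rightarrow> 'a \<Rightarrow> 'a" where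
  "exp_product A h s 0 u = u"
| "exp_product A h s (Suc j) u =
     op_exp (\<lambda>v. (- \<i> * complex_of_real h) *\<^sub>C A (s + real j * h) v) (exp_product A h s j u)"

definition galerkin_step ::
    "'a::complex_hilbert uop \<Rightarrow> (real \<Rightarrow> 'a \<Rightarrow> 'a) \<Rightarrow> real \<Rightarrow> nat \<Rightarrow> real \<Rightarrow> real \<Rightarrow> 'a \<Rightarrow> 'a" where
  "galerkin_step H0 H N M t s =
     (if s < t then exp_product (truncation H0 H N) ((t - s) / real M) s M
      else if t < s then
        inv_into (cutoff_space H0 N) (exp_product (truncation H0 H N) ((s - t) / real M) t M)
      else id)"

end

theory Submission
  imports Defs
begin

text \<open>
  Write \<open>x\<^sub>N(t)\<close> for the truncated solution starting at \<open>P\<^sub>N u\<close>. Three estimates carry the proof.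

  First, \<open>\<parallel>x\<^sub>N(t)\<parallel>\<close> measured in the norm of order \<open>\<mu> + \<sigma>\<close> is bounded uniformly in \<open>N\<close>: its square has a
  derivative controlled by the commutator hypothesis. As the exceptional null set there depends on
  the vector, the derivative is integrated over short intervals with the vector frozen, and
  a discrete Gronwall argument removes the error of the freezing.

  Second, for \<open>N \<le> N'\<close> the difference \<open>x\<^sub>N\<^sub>' - x\<^sub>N\<close> solves the equation of index \<open>N'\<close> with source
  \<open>(P\<^sub>N\<^sub>' - P\<^sub>N) H x\<^sub>N\<close>, of size \<open>(1 + N) powr -\<sigma>\<close> because \<open>H\<close> maps order \<open>\<mu> + \<sigma>\<close> to order \<open>\<sigma>\<close>. A source
  enters a unitary evolution only through the integral of its norm, so the truncated propagators
  converge at this rate on a dense set, hence strongly.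

  Third, on a step of length \<open>h\<close> freezing the generator is again a source, of size
  \<open>L h powr \<alpha> (1 + N) powr \<mu>\<close>, and the frozen exponentials are isometries, so the errors of the steps add up. For
  \<open>t < s\<close> the isometry of the product turns the error of its inverse into the forward error.
\<close>

section \<open>Geometry of complex Hilbert spaces\<close>

text \<open>The functional calculus is defined by sums over eigenspaces, so nothing about it is
  available until the eigenvectors are known to span; this is drawn from the compact positive
  operator (1 + H_0)^(-1). Afterwards powers, cutoffs and norms are all handled by comparing
  weights, component by component.

  Two kinds of constants are kept apart. The truncated operators are bounded, with a bound that
  grows with N. It gives existence of solutions, Lipschitz continuity in time and the error of
  freezing a vector; that error is quadratic in the mesh and disappears when the partition is
  refined at fixed N. The constants that survive are uniform in N: the exponential of the integral
  of c, because the weight commutes with the cutoff and the commutator tested on truncated vectors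
  is that of H itself; the bound of H between two spaces of the scale; and the Hoelder constant. The
  factor \<open>(1 + N) powr \<mu>\<close> is the price of a Hoelder bound that starts from order
  \<mu>, paid on vectors with spectrum below N.\<close>

lemma scaleC_one [simp]: "1 *\<^sub>C x = (x::'a::complex_hilbert)"
  using scaleR_scaleC[of 1 x] by simp

lemma cinner_add_right: "cinner x (y + z) = cinner x y + cinner x (z::'a::complex_hilbert)"
  by (metis cinner_add_left cinner_commute complex_cnj_add)

lemma cinner_scaleC_right: "cinner x (z *\<^sub>C y) = cnj z * cinner x (y::'a::complex_hilbert)"
  by (metis cinner_scaleC_left cinner_commute complex_cnj_mult)

lemma norm_sq_eq_Re_cinner: "(norm (x::'a::complex_hilbert))\<^sup>2 = Re (cinner x x)"
  using norm_eq_sqrt_cinner[of x] norm_ge_zero[of x] by (metis real_sqrt_ge_0_iff real_sqrt_pow2)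

lemma cinner_self: "cinner x x = complex_of_real ((norm (x::'a::complex_hilbert))\<^sup>2)"
proof -
  have "Im (cinner x x) = 0"
    using cinner_commute[of x x] by (simp add: complex_eq_iff)
  then show ?thesis by (simp add: complex_eq_iff norm_sq_eq_Re_cinner)
qed

lemma norm_scaleC: "norm (z *\<^sub>C x) = cmod z * norm (x::'a::complex_hilbert)"
proof -
  have "cinner (z *\<^sub>C x) (z *\<^sub>C x) = (z * cnj z) * cinner x x"
    by (simp add: cinner_scaleC_left cinner_scaleC_right)
  also have "\<dots> = complex_of_real ((cmod z * norm x)\<^sup>2)"
    by (simp only: cinner_self complex_norm_square[symmetric] of_real_mult power_mult_distrib of_real_power)
  finally have "(norm (z *\<^sub>C x))\<^sup>2 = (cmod z * norm x)\<^sup>2"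
    unfolding cinner_self of_real_eq_iff .
  then show ?thesis by simp
qed

lemma cinner_zero_left [simp]: "cinner 0 (y::'a::complex_hilbert) = 0"
  using cinner_add_left[of 0 0 y] by simp

lemma cinner_zero_right [simp]: "cinner (y::'a::complex_hilbert) 0 = 0"
  using cinner_add_right[of y 0 0] by simp

lemma cinner_diff_left: "cinner (x - y) z = cinner x z - cinner y (z::'a::complex_hilbert)"
  using cinner_add_left[of "x - y" y z] by simp

lemma cinner_diff_right: "cinner z (x - y) = cinner z x - cinner z (y::'a::complex_hilbert)"
  using cinner_add_right[of z "x - y" y] by simp

lemma cinner_scaleR_left: "cinner (r *\<^sub>R x) y = r * cinner x (y::'a::complex_hilbert)"
  by (simp add: scaleR_scaleC cinner_scaleC_left)

lemma cinner_scaleR_right: "cinner x (r *\<^sub>R y) = r * cinner x (y::'a::complex_hilbert)"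
  by (simp add: scaleR_scaleC cinner_scaleC_right)

lemma scaleC_zero_right [simp]: "z *\<^sub>C 0 = (0::'a::complex_hilbert)"
  using scaleC_add_right[of z 0 "0::'a"] by simp

lemma scaleC_minus_right: "z *\<^sub>C (- x) = - (z *\<^sub>C (x::'a::complex_hilbert))"
  by (metis add.inverse_unique add.right_inverse scaleC_add_right scaleC_zero_right)

lemma scaleC_zero_left [simp]: "0 *\<^sub>C x = (0::'a::complex_hilbert)"
  using scaleR_scaleC[of 0 x] by simp

lemma scaleC_minus_left: "(- z) *\<^sub>C x = - (z *\<^sub>C (x::'a::complex_hilbert))"
  by (metis add.inverse_unique add.right_inverse scaleC_add_left scaleC_zero_left)

lemma scaleC_diff_right: "z *\<^sub>C (x - y) = z *\<^sub>C x - z *\<^sub>C (y::'a::complex_hilbert)"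
  using scaleC_add_right[of z x "-y"] by (simp add: scaleC_minus_right)

lemma scaleC_scaleR_commute: "z *\<^sub>C (r *\<^sub>R x) = r *\<^sub>R (z *\<^sub>C (x::'a::complex_hilbert))"
  by (simp add: scaleR_scaleC scaleC_scaleC mult.commute)

lemma bounded_linear_scaleC: "bounded_linear (\<lambda>x::'a::complex_hilbert. z *\<^sub>C x)"
  by (rule bounded_linear_intro[where K = "cmod z"])
     (simp_all add: scaleC_add_right scaleC_scaleR_commute norm_scaleC)

lemma norm_diff_sq:
  "(norm (x - y))\<^sup>2 = (norm x)\<^sup>2 - 2 * Re (cinner x y) + (norm (y::'a::complex_hilbert))\<^sup>2"
proof -
  have "Re (cinner y x) = Re (cinner x y)" using cinner_commute[of y x] by simp
  then show ?thesis
    by (simp add: norm_sq_eq_Re_cinner cinner_diff_left cinner_diff_right)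
qed

lemma norm_add_sq:
  "(norm (x + y))\<^sup>2 = (norm x)\<^sup>2 + 2 * Re (cinner x y) + (norm (y::'a::complex_hilbert))\<^sup>2"
proof -
  have "Re (cinner y x) = Re (cinner x y)" using cinner_commute[of y x] by simp
  then show ?thesis
    by (simp add: norm_sq_eq_Re_cinner cinner_add_left cinner_add_right)
qed

text \<open>Pythagoras for the component of x orthogonal to the line through y. Nonnegativity of the
  left side is Cauchy-Schwarz, and comparison with a minimal distance yields orthogonality of the
  closest point.\<close>

lemma norm_diff_line_proj_sq:
  fixes x y :: "'a::complex_hilbert"
  assumes "y \<noteq> 0"
  shows "(norm (x - (cinner x y / (norm y)\<^sup>2) *\<^sub>C y))\<^sup>2
           = (norm x)\<^sup>2 - (cmod (cinner x y))\<^sup>2 / (norm y)\<^sup>2"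
proof -
  have "Re (cinner x ((cinner x y / (norm y)\<^sup>2) *\<^sub>C y)) = (cmod (cinner x y))\<^sup>2 / (norm y)\<^sup>2"
  proof -
    have "cnj (cinner x y) * cinner x y = complex_of_real ((cmod (cinner x y))\<^sup>2)"
      by (simp only: complex_norm_square mult.commute)
    then show ?thesis
      by (simp add: cinner_scaleC_right flip: of_real_power of_real_divide)
  qed
  moreover have "(norm ((cinner x y / (norm y)\<^sup>2) *\<^sub>C y))\<^sup>2 = (cmod (cinner x y))\<^sup>2 / (norm y)\<^sup>2"
    using assms
    by (simp add: norm_scaleC norm_divide norm_power power_mult_distrib power_divide field_simps)
  ultimately show ?thesis unfolding norm_diff_sq by simp
qed

lemma cmod_cinner_le: "cmod (cinner x y) \<le> norm x * norm (y::'a::complex_hilbert)"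
proof (cases "y = 0")
  case False
  have "0 \<le> (norm x)\<^sup>2 - (cmod (cinner x y))\<^sup>2 / (norm y)\<^sup>2"
    using norm_diff_line_proj_sq[OF False, of x] zero_le_power2 by metis
  then have "(cmod (cinner x y))\<^sup>2 \<le> (norm x * norm y)\<^sup>2"
    using False by (simp add: field_simps power_mult_distrib)
  then show ?thesis by (rule power2_le_imp_le) simp
qed simp

lemma bounded_bilinear_cinner: "bounded_bilinear (cinner :: 'a::complex_hilbert \<Rightarrow> 'a \<Rightarrow> complex)"
proof
  show "\<exists>K. \<forall>(a::'a) b. norm (cinner a b) \<le> norm a * norm b * K"
    by (rule exI[of _ 1]) (simp add: cmod_cinner_le)
qed (simp_all add: cinner_add_left cinner_add_right cinner_scaleR_left cinner_scaleR_right scaleR_conv_of_real)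

lemmas tendsto_cinner = bounded_bilinear.tendsto[OF bounded_bilinear_cinner]
lemmas continuous_on_cinner = bounded_bilinear.continuous_on[OF bounded_bilinear_cinner]
lemmas has_vector_derivative_cinner = bounded_bilinear.has_vector_derivative[OF bounded_bilinear_cinner]
lemmas bounded_linear_cinner_left = bounded_bilinear.bounded_linear_left[OF bounded_bilinear_cinner]

lemma csubspace_diff: "csubspace V \<Longrightarrow> x \<in> V \<Longrightarrow> y \<in> V \<Longrightarrow> x - y \<in> V"
  unfolding csubspace_def by (metis scaleC_minus_left scaleC_one uminus_add_conv_diff add.commute)

lemma csubspace_scaleR: "csubspace V \<Longrightarrow> x \<in> V \<Longrightarrow> r *\<^sub>R x \<in> V"
  unfolding csubspace_def by (simp add: scaleR_scaleC)

section \<open>Orthogonal projection onto closed subspaces\<close>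

lemma closest_point_exists:
  fixes V :: "'a::complex_hilbert set"
  assumes V: "csubspace V" "closed V"
  shows "\<exists>v\<in>V. \<forall>w\<in>V. norm (u - v) \<le> norm (u - w)"
proof -
  define d where "d = (INF w\<in>V. (norm (u - w))\<^sup>2)"
  have bdd: "bdd_below ((\<lambda>w. (norm (u - w))\<^sup>2) ` V)" by (rule bdd_belowI2[of _ 0]) simp
  have ne: "V \<noteq> {}" using V by (auto simp: csubspace_def)
  have d: "d \<le> (norm (u - w))\<^sup>2" if "w \<in> V" for w
    unfolding d_def using bdd that by (rule cINF_lower)
  have "\<exists>w\<in>V. (norm (u - w))\<^sup>2 < d + 1 / real (Suc n)" for n
  proof (rule ccontr)
    assume "\<not> ?thesis"
    then have "d + 1 / real (Suc n) \<le> (INF w\<in>V. (norm (u - w))\<^sup>2)"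
      by (intro cINF_greatest[OF ne]) (auto simp: not_less)
    moreover have "1 / real (Suc n) > 0" by simp
    ultimately show False unfolding d_def[symmetric] by linarith
  qed
  then obtain v where vV: "\<And>n. v n \<in> V" and v: "\<And>n. (norm (u - v n))\<^sup>2 < d + 1 / real (Suc n)"
    by metis
  \<comment> \<open>Parallelogram law: the midpoint of two members of the minimising sequence lies
    in V, so its squared distance to u is at least d, which forces the two members together.\<close>
  have para: "(norm (v m - v n))\<^sup>2 \<le> 2 / real (Suc m) + 2 / real (Suc n)" for m n
  proof -
    let ?x = "u - v m" and ?y = "u - v n"
    have mid: "(1/2) *\<^sub>R (v m + v n) \<in> V"
      using V vV by (intro csubspace_scaleR) (auto simp: csubspace_def)
    have "?x + ?y = 2 *\<^sub>R (u - (1/2) *\<^sub>R (v m + v n))"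
      by (simp add: scaleR_diff_right scaleR_2)
    then have "norm (?x + ?y) = 2 * norm (u - (1/2) *\<^sub>R (v m + v n))" by simp
    then have "(norm (?x + ?y))\<^sup>2 = 4 * (norm (u - (1/2) *\<^sub>R (v m + v n)))\<^sup>2"
      by (simp only: power_mult_distrib) simp
    then have "4 * d \<le> (norm (?x + ?y))\<^sup>2" using d[OF mid] by linarith
    moreover have "(norm (?x - ?y))\<^sup>2 + (norm (?x + ?y))\<^sup>2 = 2 * (norm ?x)\<^sup>2 + 2 * (norm ?y)\<^sup>2"
      by (simp only: norm_diff_sq[of ?x ?y] norm_add_sq[of ?x ?y])
    moreover have "norm (?x - ?y) = norm (v m - v n)" by (simp add: norm_minus_commute)
    ultimately have "(norm (v m - v n))\<^sup>2 \<le> 2 * (norm ?x)\<^sup>2 + 2 * (norm ?y)\<^sup>2 - 4 * d" by simp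
    also have "\<dots> \<le> 2 * (1 / real (Suc m)) + 2 * (1 / real (Suc n))"
      using v[of m] v[of n] by linarith
    finally show ?thesis by simp
  qed
  have "Cauchy v"
  proof (rule metric_CauchyI)
    fix e :: real assume e: "e > 0"
    obtain k :: nat where k: "4 / e\<^sup>2 < real k" using reals_Archimedean2 by blast
    have "dist (v m) (v n) < e" if "m \<ge> k" "n \<ge> k" for m n
    proof -
      have k0: "real k > 0" using k e by (smt (verit) divide_pos_pos zero_less_power)
      have "2 / real (Suc m) \<le> 2 / real k" "2 / real (Suc n) \<le> 2 / real k"
        using that k0 by (auto intro!: divide_left_mono)
      then have "(norm (v m - v n))\<^sup>2 \<le> 4 / real k" using para[of m n] by simp
      also have "\<dots> < e\<^sup>2" using k e k0 by (simp add: field_simps)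
      finally show ?thesis using e by (simp add: dist_norm power2_less_imp_less)
    qed
    then show "\<exists>M. \<forall>m\<ge>M. \<forall>n\<ge>M. dist (v m) (v n) < e" by blast
  qed
  then obtain w where w: "v \<longlonglongrightarrow> w" by (auto simp: Cauchy_convergent_iff convergent_def)
  have "w \<in> V" using closed_sequentially[OF V(2)] vV w by metis
  moreover have "norm (u - w) \<le> norm (u - y)" if "y \<in> V" for y
  proof -
    have "(\<lambda>n. (norm (u - v n))\<^sup>2) \<longlonglongrightarrow> (norm (u - w))\<^sup>2" by (intro tendsto_intros w)
    moreover have "(\<lambda>n. d + 1 / real (Suc n)) \<longlonglongrightarrow> d + 0"
      by (intro tendsto_intros LIMSEQ_Suc[OF lim_1_over_n])
    ultimately have "(norm (u - w))\<^sup>2 \<le> d"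
      using LIMSEQ_le[of "\<lambda>n. (norm (u - v n))\<^sup>2" _ "\<lambda>n. d + 1 / real (Suc n)"] less_imp_le[OF v]
      by simp
    then have "(norm (u - w))\<^sup>2 \<le> (norm (u - y))\<^sup>2" using d[OF that] by (rule order_trans)
    then show ?thesis by (rule power2_le_imp_le) simp
  qed
  ultimately show ?thesis by blast
qed

lemma orthogonal_decomposition:
  fixes V :: "'a::complex_hilbert set"
  assumes V: "csubspace V" "closed V"
  shows "\<exists>v\<in>V. \<forall>w\<in>V. cinner (u - v) w = 0"
proof -
  obtain v where v: "v \<in> V" and min: "\<And>w. w \<in> V \<Longrightarrow> norm (u - v) \<le> norm (u - w)"
    using closest_point_exists[OF V] by blast
  have "cinner (u - v) w = 0" if w: "w \<in> V" for w
  proof (cases "w = 0")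
    case False
    \<comment> \<open>Shifting the closest point v by the projection of \<open>u - v\<close> onto
      the line through w cannot reduce the distance to u, so the reduction given by Pythagoras must
      vanish.\<close>
    let ?z = "cinner (u - v) w / (norm w)\<^sup>2"
    have "norm (u - v) \<le> norm (u - (v + ?z *\<^sub>C w))"
      using V v w by (intro min) (auto simp: csubspace_def)
    then have "(norm (u - v))\<^sup>2 \<le> (norm (u - v - ?z *\<^sub>C w))\<^sup>2"
      by (simp add: diff_diff_eq power_mono)
    also have "\<dots> = (norm (u - v))\<^sup>2 - (cmod (cinner (u - v) w))\<^sup>2 / (norm w)\<^sup>2"
      by (rule norm_diff_line_proj_sq[OF False])
    finally show ?thesis using False by (simp add: divide_le_0_iff)
  qed simp
  with v show ?thesis by blast
qed

text \<open>Since \<open>orth_proj\<close> is a definite description, its values are always found by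
  exhibiting a vector of V with orthogonal remainder. Two such vectors differ by an element of V
  that is orthogonal to itself.\<close>

lemma orth_proj_unique:
  assumes V: "csubspace V" and "v \<in> V" "\<And>w. w \<in> V \<Longrightarrow> cinner (u - v) w = 0"
  shows "orth_proj V u = v"
  unfolding orth_proj_def
proof (rule the_equality)
  fix v' assume v': "v' \<in> V \<and> (\<forall>w\<in>V. cinner (u - v') w = 0)"
  then have d: "v - v' \<in> V" using assms csubspace_diff by blast
  have "cinner (v - v') (v - v') = cinner (u - v') (v - v') - cinner (u - v) (v - v')"
    by (simp add: cinner_diff_left)
  also have "\<dots> = 0" using assms(3)[OF d] v' d by simp
  finally show "v' = v" by (simp add: cinner_self)
qed (use assms in auto)

lemma orth_proj_in:
  assumes "csubspace V" "closed V"
  shows "orth_proj V u \<in> V"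
  using orthogonal_decomposition[OF assms, of u] orth_proj_unique[OF assms(1)] by metis

lemma orth_proj_orthogonal:
  assumes "csubspace V" "closed V" "w \<in> V"
  shows "cinner (u - orth_proj V u) w = 0"
  using orthogonal_decomposition[OF assms(1,2), of u] orth_proj_unique[OF assms(1)] assms(3) by metis

lemma orth_proj_add:
  assumes V: "csubspace V" "closed V"
  shows "orth_proj V (u + v) = orth_proj V u + orth_proj V v"
proof (rule orth_proj_unique[OF V(1)])
  show "orth_proj V u + orth_proj V v \<in> V"
    using orth_proj_in[OF V] V(1) by (simp add: csubspace_def)
  fix w assume "w \<in> V"
  then have "cinner (u - orth_proj V u) w + cinner (v - orth_proj V v) w = 0"
    using orth_proj_orthogonal[OF V] by simp
  then show "cinner (u + v - (orth_proj V u + orth_proj V v)) w = 0"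
    by (simp add: cinner_diff_left cinner_add_left algebra_simps)
qed

lemma orth_proj_scaleC:
  assumes V: "csubspace V" "closed V"
  shows "orth_proj V (z *\<^sub>C u) = z *\<^sub>C orth_proj V u"
proof (rule orth_proj_unique[OF V(1)])
  show "z *\<^sub>C orth_proj V u \<in> V"
    using orth_proj_in[OF V] V(1) by (simp add: csubspace_def)
  fix w assume "w \<in> V"
  then show "cinner (z *\<^sub>C u - z *\<^sub>C orth_proj V u) w = 0"
    using orth_proj_orthogonal[OF V] by (simp flip: scaleC_diff_right add: cinner_scaleC_left)
qed

lemma clinear_onD:
  assumes "clinear_on V T" "x \<in> V" "csubspace V"
  shows "T (z *\<^sub>C x) = z *\<^sub>C T x" "y \<in> V \<Longrightarrow> T (x + y) = T x + T y"
    "y \<in> V \<Longrightarrow> T (x - y) = T x - T y" "T (r *\<^sub>R x) = r *\<^sub>R T x" "T 0 = 0"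
proof -
  have add: "T (x + y) = T x + T y" if "x \<in> V" "y \<in> V" for x y
    using assms that unfolding clinear_on_def by blast
  have scale: "T (z *\<^sub>C x) = z *\<^sub>C T x" for z
    using assms unfolding clinear_on_def by blast
  show "T (z *\<^sub>C x) = z *\<^sub>C T x" by (rule scale)
  show "T (x + y) = T x + T y" if "y \<in> V" using assms(2) that by (rule add)
  show "T (r *\<^sub>R x) = r *\<^sub>R T x" unfolding scaleR_scaleC by (rule scale)
  show "T 0 = 0" using scale[of 0] by simp
  show "T (x - y) = T x - T y" if "y \<in> V"
    using add[OF csubspace_diff[OF assms(3,2) that] that] by (simp add: eq_diff_eq)
qed

section \<open>Spectral decomposition\<close>

text \<open>Cauchy criterion for unordered sums: sums over finite sets containing F0 all lie close
  to the sum over F0, so they form a Cauchy filter, and completeness supplies the limit.\<close>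

lemma summable_on_banachI:
  fixes f :: "'i \<Rightarrow> 'b::banach"
  assumes "\<And>e. e > 0 \<Longrightarrow> \<exists>F0. finite F0 \<and> (\<forall>F. finite F \<and> F \<inter> F0 = {} \<longrightarrow> norm (sum f F) < e)"
  shows "f summable_on UNIV"
proof -
  have "\<exists>P. eventually P (finite_subsets_at_top UNIV) \<and>
              (\<forall>F F'. P F \<and> P F' \<longrightarrow> dist (sum f F) (sum f F') < e)" if "e > 0" for e
  proof -
    obtain F0 where F0: "finite F0" "\<And>F. finite F \<Longrightarrow> F \<inter> F0 = {} \<Longrightarrow> norm (sum f F) < e / 2"
      using assms[of "e / 2"] \<open>e > 0\<close> by auto
    define P where "P F \<longleftrightarrow> finite F \<and> F0 \<subseteq> F" for F
    have "eventually P (finite_subsets_at_top UNIV)"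
      unfolding P_def eventually_finite_subsets_at_top using F0(1) by auto
    moreover have "dist (sum f F) (sum f F') < e" if "P F" "P F'" for F F'
    proof -
      have "dist (sum f F) (sum f F0) < e / 2" if "P F" for F
        using that F0(2)[of "F - F0"] sum_diff[of F F0 f] by (auto simp: P_def dist_norm)
      from this[OF that(1)] this[OF that(2)] show ?thesis
        using dist_triangle2[of "sum f F" "sum f F'" "sum f F0"] by simp
    qed
    ultimately show ?thesis by blast
  qed
  then have "cauchy_filter (filtermap (sum f) (finite_subsets_at_top UNIV))"
    by (simp add: cauchy_filter_metric_filtermap)
  moreover have "complete (UNIV::'b set)"
    by (meson Cauchy_convergent UNIV_I complete_def convergent_def)
  ultimately obtain L' where "(sum f \<longlongrightarrow> L') (finite_subsets_at_top UNIV)"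
    using complete_uniform[where S=UNIV] by (force simp add: filterlim_def)
  then show ?thesis using summable_on_def has_sum_def by blast
qed

lemma norm_sum_orthogonal_sq:
  fixes x :: "'i \<Rightarrow> 'a::complex_hilbert"
  assumes "finite F" and orth: "\<And>i j. i \<noteq> j \<Longrightarrow> cinner (x i) (x j) = 0"
  shows "(norm (sum x F))\<^sup>2 = (\<Sum>i\<in>F. (norm (x i))\<^sup>2)"
  using assms(1)
proof (induction F)
  case (insert i F)
  have "cinner (x i) (sum x F) = (\<Sum>j\<in>F. cinner (x i) (x j))"
    by (rule bounded_bilinear.sum_right[OF bounded_bilinear_cinner])
  also have "\<dots> = 0" using orth insert.hyps by (intro sum.neutral) metis
  finally show ?case using insert by (simp add: norm_add_sq)
qed simp

text \<open>By Pythagoras the square of a finite partial sum is a partial sum of squares, which is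
  small away from a suitable finite set. The norms themselves may fail to be summable.\<close>

lemma summable_on_orthogonal:
  fixes x :: "'i \<Rightarrow> 'a::complex_hilbert"
  assumes orth: "\<And>i j. i \<noteq> j \<Longrightarrow> cinner (x i) (x j) = 0"
    and sq: "(\<lambda>i. (norm (x i))\<^sup>2) summable_on UNIV"
  shows "x summable_on UNIV"
proof (rule summable_on_banachI)
  fix e :: real assume e: "e > 0"
  let ?g = "\<lambda>i. (norm (x i))\<^sup>2"
  let ?s = "infsum ?g UNIV"
  obtain F0 where F0: "finite F0" "dist (sum ?g F0) ?s \<le> e\<^sup>2 / 2"
    using infsum_finite_approximation[OF sq, of "e\<^sup>2 / 2"] e by auto
  have "norm (sum x F) < e" if F: "finite F" "F \<inter> F0 = {}" for F
  proof -
    have "sum ?g (F \<union> F0) \<le> ?s"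
      using F(1) F0(1) by (intro finite_sum_le_infsum sq) auto
    then have "sum ?g F \<le> ?s - sum ?g F0"
      using F F0(1) by (simp add: sum.union_disjoint)
    also have "\<dots> \<le> e\<^sup>2 / 2" using F0(2) unfolding dist_real_def by linarith
    also have "\<dots> < e\<^sup>2" using e by simp
    finally have "(norm (sum x F))\<^sup>2 < e\<^sup>2"
      using norm_sum_orthogonal_sq[where x = x, OF F(1) orth] by simp
    then show ?thesis using e power2_less_imp_less by fastforce
  qed
  then show "\<exists>F0. finite F0 \<and> (\<forall>F. finite F \<and> F \<inter> F0 = {} \<longrightarrow> norm (sum x F) < e)"
    using F0(1) by blast
qed

locale positive_compact_resolvent =
  fixes H0 :: "'a::complex_hilbert uop"
  assumes self_adjoint: "self_adjoint_op H0"
    and positive: "positive_op H0"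
    and compact_res: "compact_resolvent H0"
begin

lemma csubspace_dom: "csubspace (fst H0)" and clinear_on_dom: "clinear_on (fst H0) (snd H0)"
  using self_adjoint by (auto simp: self_adjoint_op_def)

lemmas H0_linear = clinear_onD[OF clinear_on_dom _ csubspace_dom]

text \<open>Self-adjointness as a weak test. One direction gives symmetry; the other places limits
  and orthogonal vectors in the domain and computes the operator there.\<close>

lemma adjoint_iff: "(\<forall>x\<in>fst H0. cinner (snd H0 x) y = cinner x z) \<longleftrightarrow> y \<in> fst H0 \<and> snd H0 y = z"
proof -
  have "(y, z) \<in> adjoint_graph H0 \<longleftrightarrow> y \<in> fst H0 \<and> snd H0 y = z"
    using self_adjoint by (auto simp: self_adjoint_op_def)
  then show ?thesis by (simp add: adjoint_graph_def)
qed

lemma H0_symmetric: "x \<in> fst H0 \<Longrightarrow> y \<in> fst H0 \<Longrightarrow> cinner (snd H0 x) y = cinner x (snd H0 y)"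
  using adjoint_iff by blast

text \<open>Testing against the domain replaces the eigenvalue equation of an unbounded operator by
  conditions that are continuous in x, so that eigenspaces are visibly closed.\<close>

lemma eigenspace_iff:
  "x \<in> eigenspace H0 l \<longleftrightarrow> (\<forall>y\<in>fst H0. cinner (snd H0 y) x = cinner y (l *\<^sub>R x))"
  unfolding eigenspace_def using adjoint_iff by blast

lemma csubspace_eigenspace: "csubspace (eigenspace H0 l)"
  unfolding csubspace_def
  by (auto simp: eigenspace_iff cinner_add_right scaleR_add_right cinner_scaleC_right
      scaleC_scaleR_commute[symmetric])

lemma closed_eigenspace: "closed (eigenspace H0 l)"
proof -
  have "eigenspace H0 l = (\<Inter>y\<in>fst H0. {x. cinner (snd H0 y) x = cinner y (l *\<^sub>R x)})"
    by (auto simp: eigenspace_iff)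
  also have "closed \<dots>"
    by (intro closed_INT ballI closed_Collect_eq continuous_on_cinner continuous_intros)
  finally show ?thesis .
qed

lemma eigenspace_orthogonal:
  assumes "x \<in> eigenspace H0 l" "y \<in> eigenspace H0 m" "l \<noteq> m"
  shows "cinner x y = 0"
proof -
  have "complex_of_real l * cinner x y = complex_of_real m * cinner x y"
    using assms H0_symmetric[of x y] by (simp add: eigenspace_def cinner_scaleR_left cinner_scaleR_right)
  then show ?thesis using assms(3) by simp
qed

lemma eigenspace_negative:
  assumes "x \<in> eigenspace H0 l" "l < 0"
  shows "x = 0"
proof -
  have "0 \<le> l * (norm x)\<^sup>2"
    using assms positive by (auto simp: eigenspace_def positive_op_def cinner_scaleR_left cinner_self)
  then show ?thesis using assms(2) by (simp add: zero_le_mult_iff)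
qed

text \<open>Positivity bounds the square of the norm of x by the pairing of (1 + H_0) x with x, and
  Cauchy-Schwarz does the rest. This makes -1 a convenient point at which to form the
  resolvent.\<close>

lemma norm_le_norm_shift:
  assumes "x \<in> fst H0"
  shows "norm x \<le> norm (snd H0 x + x)"
proof (cases "x = 0")
  case False
  have "norm x * norm x \<le> Re (cinner (snd H0 x + x) x)"
    using assms positive by (auto simp: positive_op_def cinner_add_left cinner_self power2_eq_square)
  also have "\<dots> \<le> norm (snd H0 x + x) * norm x"
    using complex_Re_le_cmod cmod_cinner_le order_trans by blast
  finally show ?thesis using False by simp
qed simp

text \<open>By \<open>norm_le_norm_shift\<close> the preimages of a convergent sequence are Cauchy,
  and their limit lies in the domain because it passes the weak test
  \<open>adjoint_iff\<close>.\<close>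

lemma closed_range_shift: "closed ((\<lambda>x. snd H0 x + x) ` fst H0)"
proof (subst closed_sequential_limits, intro allI impI)
  fix y l assume y: "(\<forall>n. y n \<in> (\<lambda>x. snd H0 x + x) ` fst H0) \<and> y \<longlonglongrightarrow> l"
  then obtain x where x: "\<And>n. x n \<in> fst H0" "\<And>n. y n = snd H0 (x n) + x n"
  proof -
    have "\<forall>n. \<exists>x. x \<in> fst H0 \<and> y n = snd H0 x + x" using y by blast
    then show ?thesis using that by metis
  qed
  have "Cauchy x"
  proof (rule metric_CauchyI)
    fix e :: real assume "e > 0"
    then obtain M where M: "\<And>m n. m \<ge> M \<Longrightarrow> n \<ge> M \<Longrightarrow> dist (y m) (y n) < e"
      using y LIMSEQ_imp_Cauchy metric_CauchyD by metis
    have "dist (x m) (x n) \<le> dist (y m) (y n)" for m n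
      using norm_le_norm_shift[of "x m - x n"] x csubspace_dom
      by (simp add: dist_norm H0_linear csubspace_diff algebra_simps)
    then show "\<exists>M. \<forall>m\<ge>M. \<forall>n\<ge>M. dist (x m) (x n) < e" using M order_le_less_trans by blast
  qed
  then obtain w where w: "x \<longlonglongrightarrow> w" by (auto simp: Cauchy_convergent_iff convergent_def)
  have "(\<lambda>n. y n - x n) \<longlonglongrightarrow> l - w" using y w by (intro tendsto_diff) auto
  then have A: "(\<lambda>n. snd H0 (x n)) \<longlonglongrightarrow> l - w" by (simp add: x)
  have "cinner (snd H0 z) w = cinner z (l - w)" if z: "z \<in> fst H0" for z
    using LIMSEQ_unique[OF tendsto_cinner[OF tendsto_const[of "snd H0 z"] w]] z x(1)
      tendsto_cinner[OF tendsto_const[of z] A] by (simp add: H0_symmetric)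
  then have "w \<in> fst H0 \<and> snd H0 w = l - w" using adjoint_iff by blast
  then show "l \<in> (\<lambda>x. snd H0 x + x) ` fst H0" by (intro image_eqI[of _ _ w]) auto
qed

lemma shift_surj: "\<exists>x\<in>fst H0. snd H0 x + x = y"
proof -
  let ?R = "(\<lambda>x. snd H0 x + x) ` fst H0"
  have "csubspace ?R"
    unfolding csubspace_def
  proof (intro conjI ballI allI)
    show "0 \<in> ?R" using csubspace_dom by (auto simp: csubspace_def H0_linear intro!: image_eqI[of _ _ 0])
    fix p assume "p \<in> ?R"
    then obtain x where x: "x \<in> fst H0" "p = snd H0 x + x" by blast
    show "z *\<^sub>C p \<in> ?R" for z
      using x csubspace_dom
      by (intro image_eqI[of _ _ "z *\<^sub>C x"]) (auto simp: csubspace_def H0_linear scaleC_add_right)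
    fix q assume "q \<in> ?R"
    then obtain y where y: "y \<in> fst H0" "q = snd H0 y + y" by blast
    show "p + q \<in> ?R"
      using x y csubspace_dom
      by (intro image_eqI[of _ _ "x + y"]) (auto simp: csubspace_def H0_linear)
  qed
  then obtain v where v: "v \<in> ?R" "\<And>w. w \<in> ?R \<Longrightarrow> cinner (y - v) w = 0"
    using orthogonal_decomposition[OF _ closed_range_shift, of y] by blast
  \<comment> \<open>A vector orthogonal to the range is in the domain of the adjoint, hence of
    \<open>H0\<close>, with eigenvalue -1; the lower bound \<open>norm_le_norm_shift\<close> then
    makes it 0.\<close>
  have "cinner (snd H0 x) (y - v) = cinner x (- (y - v))" if x: "x \<in> fst H0" for x
  proof -
    have "cinner (y - v) (snd H0 x + x) = 0" using v(2) x by blast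
    then have "cinner (snd H0 x + x) (y - v) = 0" by (subst cinner_commute) simp
    then have "cinner (snd H0 x) (y - v) = - cinner x (y - v)"
      by (simp add: cinner_add_left add_eq_0_iff2)
    then show ?thesis by (simp add: cinner_diff_right)
  qed
  then have "y - v \<in> fst H0" "snd H0 (y - v) + (y - v) = 0"
    using adjoint_iff[of "y - v" "- (y - v)"] by auto
  then have "norm (y - v) \<le> 0" using norm_le_norm_shift by fastforce
  then show ?thesis using v(1) by auto
qed

text \<open>Since \<open>snd H0 x - z *\<^sub>C x = (snd H0 x + x) - (1 + z) *\<^sub>C x\<close>, compactness passes from the
  resolvent at \<open>z\<close> to the one at \<open>-1\<close>.\<close>

lemma compact_resolvent_subseq:
  fixes x :: "nat \<Rightarrow> 'a"
  assumes x: "\<And>n. x n \<in> fst H0" and bd: "\<And>n. norm (snd H0 (x n) + x n) \<le> B"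
  shows "\<exists>w r. strict_mono (r::nat \<Rightarrow> nat) \<and> (x \<circ> r) \<longlonglongrightarrow> w"
proof -
  obtain z where bij: "bij_betw (\<lambda>x. snd H0 x - z *\<^sub>C x) (fst H0) UNIV"
    and comp: "compact (closure (inv_into (fst H0) (\<lambda>x. snd H0 x - z *\<^sub>C x) ` cball 0 1))"
    using compact_res by (auto simp: compact_resolvent_def)
  let ?f = "\<lambda>x. snd H0 x - z *\<^sub>C x"
  \<comment> \<open>The first two summands bound the image of \<open>x n\<close> under
    \<open>snd H0 - z\<close>; the last keeps K positive, so that dividing by K puts the image into
    the unit ball.\<close>
  define K where "K = \<bar>B\<bar> + cmod (1 + z) * \<bar>B\<bar> + 1"
  have K: "K > 0" unfolding K_def by (smt (verit) mult_nonneg_nonneg norm_ge_zero)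
  have "(1 / K) *\<^sub>R x n \<in> closure (inv_into (fst H0) ?f ` cball 0 1)" for n
  proof -
    let ?y = "(1 / K) *\<^sub>R x n"
    have y: "?y \<in> fst H0" using x csubspace_dom csubspace_scaleR by blast
    have "?f (x n) = (snd H0 (x n) + x n) - (1 + z) *\<^sub>C x n" by (simp add: scaleC_add_left)
    also have "norm \<dots> \<le> norm (snd H0 (x n) + x n) + cmod (1 + z) * norm (x n)"
      using norm_triangle_ineq4 norm_scaleC by metis
    also have "\<dots> \<le> \<bar>B\<bar> + cmod (1 + z) * \<bar>B\<bar>"
      using bd[of n] norm_le_norm_shift[OF x[of n]] by (intro add_mono mult_left_mono) auto
    finally have "norm (?f (x n)) \<le> K" by (simp add: K_def)
    moreover have "?f ?y = (1 / K) *\<^sub>R ?f (x n)"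
      using x by (simp add: H0_linear scaleC_scaleR_commute scaleR_diff_right)
    then have "norm (?f ?y) = norm (?f (x n)) / K" using K by (simp only: norm_scaleR) simp
    ultimately have "?f ?y \<in> cball 0 1" using K by simp
    then have "inv_into (fst H0) ?f (?f ?y) \<in> inv_into (fst H0) ?f ` cball 0 1" by blast
    then have "?y \<in> inv_into (fst H0) ?f ` cball 0 1"
      using inv_into_f_f[OF bij_betw_imp_inj_on[OF bij] y] by simp
    then show ?thesis by (rule closure_subset[THEN subsetD])
  qed
  then obtain w r where r: "strict_mono (r::nat\<Rightarrow>nat)" "((\<lambda>n. (1 / K) *\<^sub>R x n) \<circ> r) \<longlonglongrightarrow> w"
    using seq_compactE[OF compact_imp_seq_compact[OF comp], of "\<lambda>n. (1 / K) *\<^sub>R x n"] by metis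
  have "(\<lambda>n. K *\<^sub>R ((\<lambda>n. (1 / K) *\<^sub>R x n) \<circ> r) n) \<longlonglongrightarrow> K *\<^sub>R w"
    by (intro tendsto_scaleR tendsto_const r)
  then have "(x \<circ> r) \<longlonglongrightarrow> K *\<^sub>R w" using K by (simp add: o_def)
  with r show ?thesis by blast
qed

text \<open>The operator (1 + H_0)^(-1). It is bounded, symmetric, positive and compact and shares
  its eigenvectors with \<open>H0\<close>; the eigenvector argument is carried out for it.\<close>

definition inv_shift :: "'a \<Rightarrow> 'a" where
  "inv_shift y = (SOME x. x \<in> fst H0 \<and> snd H0 x + x = y)"

lemma inv_shift_in: "inv_shift y \<in> fst H0" and inv_shift_eq: "snd H0 (inv_shift y) + inv_shift y = y"
  unfolding inv_shift_def using someI_ex[of "\<lambda>x. x \<in> fst H0 \<and> snd H0 x + x = y"] shift_surj[of y] by auto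

lemma inv_shift_unique:
  assumes "x \<in> fst H0" "snd H0 x + x = y"
  shows "inv_shift y = x"
proof -
  have "inv_shift y - x \<in> fst H0" using inv_shift_in assms(1) csubspace_dom csubspace_diff by blast
  moreover have "snd H0 (inv_shift y - x) + (inv_shift y - x) = 0"
    using inv_shift_eq[of y] assms inv_shift_in[of y] by (simp add: H0_linear algebra_simps)
  ultimately have "norm (inv_shift y - x) \<le> 0" using norm_le_norm_shift by fastforce
  then show ?thesis by simp
qed

lemma inv_shift_add: "inv_shift (x + y) = inv_shift x + inv_shift y"
proof (rule inv_shift_unique)
  show "inv_shift x + inv_shift y \<in> fst H0" using inv_shift_in csubspace_dom by (simp add: csubspace_def)
  have "snd H0 (inv_shift x + inv_shift y) + (inv_shift x + inv_shift y) = (snd H0 (inv_shift x) + inv_shift x) + (snd H0 (inv_shift y) + inv_shift y)"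
    by (simp add: H0_linear inv_shift_in)
  then show "snd H0 (inv_shift x + inv_shift y) + (inv_shift x + inv_shift y) = x + y" by (simp only: inv_shift_eq)
qed

lemma inv_shift_scaleR: "inv_shift (r *\<^sub>R x) = r *\<^sub>R inv_shift x"
proof (rule inv_shift_unique)
  show "r *\<^sub>R inv_shift x \<in> fst H0" using inv_shift_in csubspace_dom csubspace_scaleR by blast
  have "snd H0 (r *\<^sub>R inv_shift x) + r *\<^sub>R inv_shift x = r *\<^sub>R (snd H0 (inv_shift x) + inv_shift x)"
    by (simp add: H0_linear inv_shift_in scaleR_add_right)
  then show "snd H0 (r *\<^sub>R inv_shift x) + r *\<^sub>R inv_shift x = r *\<^sub>R x" by (simp only: inv_shift_eq)
qed

lemma norm_inv_shift_le: "norm (inv_shift x) \<le> norm x"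
  using norm_le_norm_shift[OF inv_shift_in, of x] inv_shift_eq by simp

lemma bounded_linear_inv_shift: "bounded_linear inv_shift"
  by (rule bounded_linear_intro[where K = 1]) (simp_all add: inv_shift_add inv_shift_scaleR norm_inv_shift_le)

lemma inv_shift_symmetric: "cinner (inv_shift x) y = cinner x (inv_shift y)"
proof -
  have "cinner (inv_shift x) (snd H0 (inv_shift y) + inv_shift y) = cinner (snd H0 (inv_shift x) + inv_shift x) (inv_shift y)"
    using H0_symmetric[OF inv_shift_in inv_shift_in] by (simp add: cinner_add_left cinner_add_right)
  then show ?thesis by (simp add: inv_shift_eq)
qed

lemma inv_shift_positive: "0 \<le> Re (cinner (inv_shift x) x)"
proof -
  have "Re (cinner (inv_shift x) (snd H0 (inv_shift x) + inv_shift x)) = Re (cinner (snd H0 (inv_shift x)) (inv_shift x)) + (norm (inv_shift x))\<^sup>2"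
    by (simp add: cinner_add_right H0_symmetric[OF inv_shift_in inv_shift_in] cinner_self)
  also have "\<dots> \<ge> 0" using positive inv_shift_in by (auto simp: positive_op_def)
  finally show ?thesis by (simp add: inv_shift_eq)
qed

text \<open>The compact operator \<open>inv_shift\<close> attains its norm \<open>m\<close> on an invariant closed subspace: if
  \<open>norm (inv_shift x) = m\<close> for a unit vector \<open>x\<close> then \<open>inv_shift (inv_shift x) = m\<^sup>2 x\<close>, and \<open>inv_shift x + m x\<close> is an eigenvector.\<close>

lemma inv_shift_eigenvector:
  assumes W: "csubspace W" "closed W" and inv: "\<And>x. x \<in> W \<Longrightarrow> inv_shift x \<in> W" and ne: "W \<noteq> {0}"
  shows "\<exists>m y. m > 0 \<and> y \<in> W \<and> y \<noteq> 0 \<and> inv_shift y = m *\<^sub>R y"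
proof -
  define S where "S = {x \<in> W. norm x = 1}"
  define m where "m = (SUP x\<in>S. norm (inv_shift x))"
  have bdd: "bdd_above ((\<lambda>x. norm (inv_shift x)) ` S)"
    by (rule bdd_aboveI2[of _ _ 1]) (use norm_inv_shift_le in \<open>auto simp: S_def intro: order_trans[OF norm_inv_shift_le]\<close>)
  obtain v where v: "v \<in> W" "v \<noteq> 0" using ne W(1) by (auto simp: csubspace_def)
  then have v1: "(1 / norm v) *\<^sub>R v \<in> S" using csubspace_scaleR[OF W(1)] by (simp add: S_def)
  have Sle: "norm (inv_shift x) \<le> m" if "x \<in> S" for x
    unfolding m_def using bdd that by (rule cSUP_upper2) simp
  have inv_shift0: "inv_shift x = 0 \<Longrightarrow> x = 0" for x
    using inv_shift_eq[of x] csubspace_dom H0_linear(5)[of 0] by (simp add: csubspace_def)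
  have m: "m > 0"
  proof -
    have "inv_shift ((1 / norm v) *\<^sub>R v) \<noteq> 0" using v inv_shift0[of "(1 / norm v) *\<^sub>R v"] by auto
    then show ?thesis using Sle[OF v1] by (smt (verit) zero_less_norm_iff)
  qed
  have le: "norm (inv_shift x) \<le> m * norm x" if x: "x \<in> W" for x
  proof (cases "x = 0")
    case False
    then have "norm (inv_shift ((1 / norm x) *\<^sub>R x)) \<le> m"
      using Sle csubspace_scaleR[OF W(1) x] by (simp add: S_def)
    then show ?thesis using False by (simp add: inv_shift_scaleR field_simps)
  qed (use bounded_linear.linear[OF bounded_linear_inv_shift] in \<open>simp add: linear_0\<close>)
  have "\<exists>x\<in>S. m - 1 / real (Suc n) < norm (inv_shift x)" for n
    using v1 bdd less_cSUP_iff[of S "\<lambda>x. norm (inv_shift x)" "m - 1 / real (Suc n)"] unfolding m_def by auto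
  then obtain x where xS: "\<And>n. x n \<in> S" and x: "\<And>n. m - 1 / real (Suc n) < norm (inv_shift (x n))" by metis
  have lim: "(\<lambda>n. norm (inv_shift (x n))) \<longlonglongrightarrow> m"
  proof (rule tendsto_sandwich)
    have "(\<lambda>n. m - 1 / real (Suc n)) \<longlonglongrightarrow> m - 0"
      by (intro tendsto_intros LIMSEQ_Suc[OF lim_1_over_n])
    then show "(\<lambda>n. m - 1 / real (Suc n)) \<longlonglongrightarrow> m" by simp
    show "\<forall>\<^sub>F n in sequentially. m - 1 / real (Suc n) \<le> norm (inv_shift (x n))"
      by (intro always_eventually allI less_imp_le x)
    show "\<forall>\<^sub>F n in sequentially. norm (inv_shift (x n)) \<le> m"
      by (intro always_eventually allI Sle xS)
  qed (rule tendsto_const)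
  \<comment> \<open>Write T for \<open>inv_shift\<close>. The first term of the expanded square is
    at most m^4 and, by symmetry, the pairing of TTx with x is the square of the norm of Tx. A
    maximising sequence is thus asymptotically made of eigenvectors of T^2.\<close>
  have sq: "(norm (inv_shift (inv_shift (x n)) - m\<^sup>2 *\<^sub>R x n))\<^sup>2 \<le> 2 * m\<^sup>2 * (m\<^sup>2 - (norm (inv_shift (x n)))\<^sup>2)" for n
  proof -
    have xn: "x n \<in> W" "norm (x n) = 1" using xS by (auto simp: S_def)
    have "norm (inv_shift (inv_shift (x n))) \<le> m * norm (inv_shift (x n))" using le inv xn by blast
    also have "\<dots> \<le> m * m" using Sle[OF xS] m by simp
    finally have "(norm (inv_shift (inv_shift (x n))))\<^sup>2 \<le> (m * m)\<^sup>2" by (rule power_mono) simp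
    moreover have "Re (cinner (inv_shift (inv_shift (x n))) (m\<^sup>2 *\<^sub>R x n)) = m\<^sup>2 * (norm (inv_shift (x n)))\<^sup>2"
      unfolding inv_shift_symmetric[of "inv_shift (x n)"] inv_shift_scaleR by (simp add: cinner_scaleR_right cinner_self)
    ultimately show ?thesis unfolding norm_diff_sq using xn
      by (simp add: algebra_simps power2_eq_square)
  qed
  have "(\<lambda>n. 2 * m\<^sup>2 * (m\<^sup>2 - (norm (inv_shift (x n)))\<^sup>2)) \<longlonglongrightarrow> 2 * m\<^sup>2 * (m\<^sup>2 - m\<^sup>2)"
    by (intro tendsto_intros lim)
  then have lim0: "(\<lambda>n. 2 * m\<^sup>2 * (m\<^sup>2 - (norm (inv_shift (x n)))\<^sup>2)) \<longlonglongrightarrow> 0" by simp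
  have "(\<lambda>n. (norm (inv_shift (inv_shift (x n)) - m\<^sup>2 *\<^sub>R x n))\<^sup>2) \<longlonglongrightarrow> 0"
  proof (rule tendsto_sandwich[OF _ _ tendsto_const lim0])
    show "\<forall>\<^sub>F n in sequentially. 0 \<le> (norm (inv_shift (inv_shift (x n)) - m\<^sup>2 *\<^sub>R x n))\<^sup>2" by simp
  qed (intro always_eventually allI sq)
  then have "(\<lambda>n. sqrt ((norm (inv_shift (inv_shift (x n)) - m\<^sup>2 *\<^sub>R x n))\<^sup>2)) \<longlonglongrightarrow> sqrt 0" by (rule tendsto_real_sqrt)
  then have diff: "(\<lambda>n. inv_shift (inv_shift (x n)) - m\<^sup>2 *\<^sub>R x n) \<longlonglongrightarrow> 0" by (simp add: tendsto_norm_zero_iff)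
  have "norm (snd H0 (inv_shift (x n)) + inv_shift (x n)) \<le> 1" for n using xS by (simp add: inv_shift_eq S_def)
  then obtain w r where r: "strict_mono (r::nat\<Rightarrow>nat)" and w: "((\<lambda>n. inv_shift (x n)) \<circ> r) \<longlonglongrightarrow> w"
    using compact_resolvent_subseq[of "\<lambda>n. inv_shift (x n)" 1] inv_shift_in by blast
  \<comment> \<open>Compactness gave convergence of the images only. It passes to the sequence
    itself because m^2 x differs from T(Tx) by a null sequence and m is positive.\<close>
  have "(\<lambda>n. inv_shift (inv_shift (x (r n))) - (inv_shift (inv_shift (x (r n))) - m\<^sup>2 *\<^sub>R x (r n))) \<longlonglongrightarrow> inv_shift w - 0"
    using w LIMSEQ_subseq_LIMSEQ[OF diff r]
    by (intro tendsto_diff bounded_linear.tendsto[OF bounded_linear_inv_shift]) (auto simp: o_def)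
  then have "(\<lambda>n. (1 / m\<^sup>2) *\<^sub>R (m\<^sup>2 *\<^sub>R x (r n))) \<longlonglongrightarrow> (1 / m\<^sup>2) *\<^sub>R inv_shift w"
    by (intro tendsto_intros) simp
  then obtain v0 where lx: "(\<lambda>n. x (r n)) \<longlonglongrightarrow> v0" using m by auto
  have v0W: "v0 \<in> W" using closed_sequentially[OF W(2) _ lx] xS by (simp add: S_def)
  have v01: "norm v0 = 1"
    using LIMSEQ_unique[OF tendsto_norm[OF lx], of 1] xS by (simp add: S_def)
  have "(\<lambda>n. inv_shift (inv_shift (x (r n))) - m\<^sup>2 *\<^sub>R x (r n)) \<longlonglongrightarrow> inv_shift (inv_shift v0) - m\<^sup>2 *\<^sub>R v0"
    by (intro tendsto_intros bounded_linear.tendsto[OF bounded_linear_inv_shift] lx)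
  moreover have "(\<lambda>n. inv_shift (inv_shift (x (r n))) - m\<^sup>2 *\<^sub>R x (r n)) \<longlonglongrightarrow> 0"
    using LIMSEQ_subseq_LIMSEQ[OF diff r] by (simp add: o_def)
  ultimately have TT: "inv_shift (inv_shift v0) = m\<^sup>2 *\<^sub>R v0" using LIMSEQ_unique by fastforce
  let ?y = "inv_shift v0 + m *\<^sub>R v0"
  \<comment> \<open>From T^2 v0 = m^2 v0 alone, v0 could belong to the eigenvalue -m, which would
    make \<open>?y\<close> vanish. Positivity of T excludes this.\<close>
  have "Re (cinner ?y v0) = Re (cinner (inv_shift v0) v0) + m"
    using v01 by (simp add: cinner_add_left cinner_scaleR_left cinner_self)
  then have "?y \<noteq> 0" using inv_shift_positive[of v0] m by force
  moreover have "inv_shift ?y = m *\<^sub>R ?y"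
    by (simp add: inv_shift_add inv_shift_scaleR TT scaleR_add_right power2_eq_square)
  moreover have "?y \<in> W"
    using inv[OF v0W] csubspace_scaleR[OF W(1) v0W] W(1) unfolding csubspace_def by blast
  ultimately show ?thesis using m by blast
qed

text \<open>The vectors orthogonal to every eigenvector form a closed subspace invariant under
  \<open>inv_shift\<close>. If it were nonzero it would contain an eigenvector of
  \<open>inv_shift\<close> for some m > 0, hence one of \<open>H0\<close> for 1/m - 1, orthogonal to
  itself.\<close>

lemma eigenvectors_complete:
  assumes "\<And>l e. e \<in> eigenspace H0 l \<Longrightarrow> cinner w e = 0"
  shows "w = 0"
proof -
  define W where "W = {w. \<forall>l. \<forall>e\<in>eigenspace H0 l. cinner w e = 0}"
  have "csubspace W" by (auto simp: W_def csubspace_def cinner_add_left cinner_scaleC_left)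
  moreover have "closed W"
  proof -
    have "W = (\<Inter>l. \<Inter>e\<in>eigenspace H0 l. {w. cinner w e = 0})" by (auto simp: W_def)
    also have "closed \<dots>"
      by (intro closed_INT ballI closed_Collect_eq continuous_on_cinner continuous_intros)
    finally show ?thesis .
  qed
  moreover have "inv_shift x \<in> W" if x: "x \<in> W" for x
  proof -
    have "cinner (inv_shift x) e = 0" if e: "e \<in> eigenspace H0 l" for l e
    proof (cases "l < 0")
      case False
      have "inv_shift ((l + 1) *\<^sub>R e) = e"
        by (rule inv_shift_unique) (use e in \<open>auto simp: eigenspace_def algebra_simps\<close>)
      then have "(l + 1) *\<^sub>R inv_shift e = e" by (simp add: inv_shift_scaleR)
      then have "(1 / (l + 1)) *\<^sub>R (l + 1) *\<^sub>R inv_shift e = (1 / (l + 1)) *\<^sub>R e" by simp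
      then have "inv_shift e = (1 / (l + 1)) *\<^sub>R e" using False by simp
      then show ?thesis using x e by (simp add: inv_shift_symmetric W_def cinner_scaleR_right)
    qed (simp add: eigenspace_negative[OF e])
    then show ?thesis by (simp add: W_def)
  qed
  moreover have "\<not> (\<exists>m y. m > 0 \<and> y \<in> W \<and> y \<noteq> 0 \<and> inv_shift y = m *\<^sub>R y)"
  proof safe
    fix m y assume m: "m > (0::real)" "y \<in> W" "y \<noteq> 0" "inv_shift y = m *\<^sub>R y"
    have y: "y = (1 / m) *\<^sub>R inv_shift y" using m by simp
    then have yD: "y \<in> fst H0" using inv_shift_in csubspace_dom csubspace_scaleR by metis
    have "snd H0 (inv_shift y) + inv_shift y = y" by (rule inv_shift_eq)
    then have "m *\<^sub>R snd H0 y = y - m *\<^sub>R y" using m(4) yD by (simp add: H0_linear algebra_simps)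
    then have "(1 / m) *\<^sub>R (m *\<^sub>R snd H0 y) = (1 / m) *\<^sub>R (y - m *\<^sub>R y)" by simp
    then have "snd H0 y = (1 / m - 1) *\<^sub>R y" using m(1) by (simp add: algebra_simps)
    then have "y \<in> eigenspace H0 (1 / m - 1)" using yD by (simp add: eigenspace_def)
    then have "cinner y y = 0" using m(2) by (auto simp: W_def)
    then show False using m(3) by (simp add: cinner_self)
  qed
  ultimately have "W = {0}" using inv_shift_eigenvector by blast
  then show ?thesis using assms by (auto simp: W_def)
qed

end

section \<open>Functional calculus and the Sobolev scale\<close>

context positive_compact_resolvent
begin

abbreviation EP :: "real \<Rightarrow> 'a \<Rightarrow> 'a" where
  "EP l \<equiv> orth_proj (eigenspace H0 l)"

lemmas P_in = orth_proj_in[OF csubspace_eigenspace closed_eigenspace]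
lemmas P_add = orth_proj_add[OF csubspace_eigenspace closed_eigenspace]
lemmas P_scaleC = orth_proj_scaleC[OF csubspace_eigenspace closed_eigenspace]

lemma P_scaleR: "EP l (r *\<^sub>R u) = r *\<^sub>R EP l u"
  by (simp add: scaleR_scaleC P_scaleC)

lemma P_diff: "EP l (u - v) = EP l u - EP l v"
  using P_add[of l "u - v" v] by simp

lemma P_orthogonal: "l \<noteq> m \<Longrightarrow> cinner (EP l u) (EP m v) = 0"
  using eigenspace_orthogonal P_in by blast

lemma P_negative: "l < 0 \<Longrightarrow> EP l u = 0"
  using eigenspace_negative[OF P_in] .

lemma cinner_P: "e \<in> eigenspace H0 l \<Longrightarrow> cinner (EP l u) e = cinner u e"
  using orth_proj_orthogonal[OF csubspace_eigenspace closed_eigenspace, of e l u]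
  by (simp add: cinner_diff_left)

lemma bessel:
  assumes "finite F"
  shows "(\<Sum>l\<in>F. (norm (EP l u))\<^sup>2) \<le> (norm u)\<^sup>2"
proof -
  let ?s = "\<Sum>l\<in>F. EP l u"
  have s: "(norm ?s)\<^sup>2 = (\<Sum>l\<in>F. (norm (EP l u))\<^sup>2)"
    using assms by (rule norm_sum_orthogonal_sq) (rule P_orthogonal)
  have "cinner u ?s = (\<Sum>l\<in>F. cinner u (EP l u))"
    by (rule bounded_bilinear.sum_right[OF bounded_bilinear_cinner])
  also have "\<dots> = (\<Sum>l\<in>F. cinner (EP l u) (EP l u))"
    by (intro sum.cong refl cinner_P[symmetric] P_in)
  finally have "Re (cinner u ?s) = (\<Sum>l\<in>F. (norm (EP l u))\<^sup>2)" by (simp add: cinner_self)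
  then show ?thesis using norm_diff_sq[of u ?s] s zero_le_power2[of "norm (u - ?s)"] by linarith
qed

lemma P_sq_summable: "(\<lambda>l. (norm (EP l u))\<^sup>2) summable_on UNIV"
  by (intro nonneg_bdd_above_summable_on bdd_aboveI2[where M = "(norm u)\<^sup>2"]) (auto intro: bessel)

text \<open>Components may be prescribed: every square-summable choice of one vector per eigenspace
  is the component family of its sum. This is what gives \<open>fc\<close> its meaning on
  \<open>fc_dom\<close>.\<close>

lemma eigenvector_series:
  assumes x: "\<And>l. x l \<in> eigenspace H0 l" and sq: "(\<lambda>l. (norm (x l))\<^sup>2) summable_on UNIV"
  shows "(x has_sum infsum x UNIV) UNIV" "EP l (infsum x UNIV) = x l"
proof -
  have "x summable_on UNIV"
    using eigenspace_orthogonal x by (intro summable_on_orthogonal sq) blast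
  then show has: "(x has_sum infsum x UNIV) UNIV" by simp
  show "EP l (infsum x UNIV) = x l"
  proof (rule orth_proj_unique[OF csubspace_eigenspace x])
    fix e assume e: "e \<in> eigenspace H0 l"
    have "((\<lambda>i. cinner (x i) e) has_sum cinner (infsum x UNIV) e) UNIV"
      by (rule has_sum_bounded_linear[OF bounded_linear_cinner_left has])
    moreover have "((\<lambda>i. cinner (x i) e) has_sum cinner (x l) e) UNIV"
    proof -
      have "((\<lambda>i. cinner (x i) e) has_sum cinner (x l) e) {l}" by (rule has_sum_finiteI) auto
      then show ?thesis
        by (rule has_sum_cong_neutral[THEN iffD1, rotated -1])
           (use eigenspace_orthogonal[OF x e] in auto)
    qed
    ultimately show "cinner (infsum x UNIV - x l) e = 0"
      by (simp add: cinner_diff_left has_sum_unique)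
  qed
qed

text \<open>The series has the same components as u, so its difference from u is orthogonal to all
  eigenvectors and vanishes by completeness.\<close>

lemma P_has_sum: "((\<lambda>l. EP l u) has_sum u) UNIV"
proof -
  let ?v = "\<Sum>\<^sub>\<infinity>l. EP l u"
  have v: "EP l ?v = EP l u" for l by (rule eigenvector_series(2)[OF P_in P_sq_summable])
  have "u - ?v = 0"
  proof (rule eigenvectors_complete)
    fix l e assume e: "e \<in> eigenspace H0 l"
    have "cinner (u - ?v) e = cinner (EP l (u - ?v)) e" by (rule cinner_P[OF e, symmetric])
    also have "\<dots> = 0" by (simp add: P_diff v)
    finally show "cinner (u - ?v) e = 0" .
  qed
  then show ?thesis using eigenvector_series(1)[OF P_in P_sq_summable, of u] by simp
qed

lemma parseval: "((\<lambda>l. cinner (EP l u) (EP l v)) has_sum cinner u v) UNIV"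
proof -
  have "cinner (EP l u) v = cinner (EP l u) (EP l v)" for l
    using cinner_P[OF P_in, of l v u] cinner_commute by metis
  then show ?thesis
    using has_sum_bounded_linear[OF bounded_linear_cinner_left P_has_sum, of u v] by simp
qed

lemma parseval_norm: "((\<lambda>l. (norm (EP l u))\<^sup>2) has_sum (norm u)\<^sup>2) UNIV"
  using has_sum_Re[OF parseval[of u u]] by (simp add: cinner_self)

text \<open>The standard way below to prove identities between functions of \<open>H0\<close>.
  Negative l are exempt because positivity leaves no eigenvectors there.\<close>

lemma P_ext:
  assumes "\<And>l. l \<ge> 0 \<Longrightarrow> EP l u = EP l v"
  shows "u = v"
proof -
  have "EP l u = EP l v" for l using assms P_negative by (cases "l < 0") auto
  then show ?thesis using has_sum_unique[OF P_has_sum[of u]] P_has_sum[of v] by simp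
qed

lemma P_fc: "u \<in> fc_dom H0 f \<Longrightarrow> EP l (fc H0 f u) = f l *\<^sub>R EP l u"
  unfolding fc_def
  by (rule eigenvector_series(2))
     (auto simp: fc_dom_def power_mult_distrib intro: csubspace_scaleR[OF csubspace_eigenspace P_in])

lemma norm_fc_has_sum:
  "u \<in> fc_dom H0 f \<Longrightarrow> ((\<lambda>l. (f l)\<^sup>2 * (norm (EP l u))\<^sup>2) has_sum (norm (fc H0 f u))\<^sup>2) UNIV"
  using parseval_norm[of "fc H0 f u"] by (simp add: P_fc power_mult_distrib)

text \<open>Parseval turns a pointwise comparison of weights on the half-line into a comparison of
  norms. The embeddings of the scale, the contractivity of cutoffs and the rate of the spectral tail
  are all instances.\<close>

lemma fc_dom_mono:
  assumes u: "u \<in> fc_dom H0 g" and le: "\<And>l. l \<ge> 0 \<Longrightarrow> \<bar>f l\<bar> \<le> K * \<bar>g l\<bar>"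
  shows "u \<in> fc_dom H0 f" "K \<ge> 0 \<Longrightarrow> norm (fc H0 f u) \<le> K * norm (fc H0 g u)"
proof -
  have *: "(f l)\<^sup>2 * (norm (EP l u))\<^sup>2 \<le> K\<^sup>2 * ((g l)\<^sup>2 * (norm (EP l u))\<^sup>2)" for l
  proof (cases "l < 0")
    case False
    then have "\<bar>f l\<bar>\<^sup>2 \<le> (K * \<bar>g l\<bar>)\<^sup>2" by (intro power_mono le) auto
    then have "(f l)\<^sup>2 \<le> K\<^sup>2 * (g l)\<^sup>2" by (simp add: power_mult_distrib)
    then show ?thesis by (simp add: mult.assoc[symmetric] mult_right_mono)
  qed (simp add: P_negative)
  have g: "((\<lambda>l. K\<^sup>2 * ((g l)\<^sup>2 * (norm (EP l u))\<^sup>2)) has_sum K\<^sup>2 * (norm (fc H0 g u))\<^sup>2) UNIV"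
    by (intro has_sum_cmult_right norm_fc_has_sum u)
  show dom: "u \<in> fc_dom H0 f"
    unfolding fc_dom_def mem_Collect_eq
    by (rule summable_on_comparison_test[OF has_sum_imp_summable[OF g]]) (use * in auto)
  assume K: "K \<ge> 0"
  have "(norm (fc H0 f u))\<^sup>2 \<le> K\<^sup>2 * (norm (fc H0 g u))\<^sup>2"
    by (rule has_sum_mono[OF norm_fc_has_sum[OF dom] g *])
  then show "norm (fc H0 f u) \<le> K * norm (fc H0 g u)"
    using K by (simp flip: power_mult_distrib)
qed

lemma fc_dom_one: "u \<in> fc_dom H0 (\<lambda>_. 1)"
  by (simp add: fc_dom_def P_sq_summable)

lemma fc_one: "fc H0 (\<lambda>_. 1) u = u"
  by (rule P_ext) (simp add: P_fc fc_dom_one)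

lemma fc_dom_bounded: "(\<And>l. l \<ge> 0 \<Longrightarrow> \<bar>f l\<bar> \<le> K) \<Longrightarrow> u \<in> fc_dom H0 f"
  by (rule fc_dom_mono(1)[OF fc_dom_one, where K = K]) simp

lemma norm_fc_le:
  assumes "\<And>l. l \<ge> 0 \<Longrightarrow> \<bar>f l\<bar> \<le> K" 
  shows "norm (fc H0 f u) \<le> K * norm u"
proof -
  have "K \<ge> 0" using assms[of 0] abs_ge_zero[of "f 0"] by linarith
  then show ?thesis using fc_dom_mono(2)[OF fc_dom_one, of f K u] assms by (simp add: fc_one)
qed

lemma csubspace_fc_dom: "csubspace (fc_dom H0 f)"
  unfolding csubspace_def
proof (intro conjI ballI allI)
  show "0 \<in> fc_dom H0 f" using P_scaleR[of _ 0] by (simp add: fc_dom_def)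
  fix u assume u: "u \<in> fc_dom H0 f"
  show "z *\<^sub>C u \<in> fc_dom H0 f" for z
    using u summable_on_cmult_right[of "\<lambda>l. (f l)\<^sup>2 * (norm (EP l u))\<^sup>2" UNIV "(cmod z)\<^sup>2"]
    by (simp add: fc_dom_def P_scaleC norm_scaleC power_mult_distrib mult.left_commute)
  fix v assume v: "v \<in> fc_dom H0 f"
  let ?g = "\<lambda>l. 2 * ((f l)\<^sup>2 * (norm (EP l u))\<^sup>2) + 2 * ((f l)\<^sup>2 * (norm (EP l v))\<^sup>2)"
  have "?g summable_on UNIV"
    using u v by (intro summable_on_add summable_on_cmult_right) (auto simp: fc_dom_def)
  then show "u + v \<in> fc_dom H0 f"
    unfolding fc_dom_def mem_Collect_eq
  proof (rule summable_on_comparison_test)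
    fix l
    have "(norm (EP l u + EP l v))\<^sup>2 \<le> (norm (EP l u) + norm (EP l v))\<^sup>2"
      by (intro power_mono norm_triangle_ineq) simp
    also have "\<dots> \<le> 2 * (norm (EP l u))\<^sup>2 + 2 * (norm (EP l v))\<^sup>2"
      using sum_squares_bound[of "norm (EP l u)" "norm (EP l v)"] by (simp add: power2_sum)
    finally have "(f l)\<^sup>2 * (norm (EP l (u + v)))\<^sup>2
        \<le> (f l)\<^sup>2 * (2 * (norm (EP l u))\<^sup>2 + 2 * (norm (EP l v))\<^sup>2)"
      unfolding P_add by (intro mult_left_mono) auto
    then show "(f l)\<^sup>2 * (norm (EP l (u + v)))\<^sup>2 \<le> ?g l" by (simp add: algebra_simps)
  qed simp
qed

lemma clinear_on_fc: "clinear_on (fc_dom H0 f) (fc H0 f)"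
  unfolding clinear_on_def
proof (intro conjI ballI allI)
  fix u assume u: "u \<in> fc_dom H0 f"
  then have "z *\<^sub>C u \<in> fc_dom H0 f" for z using csubspace_fc_dom by (simp add: csubspace_def)
  then show "fc H0 f (z *\<^sub>C u) = z *\<^sub>C fc H0 f u" for z
    using u by - (rule P_ext, simp add: P_fc P_scaleC scaleC_scaleR_commute)
  fix v assume v: "v \<in> fc_dom H0 f"
  then have "u + v \<in> fc_dom H0 f" using u csubspace_fc_dom by (simp add: csubspace_def)
  then show "fc H0 f (u + v) = fc H0 f u + fc H0 f v"
    using u v by - (rule P_ext, simp add: P_fc P_add scaleR_add_right)
qed

lemma fc_comp:
  assumes u: "u \<in> fc_dom H0 g"
  shows "fc H0 g u \<in> fc_dom H0 f \<longleftrightarrow> u \<in> fc_dom H0 (\<lambda>l. f l * g l)"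
    and "fc H0 g u \<in> fc_dom H0 f \<Longrightarrow> fc H0 f (fc H0 g u) = fc H0 (\<lambda>l. f l * g l) u"
proof -
  show iff: "fc H0 g u \<in> fc_dom H0 f \<longleftrightarrow> u \<in> fc_dom H0 (\<lambda>l. f l * g l)"
    using u by (simp add: fc_dom_def[of H0 f] fc_dom_def[of H0 "\<lambda>l. f l * g l"] P_fc
        power_mult_distrib mult.assoc)
  assume "fc H0 g u \<in> fc_dom H0 f"
  then show "fc H0 f (fc H0 g u) = fc H0 (\<lambda>l. f l * g l) u"
    using u iff by - (rule P_ext, simp add: P_fc)
qed

lemma fc_symmetric:
  assumes "u \<in> fc_dom H0 f" "v \<in> fc_dom H0 f"
  shows "cinner (fc H0 f u) v = cinner u (fc H0 f v)"
  using has_sum_unique[OF parseval[of "fc H0 f u" v]] parseval[of u "fc H0 f v"] assms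
  by (simp add: P_fc cinner_scaleR_left cinner_scaleR_right)

section \<open>The scale of spaces as weighted square-summable components\<close>

abbreviation wt :: "real \<Rightarrow> real \<Rightarrow> real" where
  "wt r l \<equiv> (1 + l) powr r"

lemma csubspace_sob: "csubspace (sob H0 r)"
  unfolding sob_def by (rule csubspace_fc_dom)

lemma clinear_on_Lambda: "clinear_on (sob H0 r) (Lambda_pow H0 r)"
  unfolding sob_def Lambda_pow_def by (rule clinear_on_fc)

lemmas Lambda_linear = clinear_onD[OF clinear_on_Lambda _ csubspace_sob]

lemma sob_norm_scaleR: "u \<in> sob H0 r \<Longrightarrow> sob_norm H0 r (c *\<^sub>R u) = \<bar>c\<bar> * sob_norm H0 r u"
  by (simp add: sob_norm_def Lambda_linear)

lemma sob_norm_triangle: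
  "u \<in> sob H0 r \<Longrightarrow> v \<in> sob H0 r \<Longrightarrow> sob_norm H0 r (u + v) \<le> sob_norm H0 r u + sob_norm H0 r v"
  by (simp add: sob_norm_def Lambda_linear norm_triangle_ineq)

lemma sob_norm_nonneg: "0 \<le> sob_norm H0 r u"
  by (simp add: sob_norm_def)

lemma sob_mono:
  assumes "p \<le> q" "u \<in> sob H0 q"
  shows "u \<in> sob H0 p" "sob_norm H0 p u \<le> sob_norm H0 q u"
  using fc_dom_mono[of u "wt q" "wt p" 1] assms powr_mono[of p q]
  by (auto simp: sob_def sob_norm_def Lambda_pow_def)

lemma sob_norm_zero: "sob_norm H0 0 u = norm u"
proof -
  have 1: "u \<in> sob H0 0" unfolding sob_def by (rule fc_dom_bounded[where K = 1]) simp
  \<comment> \<open>The weight of order 0 is not the constant 1: at l = -1 it is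
    \<open>0 powr 0\<close>, which is 0. The comparison over nonnegative l avoids this
    point.\<close>
  have "fc H0 (wt 0) u = u" using 1 by - (rule P_ext, simp add: P_fc sob_def)
  then show "sob_norm H0 0 u = norm u" by (simp add: sob_norm_def Lambda_pow_def)
qed

lemma norm_le_sob_norm: "r \<ge> 0 \<Longrightarrow> u \<in> sob H0 r \<Longrightarrow> norm u \<le> sob_norm H0 r u"
  using sob_mono(2)[of 0 r u] by (simp add: sob_norm_zero)

section \<open>Spectral cutoffs\<close>

lemma cutoff_dom: "u \<in> fc_dom H0 (indicator {0..N})"
  by (rule fc_dom_bounded[where K = 1]) (simp add: indicator_def)

lemma P_cutoff: "EP l (cutoff H0 N u) = indicator {0..N} l *\<^sub>R EP l u"
  unfolding cutoff_def by (rule P_fc[OF cutoff_dom])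

lemma csubspace_UNIV: "csubspace UNIV" by (simp add: csubspace_def)

lemma clinear_on_cutoff: "clinear_on UNIV (cutoff H0 N)"
  using clinear_on_fc[of "indicator {0..N}"] cutoff_dom by (simp add: clinear_on_def cutoff_def)

lemmas cutoff_linear = clinear_onD[OF clinear_on_cutoff UNIV_I csubspace_UNIV]

lemma norm_cutoff_le: "norm (cutoff H0 N u) \<le> norm u"
  using norm_fc_le[of "indicator {0..N}" 1 u] by (simp add: cutoff_def indicator_def)

lemma bounded_linear_cutoff: "bounded_linear (cutoff H0 N)"
  by (rule bounded_linear_intro[where K = 1]) (simp_all add: cutoff_linear norm_cutoff_le)

lemma cutoff_cutoff: "N \<le> N' \<Longrightarrow> cutoff H0 N' (cutoff H0 N u) = cutoff H0 N u"
  "N \<le> N' \<Longrightarrow> cutoff H0 N (cutoff H0 N' u) = cutoff H0 N u"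
  by (rule P_ext; simp add: P_cutoff indicator_def)+

lemma cutoff_symmetric: "cinner (cutoff H0 N u) v = cinner u (cutoff H0 N v)"
  unfolding cutoff_def by (rule fc_symmetric[OF cutoff_dom cutoff_dom])

lemma cutoff_space_iff: "u \<in> cutoff_space H0 N \<longleftrightarrow> cutoff H0 N u = u"
  using cutoff_cutoff(1)[of N N] by (auto simp: cutoff_space_def) (metis rangeI)

lemma csubspace_cutoff_space: "csubspace (cutoff_space H0 N)"
  by (auto simp: csubspace_def cutoff_space_iff cutoff_linear)

text \<open>The absolute value makes the bound valid for all real N; for negative N the interval is
  empty and the left side is 0.\<close>

lemma wt_indicator_le:
  "r \<ge> 0 \<Longrightarrow> l \<ge> 0 \<Longrightarrow> \<bar>wt r l * indicator {0..N} l\<bar> \<le> wt r \<bar>N\<bar>"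
  by (auto simp: indicator_def intro!: powr_mono2)

lemma wt_indicator_dom: "r \<ge> 0 \<Longrightarrow> u \<in> fc_dom H0 (\<lambda>l. wt r l * indicator {0..N} l)"
  by (rule fc_dom_bounded) (rule wt_indicator_le)

lemma norm_fc_wt_indicator_le:
  "r \<ge> 0 \<Longrightarrow> norm (fc H0 (\<lambda>l. wt r l * indicator {0..N} l) u) \<le> wt r \<bar>N\<bar> * norm u"
  by (rule norm_fc_le) (rule wt_indicator_le)

lemma cutoff_in_sob: "r \<ge> 0 \<Longrightarrow> cutoff H0 N u \<in> sob H0 r"
  unfolding sob_def cutoff_def fc_comp(1)[OF cutoff_dom] by (rule wt_indicator_dom)

lemma cutoff_in_sob_inf: "cutoff H0 N u \<in> sob_inf H0"
  by (simp add: sob_inf_def cutoff_in_sob)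

lemma Lambda_cutoff: "r \<ge> 0 \<Longrightarrow> Lambda_pow H0 r (cutoff H0 N u) = fc H0 (\<lambda>l. wt r l * indicator {0..N} l) u"
  unfolding Lambda_pow_def using cutoff_in_sob[of r N u]
  by (simp add: fc_comp(2)[OF cutoff_dom] cutoff_def sob_def)

lemma sob_norm_cutoff_le: "r \<ge> 0 \<Longrightarrow> N \<ge> 0 \<Longrightarrow> sob_norm H0 r (cutoff H0 N u) \<le> (1 + N) powr r * norm u"
  using norm_fc_wt_indicator_le[of r N u] by (simp add: sob_norm_def Lambda_cutoff)

lemma sob_norm_cutoff_le_sob_norm:
  assumes "r \<ge> 0" "u \<in> sob H0 r"
  shows "sob_norm H0 r (cutoff H0 N u) \<le> sob_norm H0 r u"
  unfolding sob_norm_def Lambda_cutoff[OF assms(1)]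
  using fc_dom_mono(2)[of u "wt r" "\<lambda>l. wt r l * indicator {0..N} l" 1] assms
  by (simp add: sob_def Lambda_pow_def indicator_def)

text \<open>Above N the weight of order r is at least \<open>(1 + N) powr r\<close>, so the
  indicator of the tail is dominated by the weight times the inverse of this number. Each order of
  regularity buys one power of 1 + N.\<close>

lemma norm_diff_cutoff_le:
  assumes r: "r \<ge> 0" and N: "N \<ge> 0" and u: "u \<in> sob H0 r"
  shows "norm (u - cutoff H0 N u) \<le> (1 + N) powr (- r) * sob_norm H0 r u"
proof -
  let ?f = "indicator {N<..} :: real \<Rightarrow> real"
  have dom: "u \<in> fc_dom H0 ?f" by (rule fc_dom_bounded[where K = 1]) (simp add: indicator_def)
  have "u - cutoff H0 N u = fc H0 ?f u"
    by (rule P_ext) (auto simp: P_fc[OF dom] P_diff P_cutoff indicator_def)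
  moreover have "\<bar>?f l\<bar> \<le> (1 + N) powr (- r) * \<bar>wt r l\<bar>" if "l \<ge> 0" for l
  proof -
    have "(1 + N) powr r \<le> wt r l" if "l > N" using r N that by (intro powr_mono2) auto
    then show ?thesis using N that by (auto simp: indicator_def powr_minus field_simps)
  qed
  ultimately show ?thesis
    using fc_dom_mono(2)[of u "wt r" ?f "(1 + N) powr (- r)"] u
    by (simp add: sob_def sob_norm_def Lambda_pow_def)
qed

lemma norm_cutoff_diff_le:
  assumes "r \<ge> 0" "N \<ge> 0" "N \<le> N'" "u \<in> sob H0 r"
  shows "norm (cutoff H0 N' u - cutoff H0 N u) \<le> (1 + N) powr (- r) * sob_norm H0 r u"
proof -
  have "cutoff H0 N' u - cutoff H0 N u = cutoff H0 N' (u - cutoff H0 N u)"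
    using assms by (simp add: cutoff_linear cutoff_cutoff)
  then show ?thesis
    using norm_cutoff_le[of N' "u - cutoff H0 N u"] norm_diff_cutoff_le[OF assms(1,2,4)] by simp
qed

text \<open>By Pythagoras the squared error is the loss of squared norm under the cutoff, and by
  Parseval finitely many components carry almost all of that norm. Once N exceeds their eigenvalues,
  the loss is small.\<close>

lemma cutoff_tendsto: "((\<lambda>N. cutoff H0 N u) \<longlongrightarrow> u) at_top"
proof (rule tendstoI)
  fix e :: real assume e: "e > 0"
  obtain F where F: "finite F" "dist (\<Sum>l\<in>F. (norm (EP l u))\<^sup>2) ((norm u)\<^sup>2) < e\<^sup>2"
  proof -
    have "\<forall>\<^sub>F F in finite_subsets_at_top UNIV. dist (\<Sum>l\<in>F. (norm (EP l u))\<^sup>2) ((norm u)\<^sup>2) < e\<^sup>2"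
      using parseval_norm[of u] e unfolding has_sum_def by (intro tendstoD) auto
    then show ?thesis using that by (auto simp: eventually_finite_subsets_at_top)
  qed
  have "norm (cutoff H0 N u - u) < e" if N: "\<forall>l\<in>F. l \<le> N" for N
  proof -
    have "cinner (cutoff H0 N u) u = cinner (cutoff H0 N u) (cutoff H0 N u)"
      using cutoff_symmetric[of N "cutoff H0 N u" u] by (simp add: cutoff_cutoff)
    then have "(norm (cutoff H0 N u - u))\<^sup>2 = (norm u)\<^sup>2 - (norm (cutoff H0 N u))\<^sup>2"
      by (simp add: norm_diff_sq cinner_self)
    moreover have "(\<Sum>l\<in>F. (norm (EP l u))\<^sup>2) \<le> (norm (cutoff H0 N u))\<^sup>2"
    proof -
      have "norm (EP l u) = norm (EP l (cutoff H0 N u))" if "l \<in> F" for l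
        using N that P_negative[of l u] by (cases "l < 0") (auto simp: P_cutoff indicator_def)
      then show ?thesis using bessel[OF F(1), of "cutoff H0 N u"] by simp
    qed
    ultimately have "(norm (cutoff H0 N u - u))\<^sup>2 < e\<^sup>2" using F(2) unfolding dist_real_def by linarith
    then show ?thesis using e by (simp add: power2_less_imp_less)
  qed
  moreover have "\<forall>\<^sub>F N in at_top. \<forall>l\<in>F. l \<le> N"
    using F(1) by (simp add: eventually_ball_finite eventually_ge_at_top)
  ultimately show "\<forall>\<^sub>F N in at_top. dist (cutoff H0 N u) u < e"
    by (auto simp: dist_norm elim: eventually_mono)
qed

text \<open>On the range of the cutoff, the square of the Sobolev norm is the quadratic form of a bounded
  operator, which makes it differentiable along the truncated dynamics.\<close>

lemma sob_norm_sq_cutoff: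
  assumes "r \<ge> 0"
  shows "cinner v (Lambda_pow H0 (2 * r) (cutoff H0 N v)) = complex_of_real ((sob_norm H0 r (cutoff H0 N v))\<^sup>2)"
proof -
  let ?f = "\<lambda>l. wt r l * indicator {0..N} l"
  have dom: "u \<in> fc_dom H0 ?f" for u by (rule wt_indicator_dom[OF assms])
  have dom2: "v \<in> fc_dom H0 (\<lambda>l. ?f l * ?f l)" using fc_comp(1)[OF dom, of v ?f] dom by simp
  have dom3: "v \<in> fc_dom H0 (\<lambda>l. wt (2 * r) l * indicator {0..N} l)"
    by (rule wt_indicator_dom) (use assms in simp)
  have "Lambda_pow H0 (2 * r) (cutoff H0 N v) = fc H0 (\<lambda>l. ?f l * ?f l) v"
    unfolding Lambda_cutoff[of "2 * r", simplified, OF assms]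
    by (rule P_ext) (simp add: P_fc[OF dom2] P_fc[OF dom3] split: split_indicator flip: powr_add)
  also have "\<dots> = fc H0 ?f (fc H0 ?f v)" by (rule fc_comp(2)[OF dom dom, symmetric])
  finally have "cinner v (Lambda_pow H0 (2 * r) (cutoff H0 N v)) = cinner (fc H0 ?f v) (fc H0 ?f v)"
    by (simp add: fc_symmetric[OF dom dom])
  then show ?thesis by (simp add: cinner_self sob_norm_def Lambda_cutoff[OF assms])
qed

lemma bounded_linear_Lambda_cutoff:
  assumes "r \<ge> 0"
  shows "bounded_linear (\<lambda>v. Lambda_pow H0 r (cutoff H0 N v))"
proof (rule bounded_linear_intro[where K = "wt r \<bar>N\<bar>"])
  show "norm (Lambda_pow H0 r (cutoff H0 N x)) \<le> norm x * wt r \<bar>N\<bar>" for x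
    unfolding Lambda_cutoff[OF assms] using norm_fc_wt_indicator_le[OF assms, of N x]
    by (simp add: mult.commute)
qed (simp_all add: cutoff_linear Lambda_linear cutoff_in_sob assms)

lemma Lambda_cutoff_symmetric:
  assumes "r \<ge> 0"
  shows "cinner (Lambda_pow H0 r (cutoff H0 N u)) v = cinner u (Lambda_pow H0 r (cutoff H0 N v))"
  unfolding Lambda_cutoff[OF assms] by (intro fc_symmetric wt_indicator_dom assms)

text \<open>Functions of \<open>H0\<close> commute, so a cutoff moved across an inner product onto
  the weighted vector is absorbed there.\<close>

lemma cutoff_Lambda_cutoff:
  assumes "r \<ge> 0"
  shows "cutoff H0 N (Lambda_pow H0 r (cutoff H0 N u)) = Lambda_pow H0 r (cutoff H0 N u)"
  unfolding Lambda_cutoff[OF assms]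
  by (rule P_ext) (simp add: P_cutoff P_fc[OF wt_indicator_dom[OF assms]] split: split_indicator)

end

section \<open>Linear evolution equations\<close>

lemma vector_lipschitz:
  fixes f :: "real \<Rightarrow> 'b::real_normed_vector"
  assumes "convex J" "\<And>x. x \<in> J \<Longrightarrow> (f has_vector_derivative f' x) (at x within J)"
    and "\<And>x. x \<in> J \<Longrightarrow> norm (f' x) \<le> B" and "s \<in> J" "t \<in> J"
  shows "norm (f t - f s) \<le> B * \<bar>t - s\<bar>"
proof -
  have "norm (f t - f s) \<le> B * norm (t - s)"
  proof (rule differentiable_bound[OF assms(1) _ _ assms(5,4)])
    fix x assume x: "x \<in> J"
    show "(f has_derivative (\<lambda>h. h *\<^sub>R f' x)) (at x within J)"
      using assms(2)[OF x] by (simp add: has_vector_derivative_def)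
    show "onorm (\<lambda>h. h *\<^sub>R f' x) \<le> B"
      by (rule onorm_le) (use mult_left_mono[OF assms(3)[OF x] abs_ge_zero] in \<open>simp add: mult.commute\<close>)
  qed
  then show ?thesis by simp
qed

text \<open>The norm itself need not be differentiable, so the argument uses the smooth
  \<open>sqrt ((norm z)\<^sup>2 + \<epsilon>\<^sup>2)\<close> instead.\<close>

lemma norm_growth:
  fixes z :: "real \<Rightarrow> 'a::complex_hilbert"
  assumes J: "convex J"
    and z: "\<And>\<tau>. \<tau> \<in> J \<Longrightarrow> (z has_vector_derivative z' \<tau>) (at \<tau> within J)"
    and le: "\<And>\<tau>. \<tau> \<in> J \<Longrightarrow> \<bar>Re (cinner (z' \<tau>) (z \<tau>))\<bar> \<le> K * norm (z \<tau>)"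
    and K: "K \<ge> 0" and st: "s \<in> J" "t \<in> J"
  shows "norm (z t) \<le> norm (z s) + K * \<bar>t - s\<bar>"
proof (rule field_le_epsilon)
  fix e :: real assume e: "e > 0"
  define \<phi> where "\<phi> \<tau> = sqrt ((norm (z \<tau>))\<^sup>2 + e\<^sup>2)" for \<tau>
  have pos: "(norm (z \<tau>))\<^sup>2 + e\<^sup>2 > 0" for \<tau> using e by (simp add: add_nonneg_pos)
  have low: "norm (z \<tau>) \<le> \<phi> \<tau>" for \<tau>
    unfolding \<phi>_def by (rule real_le_rsqrt) simp
  have up: "\<phi> \<tau> \<le> norm (z \<tau>) + e" for \<tau>
    unfolding \<phi>_def using e by (intro real_le_lsqrt) (auto simp: power2_sum)
  have "norm (\<phi> t - \<phi> s) \<le> K * \<bar>t - s\<bar>"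
  proof (rule vector_lipschitz[OF J _ _ st])
    fix \<tau> assume \<tau>: "\<tau> \<in> J"
    have "((\<lambda>\<tau>. cinner (z \<tau>) (z \<tau>)) has_vector_derivative
        cinner (z \<tau>) (z' \<tau>) + cinner (z' \<tau>) (z \<tau>)) (at \<tau> within J)"
      by (intro has_vector_derivative_cinner z \<tau>)
    then have "((\<lambda>\<tau>. Re (cinner (z \<tau>) (z \<tau>))) has_vector_derivative
        Re (cinner (z \<tau>) (z' \<tau>) + cinner (z' \<tau>) (z \<tau>))) (at \<tau> within J)"
      by (rule bounded_linear.has_vector_derivative[OF bounded_linear_Re])
    moreover have "Re (cinner (z \<tau>) (z' \<tau>)) = Re (cinner (z' \<tau>) (z \<tau>))"
      by (subst cinner_commute) simp
    ultimately have "((\<lambda>\<tau>. (norm (z \<tau>))\<^sup>2) has_real_derivative 2 * Re (cinner (z' \<tau>) (z \<tau>))) (at \<tau> within J)"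
      by (simp add: cinner_self has_real_derivative_iff_has_vector_derivative)
    then have "((\<lambda>\<tau>. (norm (z \<tau>))\<^sup>2 + e\<^sup>2) has_real_derivative 2 * Re (cinner (z' \<tau>) (z \<tau>))) (at \<tau> within J)"
      using DERIV_add[OF _ DERIV_const[of "e\<^sup>2"]] by fastforce
    then have "(\<phi> has_real_derivative (inverse (\<phi> \<tau>) / 2) * (2 * Re (cinner (z' \<tau>) (z \<tau>)))) (at \<tau> within J)"
      unfolding \<phi>_def by (rule DERIV_chain2[where g = "\<lambda>\<tau>. (norm (z \<tau>))\<^sup>2 + e\<^sup>2", OF DERIV_real_sqrt[OF pos]])
    then show "(\<phi> has_vector_derivative inverse (\<phi> \<tau>) * Re (cinner (z' \<tau>) (z \<tau>))) (at \<tau> within J)"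
      by (simp add: has_real_derivative_iff_has_vector_derivative)
    \<comment> \<open>The regularisation leaves no trace in the bound of the derivative: as \<phi>
      dominates the norm of z, the quotient stays below K for every e.\<close>
    have "\<phi> \<tau> > 0" unfolding \<phi>_def using pos by simp
    moreover have "\<bar>Re (cinner (z' \<tau>) (z \<tau>))\<bar> \<le> K * \<phi> \<tau>"
      using le[OF \<tau>] mult_left_mono[OF low[of \<tau>] K] by linarith
    ultimately show "norm (inverse (\<phi> \<tau>) * Re (cinner (z' \<tau>) (z \<tau>))) \<le> K"
      by (simp add: abs_mult field_simps)
  qed
  then show "norm (z t) \<le> norm (z s) + K * \<bar>t - s\<bar> + e"
    using low[of t] up[of s] by (simp add: abs_le_iff)
qed

text \<open>A discrete form, in which \<phi> is controlled through increments and not through a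
  derivative. The factors 1 + d are replaced by exp d and multiplied up, while n + 1 errors
  quadratic in the step add up to O(1/n). The increment bound for both orders of p and q lets time
  run either way.\<close>

lemma gronwall:
  fixes \<phi> G :: "real \<Rightarrow> real"
  assumes G: "mono_on {a..b} G" and K: "K \<ge> 0" and \<phi>: "\<And>p. p \<in> {a..b} \<Longrightarrow> 0 \<le> \<phi> p"
    and step: "\<And>p q. p \<in> {a..b} \<Longrightarrow> q \<in> {a..b} \<Longrightarrow>
      \<phi> q - \<phi> p \<le> \<bar>G q - G p\<bar> * \<phi> p + K * (q - p)\<^sup>2"
    and st: "s \<in> {a..b}" "t \<in> {a..b}"
  shows "\<phi> t \<le> exp \<bar>G t - G s\<bar> * \<phi> s"
proof -
  have main: "\<phi> t \<le> exp \<bar>G t - G s\<bar> * (\<phi> s + (K * (t - s)\<^sup>2) * (1 / real (Suc n)))" for n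
  proof -
    define m where "m = real (Suc n)"
    have m: "m > 0" by (simp add: m_def)
    define h where "h = (t - s) / m"
    define p where "p j = s + real j * h" for j
    have pin: "p j \<in> {a..b}" if "j \<le> Suc n" for j
    proof -
      have "p j = (1 - real j / m) *\<^sub>R s + (real j / m) *\<^sub>R t"
        by (simp add: p_def h_def algebra_simps diff_divide_distrib)
      also have "\<dots> \<in> {a..b}"
        using that st m by (intro convexD_alt[OF convex_real_interval(5)]) (auto simp: m_def divide_le_eq)
      finally show ?thesis .
    qed
    \<comment> \<open>The partition moves in one direction from s to t, so the increments of a
      monotone function along it have one sign and their absolute values add without loss.\<close>
    have add: "\<bar>G (p (Suc j)) - G (p j)\<bar> + \<bar>G (p j) - G s\<bar> = \<bar>G (p (Suc j)) - G s\<bar>"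
      if j: "Suc j \<le> Suc n" for j
    proof (cases "s \<le> t")
      case True
      then have "h \<ge> 0" using m by (simp add: h_def)
      then have "s \<le> p j" "p j \<le> p (Suc j)" by (auto simp: p_def algebra_simps)
      then have "G s \<le> G (p j)" "G (p j) \<le> G (p (Suc j))"
        using j st pin by (auto intro!: mono_onD[OF G])
      then show ?thesis by simp
    next
      case False
      then have "h \<le> 0" using m by (simp add: h_def divide_nonpos_pos)
      then have "p j \<le> s" "p (Suc j) \<le> p j" using mult_nonneg_nonpos[of "real j" h] by (auto simp: p_def algebra_simps)
      then have "G (p j) \<le> G s" "G (p (Suc j)) \<le> G (p j)"
        using j st pin by (auto intro!: mono_onD[OF G])
      then show ?thesis by simp
    qed
    have "\<phi> (p j) \<le> exp \<bar>G (p j) - G s\<bar> * (\<phi> s + real j * (K * h\<^sup>2))" if "j \<le> Suc n" for j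
      using that
    proof (induction j)
      case (Suc j)
      let ?d = "\<bar>G (p (Suc j)) - G (p j)\<bar>"
      have "\<phi> (p (Suc j)) - \<phi> (p j) \<le> ?d * \<phi> (p j) + K * (p (Suc j) - p j)\<^sup>2"
        using Suc.prems by (intro step pin) auto
      moreover have "p (Suc j) - p j = h" by (simp add: p_def algebra_simps)
      ultimately have "\<phi> (p (Suc j)) \<le> (1 + ?d) * \<phi> (p j) + K * h\<^sup>2" by (simp add: algebra_simps)
      also have "\<dots> \<le> exp ?d * \<phi> (p j) + exp ?d * (exp \<bar>G (p j) - G s\<bar> * (K * h\<^sup>2))"
      proof (rule add_mono)
        show "(1 + ?d) * \<phi> (p j) \<le> exp ?d * \<phi> (p j)"
          using Suc.prems by (intro mult_right_mono \<phi> pin) (auto simp: exp_ge_add_one_self)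
        \<comment> \<open>The exponentials are at least 1, so the fresh error may be enlarged until
          it carries the same factor as the accumulated bound.\<close>
        have "1 * (K * h\<^sup>2) \<le> (exp ?d * exp \<bar>G (p j) - G s\<bar>) * (K * h\<^sup>2)"
          using K by (intro mult_right_mono) (auto simp flip: exp_add)
        then show "K * h\<^sup>2 \<le> exp ?d * (exp \<bar>G (p j) - G s\<bar> * (K * h\<^sup>2))" by (simp add: mult.assoc)
      qed
      also have "\<dots> \<le> exp ?d * (exp \<bar>G (p j) - G s\<bar> * (\<phi> s + real j * (K * h\<^sup>2)))
          + exp ?d * (exp \<bar>G (p j) - G s\<bar> * (K * h\<^sup>2))"
        using Suc by (intro add_right_mono mult_left_mono) auto
      also have "\<dots> = exp (?d + \<bar>G (p j) - G s\<bar>) * (\<phi> s + real (Suc j) * (K * h\<^sup>2))"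
        unfolding exp_add by (simp add: algebra_simps)
      finally show ?case unfolding add[OF Suc.prems] .
    qed (simp add: p_def)
    from this[of "Suc n"] have "\<phi> (p (Suc n)) \<le> exp \<bar>G (p (Suc n)) - G s\<bar> * (\<phi> s + m * (K * h\<^sup>2))"
      by (simp only: m_def le_refl)
    moreover have "p (Suc n) = t" using m unfolding p_def h_def m_def[symmetric] by simp
    \<comment> \<open>m errors, each quadratic in the step (t - s)/m, leave a total of order
      1/m.\<close>
    moreover have "m * (K * h\<^sup>2) = K * (t - s)\<^sup>2 * (1 / m)"
      using m by (simp add: h_def power2_eq_square)
    ultimately show ?thesis by (simp only: m_def)
  qed
  have "(\<lambda>n. exp \<bar>G t - G s\<bar> * (\<phi> s + (K * (t - s)\<^sup>2) * (1 / real (Suc n))))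
      \<longlonglongrightarrow> exp \<bar>G t - G s\<bar> * (\<phi> s + (K * (t - s)\<^sup>2) * 0)"
    by (intro tendsto_intros LIMSEQ_Suc[OF lim_1_over_n])
  then have "\<phi> t \<le> exp \<bar>G t - G s\<bar> * (\<phi> s + (K * (t - s)\<^sup>2) * 0)"
    by (rule LIMSEQ_le_const) (use main in blast)
  then show ?thesis by simp
qed

text \<open>The common part of Picard iteration and of the exponential series. Differentiating
  termwise applies A to the series shifted by one place, and one summable majorant controls both the
  series and its derivative.\<close>

lemma series_solves_ode:
  fixes x :: "nat \<Rightarrow> real \<Rightarrow> 'b::banach" and A :: "real \<Rightarrow> 'b \<Rightarrow> 'b"
  assumes J: "convex J" "s \<in> J"
    and x0: "\<And>\<tau>. x 0 \<tau> = u" and xs: "\<And>n. x (Suc n) s = 0"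
    and deriv: "\<And>n \<tau>. \<tau> \<in> J \<Longrightarrow> (x (Suc n) has_vector_derivative A \<tau> (x n \<tau>)) (at \<tau> within J)"
    and bl: "\<And>\<tau>. \<tau> \<in> J \<Longrightarrow> bounded_linear (A \<tau>)"
    and K: "K \<ge> 0" "\<And>\<tau> v. \<tau> \<in> J \<Longrightarrow> norm (A \<tau> v) \<le> K * norm v"
    and M: "\<And>n \<tau>. \<tau> \<in> J \<Longrightarrow> norm (x n \<tau>) \<le> M n" "summable M"
  shows "\<exists>X. X s = u \<and> (\<forall>\<tau>\<in>J. (\<lambda>n. x n \<tau>) sums X \<tau> \<and>
           (X has_vector_derivative A \<tau> (X \<tau>)) (at \<tau> within J))"
proof -
  define X where "X \<tau> = (\<Sum>n. x n \<tau>)" for \<tau>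
  \<comment> \<open>The termwise derivatives: the constant term contributes 0, and every later term
    contributes A applied to its predecessor.\<close>
  define y where "y n \<tau> = (case n of 0 \<Rightarrow> 0 | Suc m \<Rightarrow> A \<tau> (x m \<tau>))" for n \<tau>
  define M' where "M' n = (case n of 0 \<Rightarrow> 0 | Suc m \<Rightarrow> K * M m)" for n
  have sum_x: "summable (\<lambda>n. x n \<tau>)" if "\<tau> \<in> J" for \<tau>
    by (rule summable_comparison_test'[OF M(2), where N = 0]) (rule M(1)[OF that])
  have "summable (\<lambda>n. M' (Suc n))" using M(2) by (simp add: M'_def summable_mult)
  then have sM': "summable M'" by (simp add: summable_Suc_iff)
  have yM: "norm (y n \<tau>) \<le> M' n" if "\<tau> \<in> J" for n \<tau>
    using order_trans[OF K(2)[OF that] mult_left_mono[OF M(1)[OF that] K(1)]]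
    by (simp add: y_def M'_def split: nat.split)
  have sum_y: "(\<Sum>n. y n \<tau>) = A \<tau> (X \<tau>)" if "\<tau> \<in> J" for \<tau>
  proof -
    have "summable (\<lambda>n. y n \<tau>)"
      by (rule summable_comparison_test'[OF sM', where N = 0]) (rule yM[OF that])
    from suminf_split_head[OF this] have "(\<Sum>n. y n \<tau>) = (\<Sum>n. A \<tau> (x n \<tau>))" by (simp add: y_def)
    also have "\<dots> = A \<tau> (X \<tau>)"
      unfolding X_def by (rule bounded_linear.suminf[OF bl[OF that] sum_x[OF that], symmetric])
    finally show ?thesis .
  qed
  have "uniform_limit J (\<lambda>n \<tau>. \<Sum>i<n. y i \<tau>) (\<lambda>\<tau>. \<Sum>i. y i \<tau>) sequentially"
    by (rule Weierstrass_m_test[OF yM sM'])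
  then have ul: "uniform_limit J (\<lambda>n \<tau>. \<Sum>i<n. y i \<tau>) (\<lambda>\<tau>. A \<tau> (X \<tau>)) sequentially"
    by (rule uniform_limit_cong'[THEN iffD1, rotated -1]) (auto simp: sum_y)
  have "\<exists>g. \<forall>\<tau>\<in>J. (\<lambda>n. x n \<tau>) sums g \<tau> \<and> (g has_derivative (\<lambda>h. h *\<^sub>R A \<tau> (X \<tau>))) (at \<tau> within J)"
  proof (rule has_derivative_series[where f = x and x = s and f' = "\<lambda>n \<tau> h. h *\<^sub>R y n \<tau>",
        OF J(1) _ _ J(2) summable_sums[OF sum_x[OF J(2)]]])
    fix n \<tau> assume \<tau>: "\<tau> \<in> J"
    show "(x n has_derivative (\<lambda>h. h *\<^sub>R y n \<tau>)) (at \<tau> within J)"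
    proof (cases n)
      case 0
      then have "x n = (\<lambda>_. u)" using x0 by auto
      then show ?thesis using 0 by (simp add: y_def)
    next
      case (Suc m)
      then show ?thesis using deriv[OF \<tau>, of m] by (simp add: y_def has_vector_derivative_def)
    qed
  next
    fix e :: real assume e: "e > 0"
    have "norm ((\<Sum>i<n. h *\<^sub>R y i \<tau>) - h *\<^sub>R A \<tau> (X \<tau>)) \<le> e * norm h"
      if "dist (\<Sum>i<n. y i \<tau>) (A \<tau> (X \<tau>)) < e" for n \<tau> h
    proof -
      have "(\<Sum>i<n. h *\<^sub>R y i \<tau>) - h *\<^sub>R A \<tau> (X \<tau>) = h *\<^sub>R ((\<Sum>i<n. y i \<tau>) - A \<tau> (X \<tau>))"
        by (simp add: scaleR_sum_right scaleR_diff_right)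
      then show ?thesis
        using mult_left_mono[OF less_imp_le[OF that] abs_ge_zero[of h]] by (simp add: dist_norm mult.commute)
    qed
    then show "\<forall>\<^sub>F n in sequentially. \<forall>\<tau>\<in>J. \<forall>h. norm ((\<Sum>i<n. h *\<^sub>R y i \<tau>) - h *\<^sub>R A \<tau> (X \<tau>)) \<le> e * norm h"
      using uniform_limitD[OF ul e] by (auto elim: eventually_mono)
  qed
  then obtain g where g: "\<And>\<tau>. \<tau> \<in> J \<Longrightarrow> (\<lambda>n. x n \<tau>) sums g \<tau>"
    "\<And>\<tau>. \<tau> \<in> J \<Longrightarrow> (g has_derivative (\<lambda>h. h *\<^sub>R A \<tau> (X \<tau>))) (at \<tau> within J)" by blast
  have gX: "g \<tau> = X \<tau>" if "\<tau> \<in> J" for \<tau> using g(1)[OF that] by (simp add: X_def sums_iff)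
  have "x n s = (if n = 0 then u else 0)" for n using xs x0 by (cases n) auto
  then have "(\<lambda>n. x n s) sums u" using sums_single[of 0 "\<lambda>_. u"] by simp
  then have "g s = u" using g(1)[OF J(2)] sums_unique2 by blast
  then show ?thesis using g gX by (intro exI[of _ g]) (auto simp: has_vector_derivative_def)
qed

lemma summable_exp_bound: "summable (\<lambda>n. c * (x ^ n / fact n :: real))"
  using summable_mult[OF summable_exp[of x], of c] by (simp add: field_simps)

text \<open>The induction step behind the factorials of Picard iteration: integrating the n-th power
  of the distance to s gains 1/(n + 1). To the left of s the comparison function changes sign, hence
  two cases.\<close>

lemma power_growth_bound:
  fixes g :: "real \<Rightarrow> 'b::real_normed_vector"
  assumes g: "\<And>\<tau>. \<tau> \<in> {a..b} \<Longrightarrow> (g has_vector_derivative g' \<tau>) (at \<tau> within {a..b})"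
    and le: "\<And>\<tau>. \<tau> \<in> {a..b} \<Longrightarrow> norm (g' \<tau>) \<le> D * \<bar>\<tau> - s\<bar> ^ n"
    and gs: "g s = 0" and st: "s \<in> {a..b}" "t \<in> {a..b}"
  shows "norm (g t) \<le> D * \<bar>t - s\<bar> ^ Suc n / real (Suc n)"
proof -
  have inner: "(g has_vector_derivative g' x) (at x)" if "p < x" "x < q" "{p..q} \<subseteq> {a..b}" for p q x
  proof -
    have "x \<in> {a..b}" using that by force
    then have "(g has_vector_derivative g' x) (at x within {p<..<q})"
      using that by (intro has_vector_derivative_within_subset[OF g]) force+
    then show ?thesis using that by (simp add: has_vector_derivative_within_open[of x "{p<..<q}"])
  qed
  have cont: "continuous_on {p..q} g" if "{p..q} \<subseteq> {a..b}" for p q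
  proof -
    have "continuous_on {a..b} g" 
      by (rule continuous_on_vector_derivative) (rule g)
    then show ?thesis using that by (rule continuous_on_subset)
  qed
  consider "s < t" | "t < s" | "s = t" by linarith
  then show ?thesis
  proof cases
    case 1
    then have sub: "{s..t} \<subseteq> {a..b}" using st by auto
    let ?\<phi> = "\<lambda>\<tau>. D * (\<tau> - s) ^ Suc n / real (Suc n)"
    have "norm (g t - g s) \<le> ?\<phi> t - ?\<phi> s"
    proof (rule differentiable_bound_general[OF 1 cont[OF sub]])
      fix x assume x: "s < x" "x < t"
      show "(g has_vector_derivative g' x) (at x)" by (rule inner[OF x sub])
      have "(?\<phi> has_real_derivative D * (real (Suc n) * (x - s) ^ n) / real (Suc n)) (at x)"
        by (intro derivative_eq_intros refl) (auto simp del: of_nat_Suc)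
      then show "(?\<phi> has_vector_derivative D * (x - s) ^ n) (at x)"
        by (simp add: has_real_derivative_iff_has_vector_derivative del: of_nat_Suc)
      show "norm (g' x) \<le> D * (x - s) ^ n" using le[of x] x sub by force
    qed (intro continuous_intros, simp)
    then show ?thesis using 1 gs by simp
  next
    case 2
    then have sub: "{t..s} \<subseteq> {a..b}" using st by auto
    let ?\<phi> = "\<lambda>\<tau>. - (D * (s - \<tau>) ^ Suc n / real (Suc n))"
    have "norm (g s - g t) \<le> ?\<phi> s - ?\<phi> t"
    proof (rule differentiable_bound_general[OF 2 cont[OF sub]])
      fix x assume x: "t < x" "x < s"
      show "(g has_vector_derivative g' x) (at x)" by (rule inner[OF x sub])
      have "(?\<phi> has_real_derivative D * (real (Suc n) * (s - x) ^ n) / real (Suc n)) (at x)"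
        by (intro derivative_eq_intros refl) (auto simp del: of_nat_Suc)
      then show "(?\<phi> has_vector_derivative D * (s - x) ^ n) (at x)"
        by (simp add: has_real_derivative_iff_has_vector_derivative del: of_nat_Suc)
      show "norm (g' x) \<le> D * (s - x) ^ n" using le[of x] x sub by force
    qed (intro continuous_intros, simp)
    then show ?thesis using 2 gs by simp
  qed (use gs in simp)
qed

text \<open>The moving argument is split off: the uniform bound K handles
  \<open>f \<tau> - f \<tau>0\<close>, and strong continuity handles the fixed vector
  \<open>f \<tau>0\<close>.\<close>

lemma continuous_on_strong:
  fixes A :: "real \<Rightarrow> 'b::real_normed_vector \<Rightarrow> 'c::real_normed_vector"
  assumes bl: "\<And>\<tau>. \<tau> \<in> J \<Longrightarrow> bounded_linear (A \<tau>)"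
    and K: "\<And>\<tau> v. \<tau> \<in> J \<Longrightarrow> norm (A \<tau> v) \<le> K * norm v"
    and cont: "\<And>v. continuous_on J (\<lambda>\<tau>. A \<tau> v)" and f: "continuous_on J f"
  shows "continuous_on J (\<lambda>\<tau>. A \<tau> (f \<tau>))"
  unfolding continuous_on_def
proof
  fix \<tau>0 assume \<tau>0: "\<tau>0 \<in> J"
  have ev: "\<forall>\<^sub>F \<tau> in at \<tau>0 within J. \<tau> \<in> J" by (simp add: eventually_at_filter)
  have lim: "((\<lambda>\<tau>. K * norm (f \<tau> - f \<tau>0)) \<longlongrightarrow> K * norm (f \<tau>0 - f \<tau>0)) (at \<tau>0 within J)"
    using f \<tau>0 unfolding continuous_on_def by (intro tendsto_intros) auto
  have "((\<lambda>\<tau>. A \<tau> (f \<tau> - f \<tau>0)) \<longlongrightarrow> 0) (at \<tau>0 within J)"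
    by (rule Lim_null_comparison[OF _ lim[simplified]]) (use ev K in \<open>auto elim: eventually_mono\<close>)
  moreover have "((\<lambda>\<tau>. A \<tau> (f \<tau>0)) \<longlongrightarrow> A \<tau>0 (f \<tau>0)) (at \<tau>0 within J)"
    using cont \<tau>0 unfolding continuous_on_def by blast
  ultimately have "((\<lambda>\<tau>. A \<tau> (f \<tau> - f \<tau>0) + A \<tau> (f \<tau>0)) \<longlongrightarrow> 0 + A \<tau>0 (f \<tau>0)) (at \<tau>0 within J)"
    by (rule tendsto_add)
  moreover have "\<forall>\<^sub>F \<tau> in at \<tau>0 within J. A \<tau> (f \<tau> - f \<tau>0) + A \<tau> (f \<tau>0) = A \<tau> (f \<tau>)"
    using ev by (rule eventually_mono) (simp add: linear_diff bounded_linear.linear bl)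
  ultimately show "((\<lambda>\<tau>. A \<tau> (f \<tau>)) \<longlongrightarrow> A \<tau>0 (f \<tau>0)) (at \<tau>0 within J)"
    using tendsto_cong by fastforce
qed

text \<open>These are the successive increments of Picard iteration, the terms of the Dyson series,
  so the solution is their sum. The integral from s to t is a difference of integrals from a because
  t may lie on either side of s.\<close>

primrec picard :: "(real \<Rightarrow> 'b \<Rightarrow> 'b) \<Rightarrow> real \<Rightarrow> real \<Rightarrow> 'b \<Rightarrow> nat \<Rightarrow> real \<Rightarrow> 'b::banach" where
  "picard A a s u 0 = (\<lambda>t. u)"
| "picard A a s u (Suc n) = (\<lambda>t. integral {a..t} (\<lambda>\<tau>. A \<tau> (picard A a s u n \<tau>))
     - integral {a..s} (\<lambda>\<tau>. A \<tau> (picard A a s u n \<tau>)))"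

text \<open>Existence in the whole Banach space, by boundedness of the generator. That solutions
  remain in the cutoff space is shown separately in \<open>solution_stays\<close>.\<close>

lemma linear_ode_solvable:
  fixes A :: "real \<Rightarrow> 'b::banach \<Rightarrow> 'b"
  assumes bl: "\<And>\<tau>. \<tau> \<in> {a..b} \<Longrightarrow> bounded_linear (A \<tau>)"
    and K: "K \<ge> 0" "\<And>\<tau> v. \<tau> \<in> {a..b} \<Longrightarrow> norm (A \<tau> v) \<le> K * norm v"
    and cont: "\<And>v. continuous_on {a..b} (\<lambda>\<tau>. A \<tau> v)" and s: "s \<in> {a..b}"
  shows "\<exists>X. X s = u \<and> (\<forall>\<tau>\<in>{a..b}. (X has_vector_derivative A \<tau> (X \<tau>)) (at \<tau> within {a..b}))"
proof -
  let ?x = "picard A a s u"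
  have dc: "continuous_on {a..b} (?x n) \<and>
      (\<forall>\<tau>\<in>{a..b}. (?x (Suc n) has_vector_derivative A \<tau> (?x n \<tau>)) (at \<tau> within {a..b}))" for n
  proof (induction n)
    case 0
    have "continuous_on {a..b} (\<lambda>\<tau>. A \<tau> (?x 0 \<tau>))" using cont by simp
    from integral_has_vector_derivative[OF this] show ?case
      by (auto intro!: derivative_eq_intros)
  next
    case (Suc n)
    then have c: "continuous_on {a..b} (?x (Suc n))"
      by (intro continuous_on_vector_derivative) blast
    have "continuous_on {a..b} (\<lambda>\<tau>. A \<tau> (?x (Suc n) \<tau>))"
      by (rule continuous_on_strong[OF bl K(2) cont c])
    then have "((\<lambda>t. integral {a..t} (\<lambda>\<tau>. A \<tau> (?x (Suc n) \<tau>))) has_vector_derivative A \<tau> (?x (Suc n) \<tau>))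
        (at \<tau> within {a..b})" if "\<tau> \<in> {a..b}" for \<tau>
      using that by (rule integral_has_vector_derivative)
    then have "(?x (Suc (Suc n)) has_vector_derivative A \<tau> (?x (Suc n) \<tau>)) (at \<tau> within {a..b})"
      if "\<tau> \<in> {a..b}" for \<tau>
      unfolding picard.simps(2)[of A a s u "Suc n"] using that
      by (auto intro!: derivative_eq_intros simp del: picard.simps)
    with c show ?case by blast
  qed
  have deriv: "(?x (Suc n) has_vector_derivative A \<tau> (?x n \<tau>)) (at \<tau> within {a..b})"
    if "\<tau> \<in> {a..b}" for n \<tau> using dc that by blast
  have bound: "norm (?x n \<tau>) \<le> norm u * (K ^ n * \<bar>\<tau> - s\<bar> ^ n / fact n)" if "\<tau> \<in> {a..b}" for n \<tau>
    using that
  proof (induction n arbitrary: \<tau>)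
    case (Suc n)
    have "norm (A \<sigma> (?x n \<sigma>)) \<le> (norm u * K ^ Suc n / fact n) * \<bar>\<sigma> - s\<bar> ^ n" if "\<sigma> \<in> {a..b}" for \<sigma>
      using order_trans[OF K(2)[OF that] mult_left_mono[OF Suc.IH[OF that] K(1)]]
      by (simp add: algebra_simps)
    from power_growth_bound[OF deriv this _ s Suc.prems] 
    have "norm (?x (Suc n) \<tau>) \<le> (norm u * K ^ Suc n / fact n) * \<bar>\<tau> - s\<bar> ^ Suc n / real (Suc n)" by simp
    also have "\<dots> = norm u * (K ^ Suc n * \<bar>\<tau> - s\<bar> ^ Suc n / fact (Suc n))"
      by (simp only: fact_Suc) (simp add: field_simps)
    finally show ?case .
  qed simp
  have "\<exists>X. X s = u \<and> (\<forall>\<tau>\<in>{a..b}. (\<lambda>n. ?x n \<tau>) sums X \<tau> \<and>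
           (X has_vector_derivative A \<tau> (X \<tau>)) (at \<tau> within {a..b}))"
  proof (rule series_solves_ode[where x = ?x and A = A, OF _ s _ _ deriv bl K])
    show "norm (?x n \<tau>) \<le> norm u * ((K * (b - a)) ^ n / fact n)" if "\<tau> \<in> {a..b}" for n \<tau>
    proof (rule order_trans[OF bound[OF that]])
      have "\<bar>\<tau> - s\<bar> ^ n \<le> (b - a) ^ n" using that s by (intro power_mono) auto
      then show "norm u * (K ^ n * \<bar>\<tau> - s\<bar> ^ n / fact n) \<le> norm u * ((K * (b - a)) ^ n / fact n)"
        using K(1) by (simp add: power_mult_distrib divide_right_mono mult_left_mono)
    qed
    show "summable (\<lambda>n. norm u * ((K * (b - a)) ^ n / fact n))" by (rule summable_exp_bound)
  qed auto
  then show ?thesis by blast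
qed

text \<open>Presents an exponential factor as the end value of an autonomous evolution, so that it
  can be compared with the truncated solution through their differential equations.\<close>

lemma op_exp_solves_ode:
  fixes B :: "'b::banach \<Rightarrow> 'b"
  assumes bl: "bounded_linear B" and h: "h \<ge> 0"
  shows "\<exists>X. X s = u \<and> X (s + h) = (\<Sum>n. ((\<lambda>v. h *\<^sub>R B v) ^^ n) u /\<^sub>R fact n) \<and>
           (\<forall>\<tau>\<in>{s..s + h}. (X has_vector_derivative B (X \<tau>)) (at \<tau> within {s..s + h}))"
proof -
  obtain K where K: "K \<ge> 0" "\<And>v. norm (B v) \<le> K * norm v"
    using bounded_linear.nonneg_bounded[OF bl] by (metis mult.commute)
  let ?x = "\<lambda>n \<tau>. ((\<tau> - s) ^ n / fact n) *\<^sub>R (B ^^ n) u"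
  have pow: "norm ((B ^^ n) u) \<le> K ^ n * norm u" for n
  proof (induction n)
    case (Suc n)
    then show ?case using order_trans[OF K(2)[of "(B ^^ n) u"] mult_left_mono[OF Suc K(1)]]
      by (simp add: mult.assoc)
  qed simp
  have "\<exists>X. X s = u \<and> (\<forall>\<tau>\<in>{s..s + h}. (\<lambda>n. ?x n \<tau>) sums X \<tau> \<and>
           (X has_vector_derivative B (X \<tau>)) (at \<tau> within {s..s + h}))"
  proof (rule series_solves_ode[where x = ?x and A = "\<lambda>_. B", OF _ _ _ _ _ bl K])
    fix n \<tau>
    have "((\<lambda>\<tau>. (\<tau> - s) ^ Suc n / fact (Suc n)) has_real_derivative
        (real (Suc n) * (\<tau> - s) ^ n) / fact (Suc n)) (at \<tau> within {s..s + h})"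
      by (intro derivative_eq_intros refl) (auto simp del: of_nat_Suc)
    then have "((\<lambda>\<tau>. (\<tau> - s) ^ Suc n / fact (Suc n)) has_real_derivative (\<tau> - s) ^ n / fact n)
        (at \<tau> within {s..s + h})" by (simp add: divide_simps split: if_splits)
    then have "(?x (Suc n) has_vector_derivative ((\<tau> - s) ^ n / fact n) *\<^sub>R (B ^^ Suc n) u)
        (at \<tau> within {s..s + h})"
      by (intro bounded_linear.has_vector_derivative[OF bounded_linear_scaleR_left])
         (simp add: has_real_derivative_iff_has_vector_derivative)
    then show "(?x (Suc n) has_vector_derivative B (?x n \<tau>)) (at \<tau> within {s..s + h})"
      using linear_scale[OF bounded_linear.linear[OF bl]] by simp
  next
    fix n \<tau> assume "\<tau> \<in> {s..s + h}"
    then have "(\<tau> - s) ^ n \<le> h ^ n" by (intro power_mono) auto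
    then have "(\<tau> - s) ^ n * norm ((B ^^ n) u) \<le> h ^ n * (K ^ n * norm u)"
      using pow h by (intro mult_mono) auto
    then show "norm (?x n \<tau>) \<le> norm u * ((K * h) ^ n / fact n)"
      using \<open>\<tau> \<in> {s..s + h}\<close>
      by (simp add: power_mult_distrib divide_right_mono mult.commute mult.left_commute)
  next
    show "summable (\<lambda>n. norm u * ((K * h) ^ n / fact n))" by (rule summable_exp_bound)
  qed (use h in auto)
  then obtain X where X: "X s = u" "\<And>\<tau>. \<tau> \<in> {s..s + h} \<Longrightarrow> (\<lambda>n. ?x n \<tau>) sums X \<tau>"
    "\<And>\<tau>. \<tau> \<in> {s..s + h} \<Longrightarrow> (X has_vector_derivative B (X \<tau>)) (at \<tau> within {s..s + h})" by blast
  have "((\<lambda>v. h *\<^sub>R B v) ^^ n) u = h ^ n *\<^sub>R (B ^^ n) u" for n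
    by (induction n) (auto simp: linear_scale[OF bounded_linear.linear[OF bl]])
  then have "X (s + h) = (\<Sum>n. ((\<lambda>v. h *\<^sub>R B v) ^^ n) u /\<^sub>R fact n)"
    using X(2)[of "s + h"] h by (simp add: sums_iff divide_inverse mult.commute)
  with X show ?thesis by blast
qed

section \<open>The truncated evolution\<close>

context positive_compact_resolvent
begin

lemma bounded_sob_bound:
  assumes "bounded_sob H0 p q S"
  obtains C where "C \<ge> 0" "\<And>u. u \<in> sob H0 p \<Longrightarrow> sob_norm H0 q (S u) \<le> C * sob_norm H0 p u"
proof -
  obtain C where C: "\<forall>u\<in>sob H0 p. sob_norm H0 q (S u) \<le> C * sob_norm H0 p u"
    using assms unfolding bounded_sob_def by blast
  have "sob_norm H0 q (S u) \<le> \<bar>C\<bar> * sob_norm H0 p u" if "u \<in> sob H0 p" for u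
    using bspec[OF C that] mult_right_mono[OF abs_ge_self[of C] sob_norm_nonneg[of p u]] by linarith
  then show ?thesis using that[of "\<bar>C\<bar>"] by simp
qed

lemma bounded_sob_image: "bounded_sob H0 p q S \<Longrightarrow> u \<in> sob H0 p \<Longrightarrow> S u \<in> sob H0 q"
  unfolding bounded_sob_def by blast

lemma bounded_sob_diff:
  assumes "bounded_sob H0 p q S" "bounded_sob H0 p q S'"
  shows "bounded_sob H0 p q (\<lambda>u. S u - S' u)"
proof -
  obtain C where C: "\<And>u. u \<in> sob H0 p \<Longrightarrow> sob_norm H0 q (S u) \<le> C * sob_norm H0 p u"
    using bounded_sob_bound[OF assms(1)] by metis
  obtain C' where C': "\<And>u. u \<in> sob H0 p \<Longrightarrow> sob_norm H0 q (S' u) \<le> C' * sob_norm H0 p u"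
    using bounded_sob_bound[OF assms(2)] by metis
  note im = bounded_sob_image[OF assms(1)] bounded_sob_image[OF assms(2)]
  have "sob_norm H0 q (S u - S' u) \<le> (C + C') * sob_norm H0 p u" if u: "u \<in> sob H0 p" for u
  proof -
    have "sob_norm H0 q (S u - S' u) \<le> sob_norm H0 q (S u) + sob_norm H0 q (S' u)"
      using im[OF u] by (simp add: sob_norm_def Lambda_linear norm_triangle_ineq4)
    then show ?thesis using C[OF u] C'[OF u] by (simp add: algebra_simps)
  qed
  moreover have "S u - S' u \<in> sob H0 q" if "u \<in> sob H0 p" for u
    using im[OF that] csubspace_diff[OF csubspace_sob] by blast
  moreover have "clinear_on (sob H0 p) (\<lambda>u. S u - S' u)"
  proof -
    have "clinear_on (sob H0 p) S" "clinear_on (sob H0 p) S'"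
      using assms unfolding bounded_sob_def by blast+
    then show ?thesis unfolding clinear_on_def by (simp add: scaleC_diff_right)
  qed
  ultimately show ?thesis unfolding bounded_sob_def by blast
qed

text \<open>\<open>sob_opnorm\<close> is a supremum of reals and carries information only for a set
  bounded above, which \<open>bounded_sob\<close> provides. A vector of norm 0 cannot be normalised
  and is treated by the bound itself.\<close>

lemma sob_norm_le_opnorm:
  assumes S: "bounded_sob H0 p q S" and u: "u \<in> sob H0 p"
  shows "sob_norm H0 q (S u) \<le> sob_opnorm H0 p q S * sob_norm H0 p u"
proof -
  obtain C where C: "C \<ge> 0" "\<And>u. u \<in> sob H0 p \<Longrightarrow> sob_norm H0 q (S u) \<le> C * sob_norm H0 p u"
    using bounded_sob_bound[OF S] by metis
  have lin: "clinear_on (sob H0 p) S" using S unfolding bounded_sob_def by blast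
  note im = bounded_sob_image[OF S]
  let ?X = "{sob_norm H0 q (S u) |u. u \<in> sob H0 p \<and> sob_norm H0 p u \<le> 1}"
  have bdd: "bdd_above ?X"
  proof (rule bdd_aboveI[where M = C])
    fix x assume "x \<in> ?X"
    then obtain v where v: "x = sob_norm H0 q (S v)" "v \<in> sob H0 p" "sob_norm H0 p v \<le> 1" by blast
    have "x \<le> C * sob_norm H0 p v" using C(2)[OF v(2)] v(1) by simp
    also have "\<dots> \<le> C" using mult_left_mono[OF v(3) C(1)] by simp
    finally show "x \<le> C" .
  qed
  show ?thesis
  proof (cases "sob_norm H0 p u = 0")
    case True
    then show ?thesis using C(2)[OF u] by simp
  next
    case False
    then have pos: "sob_norm H0 p u > 0" using sob_norm_nonneg[of p u] by simp
    let ?v = "(1 / sob_norm H0 p u) *\<^sub>R u"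
    have v: "?v \<in> sob H0 p" using u csubspace_scaleR[OF csubspace_sob] by blast
    have "sob_norm H0 p ?v = 1" using pos by (simp add: sob_norm_scaleR[OF u])
    then have "sob_norm H0 q (S ?v) \<le> sob_opnorm H0 p q S"
      unfolding sob_opnorm_def using v by (intro cSup_upper bdd) auto
    moreover have "S ?v = (1 / sob_norm H0 p u) *\<^sub>R S u"
      by (rule clinear_onD(4)[OF lin u csubspace_sob])
    ultimately show ?thesis using pos by (simp add: sob_norm_scaleR[OF im[OF u]] field_simps)
  qed
qed

text \<open>Continuity bounds the family near each time, and bisection of the compact interval
  merges the local bounds into one.\<close>

lemma norm_continuous_bounded:
  assumes H: "norm_continuous_sob H0 {a..b} p q H" and ab: "a \<le> b"
  shows "\<exists>C\<ge>0. \<forall>t\<in>{a..b}. \<forall>u\<in>sob H0 p. sob_norm H0 q (H t u) \<le> C * sob_norm H0 p u"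
proof -
  \<comment> \<open>Intersecting with {a..b} allows the neighbourhoods in the bisection principle to
    reach beyond the end points.\<close>
  define Q where "Q x y \<longleftrightarrow> (\<exists>C. \<forall>t\<in>{x..y} \<inter> {a..b}. \<forall>u\<in>sob H0 p.
    sob_norm H0 q (H t u) \<le> C * sob_norm H0 p u)" for x y :: real
  have "Q a b"
  proof (rule Bolzano[OF ab])
    fix x y z assume "Q x y" "Q y z" "x \<le> y" "y \<le> z"
    then obtain C C' where C: "\<forall>t\<in>{x..y} \<inter> {a..b}. \<forall>u\<in>sob H0 p. sob_norm H0 q (H t u) \<le> C * sob_norm H0 p u"
      and C': "\<forall>t\<in>{y..z} \<inter> {a..b}. \<forall>u\<in>sob H0 p. sob_norm H0 q (H t u) \<le> C' * sob_norm H0 p u"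
      unfolding Q_def by blast
    have "sob_norm H0 q (H t u) \<le> max C C' * sob_norm H0 p u"
      if t: "t \<in> {x..z} \<inter> {a..b}" and u: "u \<in> sob H0 p" for t u
    proof -
      have "sob_norm H0 q (H t u) \<le> C * sob_norm H0 p u \<or> sob_norm H0 q (H t u) \<le> C' * sob_norm H0 p u"
        using t u C C' by (cases "t \<le> y") auto
      then show ?thesis
        using mult_right_mono[OF max.cobounded1[of C C'] sob_norm_nonneg[of p u]]
          mult_right_mono[OF max.cobounded2[of C' C] sob_norm_nonneg[of p u]] by linarith
    qed
    then show "Q x z" unfolding Q_def by blast
  next
    fix x assume x: "a \<le> x" "x \<le> b"
    then have bx: "bounded_sob H0 p q (H x)"
      and lim: "((\<lambda>t'. sob_opnorm H0 p q (\<lambda>u. H t' u - H x u)) \<longlongrightarrow> 0) (at x within {a..b})"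
      using H unfolding norm_continuous_sob_def by auto
    obtain C where C: "\<And>u. u \<in> sob H0 p \<Longrightarrow> sob_norm H0 q (H x u) \<le> C * sob_norm H0 p u"
      using bounded_sob_bound[OF bx] by metis
    obtain d where d: "d > 0" "\<And>t. t \<in> {a..b} \<Longrightarrow> t \<noteq> x \<Longrightarrow> dist t x < d \<Longrightarrow>
        dist (sob_opnorm H0 p q (\<lambda>u. H t u - H x u)) 0 < 1"
      using tendstoD[OF lim, of 1] unfolding eventually_at by auto
    have "sob_norm H0 q (H t u) \<le> (C + 1) * sob_norm H0 p u"
      if t: "t \<in> {a..b}" "dist t x < d" and u: "u \<in> sob H0 p" for t u
    proof (cases "t = x")
      case True
      then show ?thesis using C[OF u] sob_norm_nonneg[of p u] by (simp add: algebra_simps)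
    next
      case False
      have bt: "bounded_sob H0 p q (H t)" using H t unfolding norm_continuous_sob_def by auto
      have "sob_norm H0 q (H t u - H x u) \<le> sob_opnorm H0 p q (\<lambda>u. H t u - H x u) * sob_norm H0 p u"
        by (rule sob_norm_le_opnorm[OF bounded_sob_diff[OF bt bx] u])
      also have "\<dots> \<le> 1 * sob_norm H0 p u"
        using d(2)[OF t(1) False t(2)] by (intro mult_right_mono sob_norm_nonneg) auto
      finally have "sob_norm H0 q (H t u - H x u) \<le> sob_norm H0 p u" by simp
      moreover have "sob_norm H0 q (H x u + (H t u - H x u)) \<le> sob_norm H0 q (H x u) + sob_norm H0 q (H t u - H x u)"
        using bounded_sob_image[OF bx u] bounded_sob_image[OF bounded_sob_diff[OF bt bx] u]
        by (intro sob_norm_triangle)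
      ultimately show ?thesis using C[OF u] by (simp add: algebra_simps)
    qed
    then have "Q y z" if "y \<le> x \<and> x \<le> z \<and> z - y < d" for y z
      unfolding Q_def using that by (intro exI[of _ "C + 1"]) (auto simp: dist_real_def)
    then show "\<exists>d>0. \<forall>y z. y \<le> x \<and> x \<le> z \<and> z - y < d \<longrightarrow> Q y z" using d(1) by blast
  qed
  then obtain C where C: "\<forall>t\<in>{a..b} \<inter> {a..b}. \<forall>u\<in>sob H0 p. sob_norm H0 q (H t u) \<le> C * sob_norm H0 p u"
    unfolding Q_def by blast
  have "sob_norm H0 q (H t u) \<le> \<bar>C\<bar> * sob_norm H0 p u" if "t \<in> {a..b}" "u \<in> sob H0 p" for t u
    using C that mult_right_mono[OF abs_ge_self[of C] sob_norm_nonneg[of p u]] order_trans by blast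
  then show ?thesis by (intro exI[of _ "\<bar>C\<bar>"]) auto
qed

end

text \<open>The witnesses c and L of the existential hypotheses become parameters, so that all later
  constants are expressed by them. Norm continuity is recorded at the order \<sigma>, where H sends
  vectors of order \<mu> + \<sigma>.\<close>

locale truncated_evolution = positive_compact_resolvent H0
  for H0 :: "'a::complex_hilbert uop" +
  fixes H :: "real \<Rightarrow> 'a \<Rightarrow> 'a" and a b \<mu> \<sigma> \<alpha> L :: real and c :: "real \<Rightarrow> real"
  assumes ab: "a \<le> b" and \<mu>: "0 \<le> \<mu>" and \<sigma>: "0 < \<sigma>" and \<alpha>: "0 < \<alpha>" and L: "0 \<le> L"
    and H_cont: "norm_continuous_sob H0 {a..b} (\<sigma> + \<mu>) \<sigma> H"
    and c_int: "c absolutely_integrable_on {a..b}" and c_nonneg: "\<And>t. t \<in> {a..b} \<Longrightarrow> 0 \<le> c t"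
    and commutator: "\<And>v. v \<in> sob_inf H0 \<Longrightarrow> AE t in lebesgue. t \<in> {a..b} \<longrightarrow>
                cmod (\<i> * (cinner (H t v) (Lambda_pow H0 (2 * (\<mu> + \<sigma>)) v)
                          - cinner (Lambda_pow H0 (2 * (\<mu> + \<sigma>)) v) (H t v)))
                \<le> c t * (sob_norm H0 (\<mu> + \<sigma>) v)\<^sup>2"
    and H_sym: "\<And>t u v. t \<in> {a..b} \<Longrightarrow> u \<in> sob_inf H0 \<Longrightarrow> v \<in> sob_inf H0 \<Longrightarrow>
                cinner (H t u) v = cinner u (H t v)"
    and H_bounded: "\<And>t. t \<in> {a..b} \<Longrightarrow> bounded_sob H0 \<mu> 0 (H t)"
    and H_holder: "\<And>t t'. t \<in> {a..b} \<Longrightarrow> t' \<in> {a..b} \<Longrightarrow>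
                sob_opnorm H0 \<mu> 0 (\<lambda>u. H t' u - H t u) \<le> L * \<bar>t' - t\<bar> powr \<alpha>"
begin

abbreviation tr :: "real \<Rightarrow> real \<Rightarrow> 'a \<Rightarrow> 'a" where
  "tr \<equiv> truncation H0 H"

abbreviation V :: "real \<Rightarrow> 'a set" where
  "V \<equiv> cutoff_space H0"

lemma H_linear:
  assumes "t \<in> {a..b}" "u \<in> sob H0 \<mu>"
  shows "H t (z *\<^sub>C u) = z *\<^sub>C H t u" "v \<in> sob H0 \<mu> \<Longrightarrow> H t (u + v) = H t u + H t v"
    "v \<in> sob H0 \<mu> \<Longrightarrow> H t (u - v) = H t u - H t v"
  using clinear_onD[OF _ assms(2) csubspace_sob] H_bounded[OF assms(1)]
  unfolding bounded_sob_def by blast+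

lemma tr_linear:
  assumes "t \<in> {a..b}"
  shows "tr N t (z *\<^sub>C u) = z *\<^sub>C tr N t u" "tr N t (u + v) = tr N t u + tr N t v"
    "tr N t (u - v) = tr N t u - tr N t v"
  using assms \<mu> by (simp_all add: truncation_def cutoff_linear H_linear cutoff_in_sob)

lemma norm_H_diff_le:
  assumes "t \<in> {a..b}" "t' \<in> {a..b}" "u \<in> sob H0 \<mu>"
  shows "norm (H t' u - H t u) \<le> L * \<bar>t' - t\<bar> powr \<alpha> * sob_norm H0 \<mu> u"
proof -
  have "norm (H t' u - H t u) \<le> sob_opnorm H0 \<mu> 0 (\<lambda>u. H t' u - H t u) * sob_norm H0 \<mu> u"
    using sob_norm_le_opnorm[OF bounded_sob_diff[OF H_bounded[OF assms(2)] H_bounded[OF assms(1)]] assms(3)]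
    by (simp add: sob_norm_zero)
  also have "\<dots> \<le> L * \<bar>t' - t\<bar> powr \<alpha> * sob_norm H0 \<mu> u"
    by (intro mult_right_mono H_holder assms sob_norm_nonneg)
  finally show ?thesis .
qed

text \<open>The Hoelder bound measures its argument in the norm of order \<mu>; on truncated vectors
  this costs \<open>(1 + N) powr \<mu>\<close>, the factor that reappears in the time-stepping
  error.\<close>

lemma norm_tr_diff_le:
  assumes "t \<in> {a..b}" "t' \<in> {a..b}" "N \<ge> 0"
  shows "norm (tr N t' u - tr N t u) \<le> L * \<bar>t' - t\<bar> powr \<alpha> * (1 + N) powr \<mu> * norm u"
proof -
  have "tr N t' u - tr N t u = cutoff H0 N (H t' (cutoff H0 N u) - H t (cutoff H0 N u))"
    by (simp add: truncation_def cutoff_linear)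
  also have "norm \<dots> \<le> norm (H t' (cutoff H0 N u) - H t (cutoff H0 N u))" by (rule norm_cutoff_le)
  also have "\<dots> \<le> L * \<bar>t' - t\<bar> powr \<alpha> * sob_norm H0 \<mu> (cutoff H0 N u)"
    using assms \<mu> by (intro norm_H_diff_le cutoff_in_sob) auto
  also have "\<dots> \<le> L * \<bar>t' - t\<bar> powr \<alpha> * ((1 + N) powr \<mu> * norm u)"
    using L \<mu> assms by (intro mult_left_mono sob_norm_cutoff_le) auto
  finally show ?thesis by (simp add: mult.assoc)
qed

text \<open>The bound at the single time a is extended by Hoelder continuity. As K grows with N, it
  serves qualitative purposes and stays out of the final constant.\<close>

lemma tr_bounded:
  assumes "N \<ge> 0"
  obtains K where "K \<ge> 0" "\<And>t u. t \<in> {a..b} \<Longrightarrow> norm (tr N t u) \<le> K * norm u"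
proof -
  have a: "a \<in> {a..b}" using ab by simp
  obtain C where C0: "C \<ge> 0" and C: "\<And>u. u \<in> sob H0 \<mu> \<Longrightarrow> sob_norm H0 0 (H a u) \<le> C * sob_norm H0 \<mu> u"
    using bounded_sob_bound[OF H_bounded[OF a]] by metis
  define K where "K = (C + L * (b - a) powr \<alpha>) * (1 + N) powr \<mu>"
  have le: "norm (tr N t u) \<le> K * norm u" if t: "t \<in> {a..b}" for t u
  proof -
    have "norm (tr N a u) \<le> norm (H a (cutoff H0 N u))" unfolding truncation_def by (rule norm_cutoff_le)
    also have "\<dots> \<le> C * sob_norm H0 \<mu> (cutoff H0 N u)"
      using C[OF cutoff_in_sob[OF \<mu>]] by (simp add: sob_norm_zero)
    also have "\<dots> \<le> C * ((1 + N) powr \<mu> * norm u)"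
      using \<mu> assms C0 by (intro mult_left_mono sob_norm_cutoff_le) auto
    finally have 1: "norm (tr N a u) \<le> C * ((1 + N) powr \<mu> * norm u)" .
    have "norm (tr N t u - tr N a u) \<le> L * \<bar>t - a\<bar> powr \<alpha> * (1 + N) powr \<mu> * norm u"
      by (rule norm_tr_diff_le[OF a t assms])
    also have "\<dots> \<le> L * (b - a) powr \<alpha> * (1 + N) powr \<mu> * norm u"
      using t \<alpha> L by (intro mult_right_mono mult_left_mono powr_mono2) auto
    finally have "norm (tr N t u - tr N a u) \<le> L * (b - a) powr \<alpha> * (1 + N) powr \<mu> * norm u" .
    then show ?thesis using 1 norm_triangle_sub[of "tr N t u" "tr N a u"]
      by (simp add: K_def algebra_simps)
  qed
  show ?thesis
  proof (rule that)
    show "K \<ge> 0" unfolding K_def using L C0 by simp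
  qed (rule le)
qed

abbreviation gen :: "real \<Rightarrow> real \<Rightarrow> 'a \<Rightarrow> 'a" where
  "gen N t v \<equiv> (- \<i>) *\<^sub>C tr N t v"

lemma gen_diff: "t \<in> {a..b} \<Longrightarrow> gen N t (u - v) = gen N t u - gen N t v"
  by (simp add: tr_linear scaleC_diff_right)

lemma norm_gen: "norm (gen N t v) = norm (tr N t v)"
  by (simp add: norm_scaleC)

lemma bounded_linear_gen:
  assumes "t \<in> {a..b}" "N \<ge> 0"
  shows "bounded_linear (gen N t)"
proof -
  obtain K where "K \<ge> 0" "\<And>t u. t \<in> {a..b} \<Longrightarrow> norm (tr N t u) \<le> K * norm u"
    using tr_bounded[OF assms(2)] by blast
  then show ?thesis using assms(1)
    by (intro bounded_linear_intro[where K = K])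
       (simp_all add: tr_linear scaleC_add_right scaleR_scaleC scaleC_scaleC norm_scaleC mult.commute)
qed

lemma continuous_on_gen:
  assumes "N \<ge> 0"
  shows "continuous_on {a..b} (\<lambda>t. gen N t v)"
  unfolding continuous_on_def
proof
  fix t assume t: "t \<in> {a..b}"
  have ev: "\<forall>\<^sub>F t' in at t within {a..b}. t' \<in> {a..b}" by (simp add: eventually_at_filter)
  have "((\<lambda>t'. \<bar>t' - t\<bar> powr \<alpha>) \<longlongrightarrow> \<bar>t - t\<bar> powr \<alpha>) (at t within {a..b})"
    using \<alpha> by (intro tendsto_powr2 tendsto_intros) auto
  then have "((\<lambda>t'. L * \<bar>t' - t\<bar> powr \<alpha> * (1 + N) powr \<mu> * norm v) \<longlongrightarrow>
      L * \<bar>t - t\<bar> powr \<alpha> * (1 + N) powr \<mu> * norm v) (at t within {a..b})"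
    by (rule tendsto_mult[OF tendsto_mult[OF tendsto_mult[OF tendsto_const] tendsto_const] tendsto_const])
  then have lim: "((\<lambda>t'. L * \<bar>t' - t\<bar> powr \<alpha> * (1 + N) powr \<mu> * norm v) \<longlongrightarrow> 0) (at t within {a..b})"
    by simp
  have "((\<lambda>t'. gen N t' v - gen N t v) \<longlongrightarrow> 0) (at t within {a..b})"
  proof (rule Lim_null_comparison[OF eventually_mono[OF ev] lim])
    fix t' assume "t' \<in> {a..b}"
    then show "norm (gen N t' v - gen N t v) \<le> L * \<bar>t' - t\<bar> powr \<alpha> * (1 + N) powr \<mu> * norm v"
      using norm_tr_diff_le[OF t _ assms, of t' v] by (simp add: norm_scaleC flip: scaleC_diff_right)
  qed
  then show "((\<lambda>t'. gen N t' v) \<longlongrightarrow> gen N t v) (at t within {a..b})"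
    by (simp add: LIM_zero_iff)
qed

lemma tr_symmetric:
  assumes "t \<in> {a..b}"
  shows "cinner (tr N t u) v = cinner u (tr N t v)"
  unfolding truncation_def
  by (simp add: cutoff_symmetric[of N "H t (cutoff H0 N u)"] H_sym[OF assms cutoff_in_sob_inf cutoff_in_sob_inf]
      flip: cutoff_symmetric[of N u])

text \<open>The quadratic form of a symmetric operator is real, so the factor -i leaves no real
  part. Every isometry and stability estimate below rests on this cancellation.\<close>

lemma Re_cinner_gen:
  assumes "t \<in> {a..b}"
  shows "Re (cinner (gen N t u) u) = 0"
proof -
  have "Im (cinner (tr N t u) u) = 0"
    using cinner_commute[of "tr N t u" u] tr_symmetric[OF assms, of N u u] by (simp add: complex_eq_iff)
  then show ?thesis by (simp add: cinner_scaleC_left)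
qed

lemma cutoff_tr: "cutoff H0 N (tr N t v) = tr N t v"
  by (simp add: truncation_def cutoff_cutoff)

lemma gen_in_V: "gen N t v \<in> V N"
  by (simp add: cutoff_space_iff cutoff_linear cutoff_tr)

text \<open>The generator takes values in V N, so the part of the solution outside V N has
  derivative 0 and keeps its initial value 0.\<close>

lemma solution_stays:
  assumes J: "convex J" "s \<in> J" "\<tau> \<in> J" and xs: "x s \<in> V N"
    and x: "\<And>\<tau>. \<tau> \<in> J \<Longrightarrow> (x has_vector_derivative gen N (f \<tau>) (y \<tau>)) (at \<tau> within J)"
  shows "x \<tau> \<in> V N"
proof -
  let ?z = "\<lambda>\<tau>. x \<tau> - cutoff H0 N (x \<tau>)"
  have "(?z has_vector_derivative 0) (at \<tau> within J)" if "\<tau> \<in> J" for \<tau>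
    using has_vector_derivative_diff[OF x[OF that]
        bounded_linear.has_vector_derivative[OF bounded_linear_cutoff[of N] x[OF that]]] gen_in_V[of N "f \<tau>" "y \<tau>"]
    by (simp add: cutoff_space_iff)
  then have "norm (?z \<tau> - ?z s) \<le> 0 * \<bar>\<tau> - s\<bar>"
    by (rule vector_lipschitz[OF J(1)]) (use J in auto)
  then have "?z \<tau> = ?z s" by simp
  then show ?thesis using xs by (simp add: cutoff_space_iff)
qed

text \<open>Skewness makes the growth rate 0 in both directions of time. The function f selects the
  time at which the generator is evaluated: the running time for the truncated evolution, a constant
  for a frozen step.\<close>

lemma solution_isometry:
  assumes "convex J" "s \<in> J" "t \<in> J" "\<And>\<tau>. \<tau> \<in> J \<Longrightarrow> f \<tau> \<in> {a..b}"
    and x: "\<And>\<tau>. \<tau> \<in> J \<Longrightarrow> (x has_vector_derivative gen N (f \<tau>) (x \<tau>)) (at \<tau> within J)"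
  shows "norm (x t) = norm (x s)"
proof (rule antisym)
  have *: "\<bar>Re (cinner (gen N (f \<tau>) (x \<tau>)) (x \<tau>))\<bar> \<le> 0 * norm (x \<tau>)" if "\<tau> \<in> J" for \<tau>
    using Re_cinner_gen[OF assms(4)[OF that]] by simp
  show "norm (x t) \<le> norm (x s)"
    using norm_growth[OF assms(1) x * order.refl assms(2,3)] by simp
  show "norm (x s) \<le> norm (x t)"
    using norm_growth[OF assms(1) x * order.refl assms(3,2)] by simp
qed

lemma solution_diff:
  assumes "\<And>\<tau>. \<tau> \<in> J \<Longrightarrow> f \<tau> \<in> {a..b}"
    and "\<And>\<tau>. \<tau> \<in> J \<Longrightarrow> (x has_vector_derivative gen N (f \<tau>) (x \<tau>)) (at \<tau> within J)"
    and "\<And>\<tau>. \<tau> \<in> J \<Longrightarrow> (y has_vector_derivative gen N (f \<tau>) (y \<tau>)) (at \<tau> within J)"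
    and "\<tau> \<in> J"
  shows "((\<lambda>\<tau>. x \<tau> - y \<tau>) has_vector_derivative gen N (f \<tau>) (x \<tau> - y \<tau>)) (at \<tau> within J)"
  using has_vector_derivative_diff[OF assms(2,3)[OF assms(4)]] gen_diff[OF assms(1)[OF assms(4)]] by simp

lemma solution_dist:
  assumes "convex J" "s \<in> J" "t \<in> J" and f: "\<And>\<tau>. \<tau> \<in> J \<Longrightarrow> f \<tau> \<in> {a..b}"
    and x: "\<And>\<tau>. \<tau> \<in> J \<Longrightarrow> (x has_vector_derivative gen N (f \<tau>) (x \<tau>)) (at \<tau> within J)"
    and y: "\<And>\<tau>. \<tau> \<in> J \<Longrightarrow> (y has_vector_derivative gen N (f \<tau>) (y \<tau>)) (at \<tau> within J)"
  shows "norm (x t - y t) = norm (x s - y s)"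
  by (rule solution_isometry[where x = "\<lambda>\<tau>. x \<tau> - y \<tau>", OF assms(1,2,3) f solution_diff[OF f x y]])

section \<open>The truncated propagator and its algebra\<close>

abbreviation g :: "real \<Rightarrow> real \<Rightarrow> real \<Rightarrow> 'a \<Rightarrow> 'a" where
  "g \<equiv> galerkin H0 H {a..b}"

text \<open>The propagator is a definite description, so its linearity and composition laws are
  proved by exhibiting a solution. Two solutions with the same initial value keep distance
  0.\<close>

lemma galerkin_unique:
  assumes s: "s \<in> {a..b}" and t: "t \<in> {a..b}" and u: "x s \<in> V N"
    and x: "\<And>\<tau>. \<tau> \<in> {a..b} \<Longrightarrow> (x has_vector_derivative gen N \<tau> (x \<tau>)) (at \<tau> within {a..b})"
  shows "g N t s (x s) = x t"
  unfolding galerkin_def propagator_def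
proof (rule the_equality)
  have "x \<tau> \<in> V N" if "\<tau> \<in> {a..b}" for \<tau>
    by (rule solution_stays[OF convex_real_interval(5) s that u x])
  then show "\<exists>y. y s = x s \<and> y t = x t \<and> (\<forall>\<tau>\<in>{a..b}. y \<tau> \<in> V N \<and>
      (y has_vector_derivative gen N \<tau> (y \<tau>)) (at \<tau> within {a..b}))"
    using x by blast
next
  fix v assume "\<exists>y. y s = x s \<and> y t = v \<and> (\<forall>\<tau>\<in>{a..b}. y \<tau> \<in> V N \<and>
      (y has_vector_derivative gen N \<tau> (y \<tau>)) (at \<tau> within {a..b}))"
  then obtain y where y: "y s = x s" "y t = v"
    "\<And>\<tau>. \<tau> \<in> {a..b} \<Longrightarrow> (y has_vector_derivative gen N \<tau> (y \<tau>)) (at \<tau> within {a..b})" by blast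
  have "norm (y t - x t) = norm (y s - x s)"
    by (rule solution_dist[OF convex_real_interval(5) s t _ y(3) x])
  then show "v = x t" using y by simp
qed

lemma galerkin_solution:
  assumes N: "N \<ge> 0" and s: "s \<in> {a..b}" and u: "u \<in> V N"
  shows "g N s s u = u"
    and "\<tau> \<in> {a..b} \<Longrightarrow> g N \<tau> s u \<in> V N"
    and "\<tau> \<in> {a..b} \<Longrightarrow> ((\<lambda>\<tau>. g N \<tau> s u) has_vector_derivative gen N \<tau> (g N \<tau> s u)) (at \<tau> within {a..b})"
proof -
  obtain K where K: "K \<ge> 0" "\<And>t u. t \<in> {a..b} \<Longrightarrow> norm (tr N t u) \<le> K * norm u" using tr_bounded[OF N] by blast
  have "\<exists>x. x s = u \<and> (\<forall>\<tau>\<in>{a..b}. (x has_vector_derivative gen N \<tau> (x \<tau>)) (at \<tau> within {a..b}))"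
    by (rule linear_ode_solvable[OF bounded_linear_gen[OF _ N] K(1) _ continuous_on_gen[OF N] s])
       (simp_all add: norm_gen K(2))
  then obtain x where x: "x s = u"
    "\<And>\<tau>. \<tau> \<in> {a..b} \<Longrightarrow> (x has_vector_derivative gen N \<tau> (x \<tau>)) (at \<tau> within {a..b})" by blast
  have eq: "g N \<tau> s u = x \<tau>" if "\<tau> \<in> {a..b}" for \<tau>
    using galerkin_unique[OF s that, of x N] x u by simp
  show "g N s s u = u" using eq[OF s] x(1) by simp
  show "g N \<tau> s u \<in> V N" if "\<tau> \<in> {a..b}"
    using solution_stays[OF convex_real_interval(5) s that _ x(2)] x(1) u eq[OF that] by simp
  show "((\<lambda>\<tau>. g N \<tau> s u) has_vector_derivative gen N \<tau> (g N \<tau> s u)) (at \<tau> within {a..b})"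
    if "\<tau> \<in> {a..b}"
    unfolding eq[OF that]
    by (rule has_vector_derivative_transform[OF that _ x(2)[OF that]]) (simp add: eq)
qed

lemma norm_galerkin_diff:
  assumes "N \<ge> 0" "s \<in> {a..b}" "t \<in> {a..b}" "u \<in> V N" "v \<in> V N"
  shows "norm (g N t s u - g N t s v) = norm (u - v)"
  using solution_dist[OF convex_real_interval(5) assms(2,3) _
      galerkin_solution(3)[OF assms(1,2,4)] galerkin_solution(3)[OF assms(1,2,5)]]
    galerkin_solution(1)[OF assms(1,2)] assms by simp

lemma norm_galerkin:
  assumes "N \<ge> 0" "s \<in> {a..b}" "t \<in> {a..b}" "u \<in> V N"
  shows "norm (g N t s u) = norm u"
  using solution_isometry[OF convex_real_interval(5) assms(2,3) _ galerkin_solution(3)[OF assms(1,2,4)]]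
    galerkin_solution(1)[OF assms(1,2)] assms by simp

lemma galerkin_add:
  assumes "N \<ge> 0" "s \<in> {a..b}" "t \<in> {a..b}" "u \<in> V N" "v \<in> V N"
  shows "g N t s (u + v) = g N t s u + g N t s v"
proof -
  let ?x = "\<lambda>\<tau>. g N \<tau> s u + g N \<tau> s v"
  have "g N t s (?x s) = ?x t"
  proof (rule galerkin_unique[OF assms(2,3)])
    show "?x s \<in> V N"
      using assms csubspace_cutoff_space[of N] galerkin_solution(1)[OF assms(1,2)] by (simp add: csubspace_def)
    show "(?x has_vector_derivative gen N \<tau> (?x \<tau>)) (at \<tau> within {a..b})" if "\<tau> \<in> {a..b}" for \<tau>
      using has_vector_derivative_add[OF galerkin_solution(3)[OF assms(1,2,4) that]
          galerkin_solution(3)[OF assms(1,2,5) that]] that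
      by (simp add: tr_linear scaleC_add_right)
  qed
  then show ?thesis using galerkin_solution(1)[OF assms(1,2)] assms by simp
qed

lemma galerkin_scaleC:
  assumes "N \<ge> 0" "s \<in> {a..b}" "t \<in> {a..b}" "u \<in> V N"
  shows "g N t s (z *\<^sub>C u) = z *\<^sub>C g N t s u"
proof -
  let ?x = "\<lambda>\<tau>. z *\<^sub>C g N \<tau> s u"
  have "g N t s (?x s) = ?x t"
  proof (rule galerkin_unique[OF assms(2,3)])
    show "?x s \<in> V N"
      using assms csubspace_cutoff_space[of N] galerkin_solution(1)[OF assms(1,2)] by (simp add: csubspace_def)
    show "(?x has_vector_derivative gen N \<tau> (?x \<tau>)) (at \<tau> within {a..b})" if "\<tau> \<in> {a..b}" for \<tau>
      using bounded_linear.has_vector_derivative[OF bounded_linear_scaleC[of z] galerkin_solution(3)[OF assms(1,2,4) that]] that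
      by (simp add: tr_linear scaleC_scaleC mult.commute)
  qed
  then show ?thesis using galerkin_solution(1)[OF assms(1,2)] assms by simp
qed

lemma galerkin_comp:
  assumes "N \<ge> 0" "s \<in> {a..b}" "r \<in> {a..b}" "t \<in> {a..b}" "u \<in> V N"
  shows "g N t r (g N r s u) = g N t s u"
  using galerkin_unique[where x = "\<lambda>\<tau>. g N \<tau> s u", OF assms(3,4) galerkin_solution(2)[OF assms(1,2,5,3)]
      galerkin_solution(3)[OF assms(1,2,5)]] by simp

text \<open>The two contributions to the derivative of the inner product cancel by symmetry of
  \<open>tr\<close>.\<close>

lemma galerkin_cinner:
  assumes "N \<ge> 0" "s \<in> {a..b}" "t \<in> {a..b}" "u \<in> V N" "v \<in> V N"
  shows "cinner (g N t s u) (g N t s v) = cinner u v"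
proof -
  let ?f = "\<lambda>\<tau>. cinner (g N \<tau> s u) (g N \<tau> s v)"
  have "(?f has_vector_derivative 0) (at \<tau> within {a..b})" if "\<tau> \<in> {a..b}" for \<tau>
    using has_vector_derivative_cinner[OF galerkin_solution(3)[OF assms(1,2,4) that]
        galerkin_solution(3)[OF assms(1,2,5) that]] that
    by (simp add: cinner_scaleC_left cinner_scaleC_right tr_symmetric)
  then have "norm (?f t - ?f s) \<le> 0 * \<bar>t - s\<bar>"
    by (rule vector_lipschitz[OF convex_real_interval(5)]) (use assms in auto)
  then have "?f t = ?f s" by simp
  then show ?thesis using galerkin_solution(1)[OF assms(1,2)] assms by simp
qed

lemma galerkin_lipschitz:
  assumes N: "N \<ge> 0"
  obtains K where "K \<ge> 0" "\<And>s t t' u. s \<in> {a..b} \<Longrightarrow> t \<in> {a..b} \<Longrightarrow> t' \<in> {a..b} \<Longrightarrow> u \<in> V N \<Longrightarrow>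
    norm (g N t s u - g N t' s u) \<le> K * norm u * \<bar>t - t'\<bar>"
proof -
  obtain K where K: "K \<ge> 0" "\<And>t u. t \<in> {a..b} \<Longrightarrow> norm (tr N t u) \<le> K * norm u" using tr_bounded[OF N] by blast
  have "norm (g N t s u - g N t' s u) \<le> K * norm u * \<bar>t - t'\<bar>"
    if "s \<in> {a..b}" "t \<in> {a..b}" "t' \<in> {a..b}" "u \<in> V N" for s t t' u
  proof (rule vector_lipschitz[OF convex_real_interval(5) galerkin_solution(3)[OF N that(1,4)] _ that(3,2)])
    fix \<tau> assume \<tau>: "\<tau> \<in> {a..b}"
    show "norm (gen N \<tau> (g N \<tau> s u)) \<le> K * norm u"
      using K(2)[OF \<tau>, of "g N \<tau> s u"] norm_galerkin[OF N that(1) \<tau> that(4)] by (simp add: norm_gen)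
  qed
  then show ?thesis using that K(1) by blast
qed

end

text \<open>Both functions are set to 0 on the exceptional null set, which leaves their integrals
  unchanged and turns the bound into one that holds at every point.\<close>

lemma integral_abs_le_AE:
  fixes f c :: "real \<Rightarrow> real"
  assumes f: "f integrable_on {p..q}" and c: "c integrable_on {p..q}"
    and le: "AE t in lebesgue. t \<in> {p..q} \<longrightarrow> \<bar>f t\<bar> \<le> c t * k"
  shows "\<bar>integral {p..q} f\<bar> \<le> integral {p..q} c * k"
proof -
  obtain S where S: "{t \<in> space lebesgue. \<not> (t \<in> {p..q} \<longrightarrow> \<bar>f t\<bar> \<le> c t * k)} \<subseteq> S" "S \<in> null_sets lebesgue"
    using le by (auto elim!: AE_E simp: null_sets_def)
  have neg: "negligible S" using S(2) by (simp add: negligible_iff_null_sets)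
  let ?f = "\<lambda>t. if t \<in> S then 0 else f t" and ?c = "\<lambda>t. if t \<in> S then 0 else c t * k"
  have "norm (integral {p..q} ?f) \<le> integral {p..q} ?c"
  proof (rule integral_norm_bound_integral)
    show "?f integrable_on {p..q}" by (rule integrable_spike[OF f neg]) auto
    show "?c integrable_on {p..q}"
      by (rule integrable_spike[OF integrable_on_mult_left[OF c, of k] neg]) auto
    show "norm (?f t) \<le> ?c t" if "t \<in> {p..q}" for t using S(1) that by auto
  qed
  moreover have "integral {p..q} ?f = integral {p..q} f" by (rule integral_spike[OF neg]) auto
  moreover have "integral {p..q} ?c = integral {p..q} (\<lambda>t. c t * k)" by (rule integral_spike[OF neg]) auto
  ultimately show ?thesis by simp
qed

context truncated_evolution
begin

section \<open>The energy estimate\<close>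

definition B :: "real \<Rightarrow> 'a \<Rightarrow> 'a" where
  "B N v = Lambda_pow H0 (2 * (\<mu> + \<sigma>)) (cutoff H0 N v)"

text \<open>The rate of change of \<Phi> at time t when the truncated solution passes through v. Up
  to sign it is the commutator expression of the hypothesis.\<close>

definition q :: "real \<Rightarrow> real \<Rightarrow> 'a \<Rightarrow> real" where
  "q N t v = 2 * Re (cinner (gen N t v) (B N v))"

definition \<Phi> :: "'a \<Rightarrow> real" where
  "\<Phi> v = (sob_norm H0 (\<mu> + \<sigma>) v)\<^sup>2"

definition G :: "real \<Rightarrow> real" where
  "G t = integral {a..t} c"

lemma bounded_linear_B: "bounded_linear (B N)"
  unfolding B_def using \<mu> \<sigma> by (intro bounded_linear_Lambda_cutoff) auto

lemma \<Phi>_eq: "v \<in> V N \<Longrightarrow> \<Phi> v = Re (cinner v (B N v))"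
  using sob_norm_sq_cutoff[of "\<mu> + \<sigma>" v N] \<mu> \<sigma> by (simp add: \<Phi>_def B_def cutoff_space_iff)

lemma \<Phi>_deriv:
  assumes x: "(x has_vector_derivative gen N t (x t)) (at t within J)"
    and V: "\<And>\<tau>. \<tau> \<in> J \<Longrightarrow> x \<tau> \<in> V N" and t: "t \<in> J"
  shows "((\<lambda>\<tau>. \<Phi> (x \<tau>)) has_vector_derivative q N t (x t)) (at t within J)"
proof -
  let ?y = "gen N t (x t)"
  have "((\<lambda>\<tau>. cinner (x \<tau>) (B N (x \<tau>))) has_vector_derivative
      cinner (x t) (B N ?y) + cinner ?y (B N (x t))) (at t within J)"
    by (intro has_vector_derivative_cinner x bounded_linear.has_vector_derivative[OF bounded_linear_B])
  then have "((\<lambda>\<tau>. Re (cinner (x \<tau>) (B N (x \<tau>)))) has_vector_derivative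
      Re (cinner (x t) (B N ?y) + cinner ?y (B N (x t)))) (at t within J)"
    by (rule bounded_linear.has_vector_derivative[OF bounded_linear_Re])
  moreover have "cinner (x t) (B N ?y) = cnj (cinner ?y (B N (x t)))"
  proof -
    have "cinner (x t) (B N ?y) = cinner (B N (x t)) ?y"
      unfolding B_def using \<mu> \<sigma> by (intro Lambda_cutoff_symmetric[symmetric]) auto
    then show ?thesis using cinner_commute by metis
  qed
  ultimately have "((\<lambda>\<tau>. Re (cinner (x \<tau>) (B N (x \<tau>)))) has_vector_derivative q N t (x t)) (at t within J)"
    by (simp add: q_def)
  then show ?thesis
    by (rule has_vector_derivative_transform[OF t, rotated]) (simp add: \<Phi>_eq V)
qed

text \<open>The reason for uniformity in N: the outer cutoff of \<open>tr\<close> moves onto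
  \<open>B N v\<close>, where it is absorbed, and the inner one fixes v. What remains is the
  commutator with H itself, bounded by the given c.\<close>

lemma abs_q_le_AE:
  assumes v: "v \<in> V N"
  shows "AE t in lebesgue. t \<in> {a..b} \<longrightarrow> \<bar>q N t v\<bar> \<le> c t * \<Phi> v"
proof -
  have cv: "cutoff H0 N v = v" using v by (simp add: cutoff_space_iff)
  then have "v \<in> sob_inf H0" using cutoff_in_sob_inf[of N v] by simp
  moreover have "\<bar>q N t v\<bar> = cmod (\<i> * (cinner (H t v) (Lambda_pow H0 (2 * (\<mu> + \<sigma>)) v)
                          - cinner (Lambda_pow H0 (2 * (\<mu> + \<sigma>)) v) (H t v)))" for t
  proof -
    let ?z = "cinner (H t v) (B N v)"
    have "cinner (tr N t v) (B N v) = ?z"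
      unfolding truncation_def cv using \<mu> \<sigma>
      by (simp add: cutoff_symmetric B_def cutoff_Lambda_cutoff)
    then have "q N t v = 2 * Im ?z" by (simp add: q_def cinner_scaleC_left)
    moreover have "cinner (B N v) (H t v) = cnj ?z" by (rule cinner_commute)
    moreover have "\<i> * (?z - cnj ?z) = complex_of_real (- 2 * Im ?z)" by (simp add: complex_eq_iff)
    ultimately show ?thesis by (simp add: B_def cv)
  qed
  ultimately show ?thesis using commutator by (simp add: \<Phi>_def)
qed

lemma G_diff: "p \<in> {a..b} \<Longrightarrow> p \<le> r \<Longrightarrow> r \<le> b \<Longrightarrow> G r - G p = integral {p..r} c"
  and c_integrable: "p \<in> {a..b} \<Longrightarrow> r \<le> b \<Longrightarrow> c integrable_on {p..r}"
proof -
  have ci: "c integrable_on {a..b}" using c_int by (rule set_lebesgue_integral_eq_integral(1))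
  show "c integrable_on {p..r}" if "p \<in> {a..b}" "r \<le> b" for p r
    using that by (intro integrable_on_subinterval[OF ci]) auto
  show "G r - G p = integral {p..r} c" if "p \<in> {a..b}" "p \<le> r" "r \<le> b"
  proof -
    have "c integrable_on {a..r}" using that by (intro integrable_on_subinterval[OF ci]) auto
    then have "integral {a..p} c + integral {p..r} c = integral {a..r} c"
      using that by (intro Henstock_Kurzweil_Integration.integral_combine) auto
    then show ?thesis by (simp add: G_def)
  qed
qed

lemma mono_G: "mono_on {a..b} G"
proof (rule mono_onI)
  fix p r assume pr: "p \<in> {a..b}" "r \<in> {a..b}" "p \<le> r"
  have "0 \<le> integral {p..r} c"
    using pr by (intro integral_nonneg c_integrable) (auto intro: c_nonneg)
  then show "G p \<le> G r" using G_diff[of p r] pr by simp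
qed

lemma q_lipschitz:
  assumes N: "N \<ge> 0"
  obtains K where "K \<ge> 0" "\<And>t v w. t \<in> {a..b} \<Longrightarrow>
    \<bar>q N t v - q N t w\<bar> \<le> K * (norm v + norm w) * norm (v - w)"
proof -
  obtain K1 where K1: "K1 \<ge> 0" "\<And>t u. t \<in> {a..b} \<Longrightarrow> norm (tr N t u) \<le> K1 * norm u"
    using tr_bounded[OF N] by blast
  obtain K2 where K2: "K2 \<ge> 0" "\<And>u. norm (B N u) \<le> norm u * K2"
    using bounded_linear.nonneg_bounded[OF bounded_linear_B] by blast
  have gB: "cmod (cinner (gen N t x) (B N y)) \<le> K1 * K2 * norm x * norm y" if "t \<in> {a..b}" for t x y
  proof -
    have "cmod (cinner (gen N t x) (B N y)) \<le> norm (gen N t x) * norm (B N y)" by (rule cmod_cinner_le)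
    also have "\<dots> \<le> (K1 * norm x) * (norm y * K2)"
      using K1 K2 that by (intro mult_mono) (auto simp: norm_gen)
    finally show ?thesis by (simp add: algebra_simps)
  qed
  have "\<bar>q N t v - q N t w\<bar> \<le> (2 * (K1 * K2)) * (norm v + norm w) * norm (v - w)" if t: "t \<in> {a..b}" for t v w
  proof -
    have "cinner (gen N t v) (B N v) - cinner (gen N t w) (B N w)
        = cinner (gen N t (v - w)) (B N v) + cinner (gen N t w) (B N (v - w))"
      using gen_diff[OF t, of N v w] linear_diff[OF bounded_linear.linear[OF bounded_linear_B], of N v w]
      by (simp add: cinner_diff_left cinner_diff_right)
    then have "q N t v - q N t w = 2 * Re (cinner (gen N t (v - w)) (B N v) + cinner (gen N t w) (B N (v - w)))"
      by (simp add: q_def flip: right_diff_distrib minus_complex.sel)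
    also have "\<bar>\<dots>\<bar> \<le> 2 * cmod (cinner (gen N t (v - w)) (B N v) + cinner (gen N t w) (B N (v - w)))"
      using abs_Re_le_cmod by (simp add: abs_mult del: plus_complex.sel)
    also have "\<dots> \<le> 2 * (K1 * K2 * norm (v - w) * norm v + K1 * K2 * norm w * norm (v - w))"
      by (intro mult_left_mono order_trans[OF norm_triangle_ineq] add_mono gB t) simp
    finally show ?thesis by (simp add: algebra_simps)
  qed
  moreover have "2 * (K1 * K2) \<ge> 0" using K1(1) K2(1) by simp
  ultimately show ?thesis using that by blast
qed

lemma continuous_on_q:
  assumes N: "N \<ge> 0" and x: "continuous_on {a..b} x"
  shows "continuous_on {a..b} (\<lambda>t. q N t (x t))"
proof -
  obtain K where K: "K \<ge> 0" "\<And>t u. t \<in> {a..b} \<Longrightarrow> norm (tr N t u) \<le> K * norm u"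
    using tr_bounded[OF N] by blast
  have "continuous_on {a..b} (\<lambda>t. gen N t (x t))"
    by (rule continuous_on_strong[OF bounded_linear_gen[OF _ N] _ continuous_on_gen[OF N] x, where K = K])
       (simp_all add: norm_gen K)
  moreover have "continuous_on {a..b} (\<lambda>t. B N (x t))"
    by (rule bounded_linear.continuous_on[OF bounded_linear_B x])
  ultimately show ?thesis
    unfolding q_def by (intro continuous_intros continuous_on_cinner)
qed

text \<open>The vector may be frozen at any time e of the interval. Both end points are needed,
  since Gronwall compares with the starting value of a step whichever way time runs.\<close>

lemma energy_increment:
  assumes N: "N \<ge> 0" and s: "s \<in> {a..b}" and u: "u \<in> V N"
  obtains K where "K \<ge> 0" "\<And>p r e. a \<le> p \<Longrightarrow> p \<le> r \<Longrightarrow> r \<le> b \<Longrightarrow> e \<in> {p..r} \<Longrightarrow>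
    \<bar>\<Phi> (g N r s u) - \<Phi> (g N p s u)\<bar> \<le> (G r - G p) * \<Phi> (g N e s u) + K * (r - p)\<^sup>2"
proof -
  let ?x = "\<lambda>t. g N t s u"
  note sol = galerkin_solution[OF N s u]
  obtain K1 where K1: "K1 \<ge> 0" "\<And>t v w. t \<in> {a..b} \<Longrightarrow>
    \<bar>q N t v - q N t w\<bar> \<le> K1 * (norm v + norm w) * norm (v - w)" using q_lipschitz[OF N] by blast
  obtain K2 where K2: "K2 \<ge> 0" "\<And>s t t' u. s \<in> {a..b} \<Longrightarrow> t \<in> {a..b} \<Longrightarrow> t' \<in> {a..b} \<Longrightarrow> u \<in> V N \<Longrightarrow>
    norm (g N t s u - g N t' s u) \<le> K2 * norm u * \<bar>t - t'\<bar>" using galerkin_lipschitz[OF N] by blast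
  \<comment> \<open>Lipschitz constant of q times Lipschitz constant of the solution, with
    \<open>norm u\<close> for all conserved norms. It depends on N and u and is later eliminated by
    refinement.\<close>
  define K where "K = K1 * (2 * norm u) * (K2 * norm u)"
  have K: "K \<ge> 0" using K1(1) K2(1) by (simp add: K_def)
  have "\<bar>\<Phi> (?x r) - \<Phi> (?x p)\<bar> \<le> (G r - G p) * \<Phi> (?x e) + K * (r - p)\<^sup>2"
    if pr: "a \<le> p" "p \<le> r" "r \<le> b" and e: "e \<in> {p..r}" for p r e
  proof -
    have sub: "{p..r} \<subseteq> {a..b}" and eab: "e \<in> {a..b}" using pr e by auto
    have contx: "continuous_on {a..b} ?x" by (rule continuous_on_vector_derivative[OF sol(3)])
    have i1: "((\<lambda>t. q N t (?x t)) has_integral \<Phi> (?x r) - \<Phi> (?x p)) {p..r}"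
    proof (rule fundamental_theorem_of_calculus[OF pr(2)])
      fix t assume t: "t \<in> {p..r}"
      then have tab: "t \<in> {a..b}" using sub by blast
      have "((\<lambda>\<tau>. \<Phi> (?x \<tau>)) has_vector_derivative q N t (?x t)) (at t within {a..b})"
        using \<Phi>_deriv[where x = ?x, OF sol(3)[OF tab] sol(2) tab] by simp
      then show "((\<lambda>\<tau>. \<Phi> (?x \<tau>)) has_vector_derivative q N t (?x t)) (at t within {p..r})"
        using sub by (rule has_vector_derivative_within_subset)
    qed
    have "continuous_on {p..r} (\<lambda>t. q N t (?x e))"
      by (rule continuous_on_subset[OF continuous_on_q[OF N continuous_on_const] sub])
    then have i2: "(\<lambda>t. q N t (?x e)) integrable_on {p..r}" by (rule integrable_continuous_real)
    have 1: "\<bar>integral {p..r} (\<lambda>t. q N t (?x e))\<bar> \<le> integral {p..r} c * \<Phi> (?x e)"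
    proof (rule integral_abs_le_AE[OF i2])
      show "c integrable_on {p..r}" using pr by (intro c_integrable) auto
      show "AE t in lebesgue. t \<in> {p..r} \<longrightarrow> \<bar>q N t (?x e)\<bar> \<le> c t * \<Phi> (?x e)"
        using abs_q_le_AE[OF sol(2)[OF eab]] by (rule eventually_mono) (use sub in blast)
    qed
    have i3: "((\<lambda>t. q N t (?x t) - q N t (?x e)) has_integral
        (\<Phi> (?x r) - \<Phi> (?x p) - integral {p..r} (\<lambda>t. q N t (?x e)))) {p..r}"
      by (rule has_integral_diff[OF i1 integrable_integral[OF i2]])
    \<comment> \<open>Freezing costs at most K times the length of the interval pointwise, and
      integration contributes the length once more: the error is quadratic.\<close>
    have 2: "norm (\<Phi> (?x r) - \<Phi> (?x p) - integral {p..r} (\<lambda>t. q N t (?x e))) \<le> K * (r - p) * measure lborel {p..r}"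
    proof (rule has_integral_bound_real[OF _ finite.emptyI i3])
      show "0 \<le> K * (r - p)" using K pr by simp
      fix t assume "t \<in> {p..r} - {}"
      then have t: "t \<in> {p..r}" by simp
      then have tab: "t \<in> {a..b}" using sub by blast
      have "\<bar>q N t (?x t) - q N t (?x e)\<bar> \<le> K1 * (norm (?x t) + norm (?x e)) * norm (?x t - ?x e)"
        by (rule K1(2)[OF tab])
      also have "\<dots> = K1 * (2 * norm u) * norm (?x t - ?x e)"
        using norm_galerkin[OF N s _ u] tab eab by simp
      also have "\<dots> \<le> K1 * (2 * norm u) * (K2 * norm u * \<bar>t - e\<bar>)"
        using K1(1) by (intro mult_left_mono K2(2) s tab eab u) auto
      also have "\<dots> = K * \<bar>t - e\<bar>" by (simp add: K_def)
      also have "\<dots> \<le> K * (r - p)" using K t e by (intro mult_left_mono) auto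
      finally show "norm (q N t (?x t) - q N t (?x e)) \<le> K * (r - p)" by simp
    qed
    have "G r - G p = integral {p..r} c" using pr by (intro G_diff) auto
    then show ?thesis using 1 2 pr by (simp add: power2_eq_square mult.assoc)
  qed
  then show ?thesis using that K by blast
qed

lemma galerkin_sob_bound:
  assumes N: "N \<ge> 0" and s: "s \<in> {a..b}" and t: "t \<in> {a..b}" and u: "u \<in> V N"
  shows "sob_norm H0 (\<mu> + \<sigma>) (g N t s u) \<le> exp (G b) * sob_norm H0 (\<mu> + \<sigma>) u"
proof -
  obtain K where K: "K \<ge> 0" "\<And>p r e. a \<le> p \<Longrightarrow> p \<le> r \<Longrightarrow> r \<le> b \<Longrightarrow> e \<in> {p..r} \<Longrightarrow>
    \<bar>\<Phi> (g N r s u) - \<Phi> (g N p s u)\<bar> \<le> (G r - G p) * \<Phi> (g N e s u) + K * (r - p)\<^sup>2"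
    using energy_increment[OF N s u] by blast
  have mono: "G p \<le> G r" if "a \<le> p" "p \<le> r" "r \<le> b" for p r
    using mono_onD[OF mono_G, of p r] that by simp
  have "\<Phi> (g N t s u) \<le> exp \<bar>G t - G s\<bar> * \<Phi> (g N s s u)"
  proof (rule gronwall[where \<phi> = "\<lambda>t. \<Phi> (g N t s u)", OF mono_G K(1) _ _ s t])
    show "0 \<le> \<Phi> (g N p s u)" for p by (simp add: \<Phi>_def)
    fix p r assume pr: "p \<in> {a..b}" "r \<in> {a..b}"
    show "\<Phi> (g N r s u) - \<Phi> (g N p s u) \<le> \<bar>G r - G p\<bar> * \<Phi> (g N p s u) + K * (r - p)\<^sup>2"
    proof (cases "p \<le> r")
      case True
      then show ?thesis using K(2)[of p r p] mono[of p r] pr by simp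
    next
      \<comment> \<open>Backwards in time the starting value sits at the right end of the interval,
        so this is where the vector is frozen.\<close>
      case False
      then show ?thesis using K(2)[of r p p] mono[of r p] pr by (simp add: power2_commute[of r p])
    qed
  qed
  \<comment> \<open>The difference of G-values is at most \<open>G b\<close>; the doubled exponent
    is chosen to make the right side the square of \<open>exp (G b)\<close> times a norm.\<close>
  also have "\<dots> \<le> exp (2 * G b) * \<Phi> (g N s s u)"
  proof -
    have "G a = 0" by (simp add: G_def)
    then have "0 \<le> G s" "G s \<le> G b" "0 \<le> G t" "G t \<le> G b"
      using mono[of a s] mono[of s b] mono[of a t] mono[of t b] s t by auto
    then show ?thesis by (intro mult_right_mono) (auto simp: \<Phi>_def)
  qed
  also have "\<dots> = (exp (G b) * sob_norm H0 (\<mu> + \<sigma>) u)\<^sup>2"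
    using galerkin_solution(1)[OF N s u]
    by (simp add: \<Phi>_def power_mult_distrib flip: exp_double)
  finally show ?thesis
    unfolding \<Phi>_def by (rule power2_le_imp_le) (simp add: sob_norm_nonneg)
qed

section \<open>Convergence of the truncated propagators\<close>

lemma galerkin_rate:
  obtains C where "C \<ge> 0" "\<And>N N' s t u. 0 \<le> N \<Longrightarrow> N \<le> N' \<Longrightarrow> s \<in> {a..b} \<Longrightarrow> t \<in> {a..b} \<Longrightarrow>
    u \<in> sob H0 (\<mu> + \<sigma>) \<Longrightarrow> norm (g N' t s (cutoff H0 N' u) - g N t s (cutoff H0 N u))
      \<le> C * (1 + N) powr (- \<sigma>) * sob_norm H0 (\<mu> + \<sigma>) u"
proof -
  obtain C0 where C0: "C0 \<ge> 0" "\<And>t u. t \<in> {a..b} \<Longrightarrow> u \<in> sob H0 (\<sigma> + \<mu>) \<Longrightarrow>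
      sob_norm H0 \<sigma> (H t u) \<le> C0 * sob_norm H0 (\<sigma> + \<mu>) u"
    using norm_continuous_bounded[OF H_cont ab] by blast
  \<comment> \<open>The 1 accounts for the difference of the initial values, the second summand for
    the source accumulated over an interval of length at most b - a.\<close>
  define C where "C = 1 + C0 * exp (G b) * (b - a)"
  have C: "C \<ge> 0" using C0(1) ab by (simp add: C_def)
  have "norm (g N' t s (cutoff H0 N' u) - g N t s (cutoff H0 N u))
      \<le> C * (1 + N) powr (- \<sigma>) * sob_norm H0 (\<mu> + \<sigma>) u"
    if N: "0 \<le> N" "N \<le> N'" and s: "s \<in> {a..b}" and t: "t \<in> {a..b}" and u: "u \<in> sob H0 (\<mu> + \<sigma>)" for N N' s t u
  proof -
    have N': "N' \<ge> 0" using N by simp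
    let ?R = "sob_norm H0 (\<mu> + \<sigma>) u" and ?w = "(1 + N) powr (- \<sigma>)"
    have V: "cutoff H0 N u \<in> V N" "cutoff H0 N' u \<in> V N'" by (simp_all add: cutoff_space_def)
    let ?x = "\<lambda>\<tau>. g N \<tau> s (cutoff H0 N u)" and ?y = "\<lambda>\<tau>. g N' \<tau> s (cutoff H0 N' u)"
    \<comment> \<open>Both generators act on the same vector of V N, which lies in V N' too. The
      inner cutoffs are then invisible and only the outer ones differ.\<close>
    let ?f = "\<lambda>\<tau>. gen N' \<tau> (?x \<tau>) - gen N \<tau> (?x \<tau>)"
    note x = galerkin_solution[OF N(1) s V(1)] and y = galerkin_solution[OF N' s V(2)]
    define K where "K = ?w * (C0 * (exp (G b) * ?R))"
    have f: "norm (?f \<tau>) \<le> K" if \<tau>: "\<tau> \<in> {a..b}" for \<tau>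
    proof -
      have xV: "cutoff H0 N (?x \<tau>) = ?x \<tau>" using x(2)[OF \<tau>] by (simp add: cutoff_space_iff)
      then have xV': "cutoff H0 N' (?x \<tau>) = ?x \<tau>" using cutoff_cutoff(1)[OF N(2)] by metis
      have xs: "?x \<tau> \<in> sob H0 (\<sigma> + \<mu>)" using cutoff_in_sob[of "\<sigma> + \<mu>" N "?x \<tau>"] xV \<mu> \<sigma> by simp
      have "norm (?f \<tau>) = norm (cutoff H0 N' (H \<tau> (?x \<tau>)) - cutoff H0 N (H \<tau> (?x \<tau>)))"
        by (simp add: truncation_def xV xV' norm_scaleC flip: scaleC_diff_right)
      also have "\<dots> \<le> ?w * sob_norm H0 \<sigma> (H \<tau> (?x \<tau>))"
      proof (rule norm_cutoff_diff_le)
        show "H \<tau> (?x \<tau>) \<in> sob H0 \<sigma>"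
          using H_cont[unfolded norm_continuous_sob_def, THEN conjunct1, THEN bspec, OF \<tau>] xs
          by (rule bounded_sob_image)
      qed (use \<sigma> N in auto)
      also have "\<dots> \<le> ?w * (C0 * sob_norm H0 (\<sigma> + \<mu>) (?x \<tau>))"
        by (intro mult_left_mono C0(2) \<tau> xs) simp
      also have "\<dots> \<le> ?w * (C0 * (exp (G b) * sob_norm H0 (\<mu> + \<sigma>) (cutoff H0 N u)))"
        using galerkin_sob_bound[OF N(1) s \<tau> V(1)] C0(1)
        by (intro mult_left_mono) (auto simp: add.commute)
      also have "\<dots> \<le> K"
        unfolding K_def using C0(1) \<mu> \<sigma> u by (intro mult_left_mono sob_norm_cutoff_le_sob_norm) auto
      finally show ?thesis .
    qed
    have K: "K \<ge> 0" using order_trans[OF norm_ge_zero f[OF t]] .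
    have "norm (?y t - ?x t) \<le> norm (?y s - ?x s) + K * \<bar>t - s\<bar>"
    proof (rule norm_growth[OF convex_real_interval(5) _ _ K s t])
      fix \<tau> assume \<tau>: "\<tau> \<in> {a..b}"
      show "((\<lambda>\<tau>. ?y \<tau> - ?x \<tau>) has_vector_derivative gen N' \<tau> (?y \<tau>) - gen N \<tau> (?x \<tau>)) (at \<tau> within {a..b})"
        by (intro has_vector_derivative_diff x(3) y(3) \<tau>)
      \<comment> \<open>Arranged so that the generator of index N' acts on the difference of the
        solutions, where it is skew and drops out of the real part.\<close>
      have "gen N' \<tau> (?y \<tau>) - gen N \<tau> (?x \<tau>) = gen N' \<tau> (?y \<tau> - ?x \<tau>) + ?f \<tau>"
        using gen_diff[OF \<tau>, of N' "?y \<tau>" "?x \<tau>"] by simp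
      then have "Re (cinner (gen N' \<tau> (?y \<tau>) - gen N \<tau> (?x \<tau>)) (?y \<tau> - ?x \<tau>)) = Re (cinner (?f \<tau>) (?y \<tau> - ?x \<tau>))"
        using Re_cinner_gen[OF \<tau>, of N' "?y \<tau> - ?x \<tau>"] by (simp only: cinner_add_left plus_complex.sel)
      moreover have "\<bar>Re (cinner (?f \<tau>) (?y \<tau> - ?x \<tau>))\<bar> \<le> K * norm (?y \<tau> - ?x \<tau>)"
        by (rule order_trans[OF abs_Re_le_cmod
              order_trans[OF cmod_cinner_le mult_right_mono[OF f[OF \<tau>] norm_ge_zero]]])
      ultimately show "\<bar>Re (cinner (gen N' \<tau> (?y \<tau>) - gen N \<tau> (?x \<tau>)) (?y \<tau> - ?x \<tau>))\<bar> \<le> K * norm (?y \<tau> - ?x \<tau>)"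
        by (simp only:)
    qed
    moreover have "norm (?y s - ?x s) \<le> ?w * ?R"
    proof -
      have "norm (cutoff H0 N' u - cutoff H0 N u) \<le> ?w * sob_norm H0 \<sigma> u"
        using \<mu> \<sigma> N sob_mono(1)[OF _ u, of \<sigma>] by (intro norm_cutoff_diff_le) auto
      also have "\<dots> \<le> ?w * ?R" using \<mu> u by (intro mult_left_mono sob_mono(2)) auto
      finally show ?thesis using x(1) y(1) by simp
    qed
    moreover have "K * \<bar>t - s\<bar> \<le> K * (b - a)" using K s t by (intro mult_left_mono) auto
    ultimately show ?thesis by (simp add: C_def K_def algebra_simps)
  qed
  then show ?thesis using that C by blast
qed

section \<open>Piecewise frozen evolution\<close>

lemma exp_step:
  assumes N: "N \<ge> 0" and s: "s \<in> {a..b}" and h: "h \<ge> 0"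
  obtains X where "X s = u" "X (s + h) = op_exp (\<lambda>v. (- \<i> * complex_of_real h) *\<^sub>C tr N s v) u"
    "\<And>\<tau>. \<tau> \<in> {s..s + h} \<Longrightarrow> (X has_vector_derivative gen N s (X \<tau>)) (at \<tau> within {s..s + h})"
proof -
  have "(\<lambda>v. (- \<i> * complex_of_real h) *\<^sub>C tr N s v) = (\<lambda>v. h *\<^sub>R gen N s v)"
    by (simp add: scaleR_scaleC scaleC_scaleC mult.commute)
  then show ?thesis
    using op_exp_solves_ode[OF bounded_linear_gen[OF s N] h, of s u] that unfolding op_exp_def by auto
qed

abbreviation e :: "real \<Rightarrow> real \<Rightarrow> real \<Rightarrow> 'a \<Rightarrow> 'a" where
  "e N s h \<equiv> op_exp (\<lambda>v. (- \<i> * complex_of_real h) *\<^sub>C tr N s v)"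

lemma exp_step_dist:
  assumes N: "N \<ge> 0" and s: "s \<in> {a..b}" and h: "h \<ge> 0"
  shows "norm (e N s h u - e N s h v) = norm (u - v)"
proof -
  obtain X where X: "X s = u" "X (s + h) = e N s h u"
    "\<And>\<tau>. \<tau> \<in> {s..s + h} \<Longrightarrow> (X has_vector_derivative gen N s (X \<tau>)) (at \<tau> within {s..s + h})"
    using exp_step[OF N s h] by metis
  obtain Y where Y: "Y s = v" "Y (s + h) = e N s h v"
    "\<And>\<tau>. \<tau> \<in> {s..s + h} \<Longrightarrow> (Y has_vector_derivative gen N s (Y \<tau>)) (at \<tau> within {s..s + h})"
    using exp_step[OF N s h] by metis
  show ?thesis
    using solution_dist[where f = "\<lambda>_. s" and s = s and t = "s + h", OF convex_real_interval(5) _ _ s X(3) Y(3)]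
      X Y h by simp
qed

lemma exp_step_surj:
  assumes N: "N \<ge> 0" and s: "s \<in> {a..b}" and h: "h \<ge> 0" and w: "w \<in> V N"
  shows "\<exists>u\<in>V N. e N s h u = w"
proof -
  obtain K where K: "K \<ge> 0" "\<And>v. norm (gen N s v) \<le> K * norm v"
    using tr_bounded[OF N] s by (metis norm_gen)
  obtain Y where Y: "Y (s + h) = w"
    "\<And>\<tau>. \<tau> \<in> {s..s + h} \<Longrightarrow> (Y has_vector_derivative gen N s (Y \<tau>)) (at \<tau> within {s..s + h})"
    using linear_ode_solvable[where A = "\<lambda>_. gen N s" and a = s and b = "s + h" and s = "s + h" and u = w,
        OF bounded_linear_gen[OF s N] K(1) K(2) continuous_on_const] h by auto
  have Ys: "Y s \<in> V N"
    by (rule solution_stays[where s = "s + h" and f = "\<lambda>_. s", OF convex_real_interval(5) _ _ _ Y(2)])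
       (use Y(1) w h in auto)
  obtain X where X: "X s = Y s" "X (s + h) = e N s h (Y s)"
    "\<And>\<tau>. \<tau> \<in> {s..s + h} \<Longrightarrow> (X has_vector_derivative gen N s (X \<tau>)) (at \<tau> within {s..s + h})"
    using exp_step[OF N s h] by metis
  have "norm (X (s + h) - Y (s + h)) = norm (X s - Y s)"
    by (rule solution_dist[where f = "\<lambda>_. s", OF convex_real_interval(5) _ _ s X(3) Y(2)])
       (use h in auto)
  then show ?thesis using X Y Ys by (intro bexI[of _ "Y s"]) auto
qed

lemma exp_step_error:
  assumes N: "N \<ge> 0" and h: "h \<ge> 0" and s: "s \<in> {a..b}" and sh: "s + h \<in> {a..b}" and u: "u \<in> V N"
  shows "norm (g N (s + h) s u - e N s h u) \<le> L * h powr \<alpha> * (1 + N) powr \<mu> * norm u * h"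
proof -
  let ?x = "\<lambda>\<tau>. g N \<tau> s u" and ?K = "L * h powr \<alpha> * (1 + N) powr \<mu> * norm u"
  note x = galerkin_solution[OF N s u]
  have sub: "{s..s + h} \<subseteq> {a..b}" using s sh by auto
  obtain X where X: "X s = u" "X (s + h) = e N s h u"
    "\<And>\<tau>. \<tau> \<in> {s..s + h} \<Longrightarrow> (X has_vector_derivative gen N s (X \<tau>)) (at \<tau> within {s..s + h})"
    using exp_step[OF N s h] by metis
  have "norm (?x (s + h) - X (s + h)) \<le> norm (?x s - X s) + ?K * \<bar>s + h - s\<bar>"
  proof (rule norm_growth[OF convex_real_interval(5)])
    fix \<tau> assume \<tau>: "\<tau> \<in> {s..s + h}"
    then have \<tau>ab: "\<tau> \<in> {a..b}" using sub by blast
    let ?f = "gen N \<tau> (?x \<tau>) - gen N s (?x \<tau>)" and ?z = "?x \<tau> - X \<tau>"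
    show "((\<lambda>\<tau>. ?x \<tau> - X \<tau>) has_vector_derivative gen N \<tau> (?x \<tau>) - gen N s (X \<tau>)) (at \<tau> within {s..s + h})"
      by (intro has_vector_derivative_diff X(3) \<tau> has_vector_derivative_within_subset[OF x(3)[OF \<tau>ab] sub])
    have "gen N \<tau> (?x \<tau>) - gen N s (X \<tau>) = gen N s ?z + ?f"
      using gen_diff[OF s, of N "?x \<tau>" "X \<tau>"] by simp
    then have "Re (cinner (gen N \<tau> (?x \<tau>) - gen N s (X \<tau>)) ?z) = Re (cinner ?f ?z)"
      using Re_cinner_gen[OF s, of N ?z] by (simp only: cinner_add_left plus_complex.sel)
    moreover have "norm ?f \<le> ?K"
    proof -
      have "norm ?f = norm (tr N \<tau> (?x \<tau>) - tr N s (?x \<tau>))"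
        by (simp add: norm_scaleC flip: scaleC_diff_right)
      also have "\<dots> \<le> L * \<bar>\<tau> - s\<bar> powr \<alpha> * (1 + N) powr \<mu> * norm (?x \<tau>)"
        by (rule norm_tr_diff_le[OF s \<tau>ab N])
      also have "\<dots> = L * \<bar>\<tau> - s\<bar> powr \<alpha> * (1 + N) powr \<mu> * norm u"
        using norm_galerkin[OF N s \<tau>ab u] by simp
      also have "\<dots> \<le> ?K"
        using L \<alpha> \<tau> by (intro mult_right_mono mult_left_mono powr_mono2) auto
      finally show ?thesis .
    qed
    then have "\<bar>Re (cinner ?f ?z)\<bar> \<le> ?K * norm ?z"
      by (rule order_trans[OF abs_Re_le_cmod
            order_trans[OF cmod_cinner_le mult_right_mono[OF _ norm_ge_zero]]])
    ultimately show "\<bar>Re (cinner (gen N \<tau> (?x \<tau>) - gen N s (X \<tau>)) ?z)\<bar> \<le> ?K * norm ?z"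
      by (simp only:)
  qed (use L h in auto)
  then show ?thesis using x(1) X h by simp
qed

lemma exp_product_dist:
  assumes N: "N \<ge> 0" and h: "h \<ge> 0" and s: "a \<le> s"
  shows "s + real j * h \<le> b \<Longrightarrow>
    norm (exp_product (tr N) h s j u - exp_product (tr N) h s j v) = norm (u - v)"
proof (induction j)
  case (Suc j)
  then have le: "s + real j * h \<le> b" using h by (simp add: algebra_simps)
  have "s + real j * h \<in> {a..b}" using le s h by (simp add: add_increasing2)
  from exp_step_dist[OF N this h] Suc.IH[OF le] show ?case by simp
qed simp

lemma exp_product_surj:
  assumes N: "N \<ge> 0" and h: "h \<ge> 0" and s: "a \<le> s"
  shows "s + real j * h \<le> b \<Longrightarrow> w \<in> V N \<Longrightarrow> \<exists>u\<in>V N. exp_product (tr N) h s j u = w"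
proof (induction j arbitrary: w)
  case (Suc j)
  then have le: "s + real j * h \<le> b" using h by (simp add: algebra_simps)
  have "s + real j * h \<in> {a..b}" using le s h by (simp add: add_increasing2)
  then obtain v where v: "v \<in> V N" "e N (s + real j * h) h v = w"
    using exp_step_surj[OF N _ h Suc.prems(2)] by blast
  obtain u where "u \<in> V N" "exp_product (tr N) h s j u = v" using Suc.IH[OF le v(1)] by blast
  with v(2) show ?case by auto
qed auto

lemma exp_product_error:
  assumes N: "N \<ge> 0" and h: "h \<ge> 0" and s: "a \<le> s" and u: "u \<in> V N"
  shows "s + real j * h \<le> b \<Longrightarrow> norm (g N (s + real j * h) s u - exp_product (tr N) h s j u)
    \<le> real j * (L * h powr \<alpha> * (1 + N) powr \<mu> * norm u * h)"
proof (induction j)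
  case 0
  then show ?case using galerkin_solution(1)[OF N _ u] s by simp
next
  case (Suc j)
  let ?t = "s + real j * h" and ?K = "L * h powr \<alpha> * (1 + N) powr \<mu> * norm u * h"
  have le: "?t \<le> b" using Suc.prems h by (simp add: algebra_simps)
  have t: "?t \<in> {a..b}" using le s h by (simp add: add_increasing2)
  have t': "?t + h \<in> {a..b}" using Suc.prems t h by (simp add: algebra_simps)
  have sab: "s \<in> {a..b}" using t s h le order_trans[of s ?t b] by simp
  let ?x = "g N ?t s u" and ?y = "exp_product (tr N) h s j u"
  have xV: "?x \<in> V N" by (rule galerkin_solution(2)[OF N sab u t])
  have eq: "s + real (Suc j) * h = ?t + h" by (simp add: algebra_simps)
  have "g N (s + real (Suc j) * h) s u = g N (?t + h) ?t ?x"
    by (simp only: eq galerkin_comp[OF N sab t t' u])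
  \<comment> \<open>The fresh error is taken at the exact state, still of norm
    \<open>norm u\<close>; the earlier error passes through the same exponential in both terms and
    keeps its size.\<close>
  then have split: "g N (s + real (Suc j) * h) s u - exp_product (tr N) h s (Suc j) u
      = (g N (?t + h) ?t ?x - e N ?t h ?x) + (e N ?t h ?x - e N ?t h ?y)" by simp
  have "norm (g N (?t + h) ?t ?x - e N ?t h ?x) \<le> ?K"
    using exp_step_error[OF N h t t' xV] by (simp only: norm_galerkin[OF N sab t u])
  moreover have "norm (e N ?t h ?x - e N ?t h ?y) \<le> real j * ?K"
    using Suc.IH[OF le] by (simp only: exp_step_dist[OF N t h])
  ultimately have "norm ((g N (?t + h) ?t ?x - e N ?t h ?x) + (e N ?t h ?x - e N ?t h ?y)) \<le> ?K + real j * ?K"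
    by (rule order_trans[OF norm_triangle_ineq add_mono])
  also have "\<dots> = real (Suc j) * ?K" by (simp add: algebra_simps)
  finally show ?case by (simp only: split)
qed

lemma exp_product_error_uniform:
  assumes N: "N \<ge> 0" and M: "M \<ge> 1" and s: "s \<in> {a..b}" and t: "t \<in> {a..b}" and st: "s < t" and u: "u \<in> V N"
  shows "norm (g N t s u - exp_product (tr N) ((t - s) / real M) s M u)
    \<le> L * (b - a) powr \<alpha> * (b - a) * ((1 + N) powr \<mu> * real M powr (- \<alpha>)) * norm u"
proof -
  let ?h = "(t - s) / real M"
  have t_eq: "s + real M * ?h = t" using M by simp
  have "norm (g N (s + real M * ?h) s u - exp_product (tr N) ?h s M u)
      \<le> real M * (L * ?h powr \<alpha> * (1 + N) powr \<mu> * norm u * ?h)"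
    by (rule exp_product_error[OF N _ _ u]) (use s t st M in \<open>auto simp: t_eq\<close>)
  \<comment> \<open>M steps of error h^(1 + \<alpha>) with h = (t - s)/M: one power of M cancels and
    M^(-\<alpha>) is left.\<close>
  also have "\<dots> = (t - s) powr \<alpha> * (t - s) * (L * ((1 + N) powr \<mu> * real M powr (- \<alpha>)) * norm u)"
    using M st by (simp add: powr_divide powr_minus field_simps)
  also have "\<dots> \<le> (b - a) powr \<alpha> * (b - a) * (L * ((1 + N) powr \<mu> * real M powr (- \<alpha>)) * norm u)"
    using s t st L \<alpha> by (intro mult_right_mono mult_mono powr_mono2) auto
  finally show ?thesis by (simp only: t_eq) (simp add: mult_ac)
qed

lemma galerkin_step_error:
  assumes N: "N \<ge> 0" and M: "M \<ge> 1" and s: "s \<in> {a..b}" and t: "t \<in> {a..b}" and u: "u \<in> V N"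
  shows "norm (galerkin_step H0 H N M t s u - g N t s u)
    \<le> L * (b - a) powr \<alpha> * (b - a) * ((1 + N) powr \<mu> * real M powr (- \<alpha>)) * norm u"
proof -
  consider "s < t" | "t < s" | "s = t" by linarith
  then show ?thesis
  proof cases
    case 1
    then show ?thesis using exp_product_error_uniform[OF N M s t 1 u]
      by (simp add: galerkin_step_def norm_minus_commute)
  next
    case 2
    let ?h = "(s - t) / real M"
    let ?E = "exp_product (tr N) ?h t M"
    have h: "?h \<ge> 0" "a \<le> t" "t + real M * ?h \<le> b" using 2 M s t by auto
    have mem: "u \<in> ?E ` V N" using exp_product_surj[OF N h u] by blast
    define v where "v = inv_into (V N) ?E u"
    have v: "?E v = u" "v \<in> V N"
      unfolding v_def by (rule f_inv_into_f[OF mem], rule inv_into_into[OF mem])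
    define w where "w = g N t s u"
    have w: "w \<in> V N" "norm w = norm u" "g N s t w = u"
      unfolding w_def using galerkin_solution[OF N s u] norm_galerkin[OF N s t u] galerkin_comp[OF N s t s u] s t by auto
    \<comment> \<open>Both vectors are sent to u, v by the product of exponentials and w by the
      exact evolution from t to s.\<close>
    have "norm (v - w) = norm (?E v - ?E w)" by (rule exp_product_dist[OF N h, symmetric])
    also have "\<dots> = norm (g N s t w - ?E w)" by (simp add: v w)
    also have "\<dots> \<le> L * (b - a) powr \<alpha> * (b - a) * ((1 + N) powr \<mu> * real M powr (- \<alpha>)) * norm w"
      by (rule exp_product_error_uniform[OF N M t s 2 w(1)])
    finally show ?thesis using 2 by (simp add: galerkin_step_def v_def w_def w(2)[unfolded w_def])
  next
    case 3
    then show ?thesis using galerkin_solution(1)[OF N s u] L ab by (simp add: galerkin_step_def)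
  qed
qed

end

section \<open>The limit propagator\<close>

text \<open>The limit is found along the integers and then transferred to the reals. The criterion
  compares with N0 alone, to suit \<open>galerkin_rate\<close>, whose bound depends on the smaller
  index.\<close>

lemma convergent_at_top_real:
  fixes f :: "real \<Rightarrow> 'b::complete_space"
  assumes "\<And>\<epsilon>. \<epsilon> > 0 \<Longrightarrow> \<exists>N0. \<forall>N\<ge>N0. dist (f N) (f N0) < \<epsilon>"
  shows "\<exists>l. (f \<longlongrightarrow> l) at_top"
proof -
  have cau: "\<exists>N0. \<forall>N\<ge>N0. \<forall>N'\<ge>N0. dist (f N) (f N') < \<epsilon>" if "\<epsilon> > 0" for \<epsilon>
  proof -
    have "\<epsilon> / 2 > 0" using that by simp
    then obtain N0 where N0: "\<And>N. N \<ge> N0 \<Longrightarrow> dist (f N) (f N0) < \<epsilon> / 2" using assms by blast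
    have "dist (f N) (f N') < \<epsilon>" if "N \<ge> N0" "N' \<ge> N0" for N N'
      using dist_triangle2[of "f N" "f N'" "f N0"] N0[OF that(1)] N0[OF that(2)] by simp
    then show ?thesis by blast
  qed
  have "Cauchy (\<lambda>n. f (real n))"
  proof (rule metric_CauchyI)
    fix \<epsilon> :: real assume "\<epsilon> > 0"
    then obtain N0 where N0: "\<And>N N'. N \<ge> N0 \<Longrightarrow> N' \<ge> N0 \<Longrightarrow> dist (f N) (f N') < \<epsilon>" using cau by blast
    obtain k where "real k \<ge> N0" using real_arch_simple by blast
    then have "dist (f (real m)) (f (real n)) < \<epsilon>" if "m \<ge> k" "n \<ge> k" for m n
      using that by (intro N0) (auto intro: order_trans)
    then show "\<exists>M. \<forall>m\<ge>M. \<forall>n\<ge>M. dist (f (real m)) (f (real n)) < \<epsilon>" by blast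
  qed
  then obtain l where l: "(\<lambda>n. f (real n)) \<longlonglongrightarrow> l" by (auto simp: Cauchy_convergent_iff convergent_def)
  have "(f \<longlongrightarrow> l) at_top"
  proof (rule tendstoI)
    fix \<epsilon> :: real assume \<epsilon>: "\<epsilon> > 0"
    then obtain N0 where N0: "\<And>N N'. N \<ge> N0 \<Longrightarrow> N' \<ge> N0 \<Longrightarrow> dist (f N) (f N') < \<epsilon> / 2"
      using cau[of "\<epsilon> / 2"] by auto
    have "\<forall>\<^sub>F n in sequentially. dist (f (real n)) l < \<epsilon> / 2" using tendstoD[OF l, of "\<epsilon> / 2"] \<epsilon> by simp
    moreover have "\<forall>\<^sub>F n in sequentially. real n \<ge> N0"
      using filterlim_real_sequentially by (simp add: filterlim_at_top)
    ultimately have "\<forall>\<^sub>F n in sequentially. dist (f (real n)) l < \<epsilon> / 2 \<and> real n \<ge> N0"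
      by (rule eventually_conj)
    then obtain n where n: "dist (f (real n)) l < \<epsilon> / 2" "real n \<ge> N0"
      using eventually_happens'[OF sequentially_bot] by blast
    have "dist (f N) l < \<epsilon>" if "N \<ge> N0" for N
      using dist_triangle[of "f N" l "f (real n)"] N0[OF that n(2)] n(1) by simp
    then show "\<forall>\<^sub>F N in at_top. dist (f N) l < \<epsilon>" using eventually_at_top_linorder by blast
  qed
  then show ?thesis by blast
qed

context truncated_evolution
begin

abbreviation U :: "real \<Rightarrow> real \<Rightarrow> 'a \<Rightarrow> 'a" where
  "U \<equiv> full_propagator H0 H {a..b}"

lemma cutoff_in_V: "cutoff H0 N u \<in> V N"
  by (simp add: cutoff_space_def)

lemma norm_galerkin_cutoff_diff:
  assumes "N \<ge> 0" "s \<in> {a..b}" "t \<in> {a..b}"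
  shows "norm (g N t s (cutoff H0 N u) - g N t s (cutoff H0 N v)) \<le> norm (u - v)"
  using norm_galerkin_diff[OF assms cutoff_in_V cutoff_in_V, of u v] norm_cutoff_le[of N "u - v"]
  by (simp add: cutoff_linear)

lemma rate_tendsto_zero: "((\<lambda>N. C * (1 + N) powr (- \<sigma>) * k) \<longlongrightarrow> 0) at_top"
proof -
  have "filterlim (\<lambda>N::real. 1 + N) at_top at_top"
    by (rule filterlim_tendsto_add_at_top[OF tendsto_const filterlim_ident])
  then have "((\<lambda>N. (1 + N) powr (- \<sigma>)) \<longlongrightarrow> 0) at_top" using \<sigma> by (intro tendsto_neg_powr) auto
  then show ?thesis by (intro tendsto_mult_left_zero tendsto_mult_right_zero)
qed

lemma galerkin_convergent:
  assumes s: "s \<in> {a..b}" and t: "t \<in> {a..b}"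
  shows "\<exists>l. ((\<lambda>N. g N t s (cutoff H0 N u)) \<longlongrightarrow> l) at_top"
proof (rule convergent_at_top_real)
  fix \<epsilon> :: real assume \<epsilon>: "\<epsilon> > 0"
  obtain C where C: "\<And>N N' s t u. 0 \<le> N \<Longrightarrow> N \<le> N' \<Longrightarrow> s \<in> {a..b} \<Longrightarrow> t \<in> {a..b} \<Longrightarrow>
    u \<in> sob H0 (\<mu> + \<sigma>) \<Longrightarrow> norm (g N' t s (cutoff H0 N' u) - g N t s (cutoff H0 N u))
      \<le> C * (1 + N) powr (- \<sigma>) * sob_norm H0 (\<mu> + \<sigma>) u" using galerkin_rate by metis
  have "\<forall>\<^sub>F K in at_top. dist (cutoff H0 K u) u < \<epsilon> / 4"
    using tendstoD[OF cutoff_tendsto, of "\<epsilon> / 4"] \<epsilon> by simp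
  then obtain K where K: "dist (cutoff H0 K u) u < \<epsilon> / 4"
    using eventually_happens'[OF trivial_limit_at_top_linorder] by blast
  \<comment> \<open>A smooth substitute for u, fixed before N0 is chosen. Replacing u by v costs a
    quarter of \<epsilon> at either index by isometry, and the rate for v accounts for the remaining
    half.\<close>
  define v where "v = cutoff H0 K u"
  have v: "v \<in> sob H0 (\<mu> + \<sigma>)" unfolding v_def using \<mu> \<sigma> by (intro cutoff_in_sob) auto
  have uv: "norm (u - v) < \<epsilon> / 4" using K by (simp add: v_def dist_norm norm_minus_commute)
  have "\<forall>\<^sub>F N in at_top. dist (C * (1 + N) powr (- \<sigma>) * sob_norm H0 (\<mu> + \<sigma>) v) 0 < \<epsilon> / 2"
    using tendstoD[OF rate_tendsto_zero, of "\<epsilon> / 2"] \<epsilon> by simp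
  then have "\<forall>\<^sub>F N in at_top. dist (C * (1 + N) powr (- \<sigma>) * sob_norm H0 (\<mu> + \<sigma>) v) 0 < \<epsilon> / 2 \<and> N \<ge> 0"
    by (intro eventually_conj eventually_ge_at_top)
  from eventually_happens'[OF trivial_limit_at_top_linorder this]
  obtain N0 where "dist (C * (1 + N0) powr (- \<sigma>) * sob_norm H0 (\<mu> + \<sigma>) v) 0 < \<epsilon> / 2" "N0 \<ge> 0"
    by blast
  then have N0: "C * (1 + N0) powr (- \<sigma>) * sob_norm H0 (\<mu> + \<sigma>) v < \<epsilon> / 2" "N0 \<ge> 0"
    unfolding dist_real_def by linarith+
  have "dist (g N t s (cutoff H0 N u)) (g N0 t s (cutoff H0 N0 u)) < \<epsilon>" if N: "N \<ge> N0" for N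
  proof -
    have 1: "norm (g N t s (cutoff H0 N u) - g N t s (cutoff H0 N v)) < \<epsilon> / 4"
      using norm_galerkin_cutoff_diff[OF _ s t, of N u v] uv N N0(2) by simp
    have 2: "norm (g N0 t s (cutoff H0 N0 u) - g N0 t s (cutoff H0 N0 v)) < \<epsilon> / 4"
      using norm_galerkin_cutoff_diff[OF N0(2) s t, of u v] uv by simp
    have 3: "norm (g N t s (cutoff H0 N v) - g N0 t s (cutoff H0 N0 v)) < \<epsilon> / 2"
      using C[OF N0(2) N s t v] N0(1) by simp
    show ?thesis
      using dist_triangle_lt[of "g N t s (cutoff H0 N u)" "g N t s (cutoff H0 N v)"
          "g N0 t s (cutoff H0 N0 v)" "\<epsilon> / 4 + \<epsilon> / 2"]
        dist_triangle_lt[of "g N t s (cutoff H0 N u)" "g N0 t s (cutoff H0 N0 v)"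
          "g N0 t s (cutoff H0 N0 u)" \<epsilon>] 1 2 3
      by (simp add: dist_norm norm_minus_commute)
  qed
  then show "\<exists>N0. \<forall>N\<ge>N0. dist (g N t s (cutoff H0 N u)) (g N0 t s (cutoff H0 N0 u)) < \<epsilon>" by blast
qed

lemma full_propagator_tendsto:
  assumes "s \<in> {a..b}" "t \<in> {a..b}"
  shows "((\<lambda>N. g N t s (cutoff H0 N u)) \<longlongrightarrow> U t s u) at_top"
proof -
  obtain l where l: "((\<lambda>N. g N t s (cutoff H0 N u)) \<longlongrightarrow> l) at_top" using galerkin_convergent[OF assms] by blast
  have "U t s u = l" unfolding full_propagator_def by (rule tendsto_Lim[OF trivial_limit_at_top_linorder l])
  then show ?thesis using l by simp
qed

lemma full_propagator_rate:
  obtains C where "C \<ge> 0" "\<And>N s t u. 0 \<le> N \<Longrightarrow> s \<in> {a..b} \<Longrightarrow> t \<in> {a..b} \<Longrightarrow>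
    u \<in> sob H0 (\<mu> + \<sigma>) \<Longrightarrow> norm (g N t s (cutoff H0 N u) - U t s u)
      \<le> C * (1 + N) powr (- \<sigma>) * sob_norm H0 (\<mu> + \<sigma>) u"
proof -
  obtain C where C: "C \<ge> 0" "\<And>N N' s t u. 0 \<le> N \<Longrightarrow> N \<le> N' \<Longrightarrow> s \<in> {a..b} \<Longrightarrow> t \<in> {a..b} \<Longrightarrow>
    u \<in> sob H0 (\<mu> + \<sigma>) \<Longrightarrow> norm (g N' t s (cutoff H0 N' u) - g N t s (cutoff H0 N u))
      \<le> C * (1 + N) powr (- \<sigma>) * sob_norm H0 (\<mu> + \<sigma>) u" using galerkin_rate by metis
  have "norm (g N t s (cutoff H0 N u) - U t s u) \<le> C * (1 + N) powr (- \<sigma>) * sob_norm H0 (\<mu> + \<sigma>) u"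
    if N: "0 \<le> N" and s: "s \<in> {a..b}" and t: "t \<in> {a..b}" and u: "u \<in> sob H0 (\<mu> + \<sigma>)" for N s t u
  proof -
    have lim: "((\<lambda>N'. norm (g N' t s (cutoff H0 N' u) - g N t s (cutoff H0 N u))) \<longlongrightarrow>
        norm (U t s u - g N t s (cutoff H0 N u))) at_top"
      by (intro tendsto_intros full_propagator_tendsto s t)
    have "\<forall>\<^sub>F N' in at_top. norm (g N' t s (cutoff H0 N' u) - g N t s (cutoff H0 N u))
        \<le> C * (1 + N) powr (- \<sigma>) * sob_norm H0 (\<mu> + \<sigma>) u"
      using eventually_ge_at_top[of N] by (rule eventually_mono) (rule C(2)[OF N _ s t u])
    from tendsto_upperbound[OF lim this trivial_limit_at_top_linorder] show ?thesis by (simp add: norm_minus_commute)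
  qed
  then show ?thesis using that C(1) by blast
qed

text \<open>Carries identities of the truncated propagators, available for nonnegative N, over to
  their strong limits.\<close>

lemma tendsto_eqI:
  fixes f :: "real \<Rightarrow> 'c::t2_space"
  assumes "(f \<longlongrightarrow> l) at_top" "(f' \<longlongrightarrow> l') at_top" "\<And>N. N \<ge> 0 \<Longrightarrow> f N = f' N"
  shows "l = l'"
proof -
  have "\<forall>\<^sub>F N in at_top. f N = f' N" using eventually_ge_at_top[of 0] by (rule eventually_mono) (rule assms(3))
  then have "(f' \<longlongrightarrow> l) at_top" using assms(1) tendsto_cong by blast
  then show ?thesis using tendsto_unique[OF trivial_limit_at_top_linorder] assms(2) by blast
qed

lemma full_propagator_cinner:
  assumes "s \<in> {a..b}" "t \<in> {a..b}"
  shows "cinner (U t s u) (U t s v) = cinner u v"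
  by (rule tendsto_eqI[OF tendsto_cinner[OF full_propagator_tendsto full_propagator_tendsto]
        tendsto_cinner[OF cutoff_tendsto cutoff_tendsto]])
     (use assms in \<open>auto simp: galerkin_cinner cutoff_in_V\<close>)

lemma full_propagator_add:
  assumes "s \<in> {a..b}" "t \<in> {a..b}"
  shows "U t s (u + v) = U t s u + U t s v"
  by (rule tendsto_eqI[OF full_propagator_tendsto tendsto_add[OF full_propagator_tendsto full_propagator_tendsto]])
     (use assms in \<open>auto simp: galerkin_add cutoff_in_V cutoff_linear\<close>)

lemma full_propagator_scaleC:
  assumes "s \<in> {a..b}" "t \<in> {a..b}"
  shows "U t s (z *\<^sub>C u) = z *\<^sub>C U t s u"
  by (rule tendsto_eqI[OF full_propagator_tendsto
        bounded_linear.tendsto[OF bounded_linear_scaleC full_propagator_tendsto]])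
     (use assms in \<open>auto simp: galerkin_scaleC cutoff_in_V cutoff_linear\<close>)

lemma full_propagator_dist:
  assumes "s \<in> {a..b}" "t \<in> {a..b}"
  shows "norm (U t s u - U t s v) = norm (u - v)"
proof -
  have "U t s (u - v) = U t s u - U t s v"
    using full_propagator_add[OF assms, of "u - v" v] by simp
  then have "(norm (U t s u - U t s v))\<^sup>2 = (norm (u - v))\<^sup>2"
    using full_propagator_cinner[OF assms, of "u - v" "u - v"] by (simp add: norm_sq_eq_Re_cinner)
  then show ?thesis by simp
qed

lemma full_propagator_refl:
  assumes "s \<in> {a..b}"
  shows "U s s u = u"
  by (rule tendsto_eqI[OF full_propagator_tendsto cutoff_tendsto])
     (use assms in \<open>auto simp: galerkin_solution(1) cutoff_in_V\<close>)

text \<open>Strong limits compose because the truncated propagators are isometric for every N: the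
  error of the intermediate state is passed on without growth.\<close>

lemma full_propagator_comp:
  assumes s: "s \<in> {a..b}" and r: "r \<in> {a..b}" and t: "t \<in> {a..b}"
  shows "U t r (U r s u) = U t s u"
proof -
  let ?w = "U r s u"
  have lim: "((\<lambda>N. norm (?w - g N r s (cutoff H0 N u))) \<longlongrightarrow> norm (?w - ?w)) at_top"
    by (intro tendsto_intros full_propagator_tendsto s r)
  have "((\<lambda>N. g N t r (cutoff H0 N ?w) - g N t s (cutoff H0 N u)) \<longlongrightarrow> 0) at_top"
  proof (rule Lim_null_comparison[OF eventually_mono[OF eventually_ge_at_top[of 0]] lim[simplified]])
    fix N :: real assume N: "0 \<le> N"
    let ?v = "g N r s (cutoff H0 N u)"
    have vV: "?v \<in> V N" by (rule galerkin_solution(2)[OF N s cutoff_in_V r])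
    then have "cutoff H0 N ?v = ?v" by (simp add: cutoff_space_iff)
    moreover have "g N t r ?v = g N t s (cutoff H0 N u)" by (rule galerkin_comp[OF N s r t cutoff_in_V])
    ultimately show "norm (g N t r (cutoff H0 N ?w) - g N t s (cutoff H0 N u)) \<le> norm (?w - ?v)"
      using norm_galerkin_cutoff_diff[OF N r t, of ?w ?v] by simp
  qed
  moreover have "((\<lambda>N. g N t r (cutoff H0 N ?w) - g N t s (cutoff H0 N u)) \<longlongrightarrow> U t r ?w - U t s u) at_top"
    by (intro tendsto_diff full_propagator_tendsto s t r)
  ultimately show ?thesis using tendsto_unique[OF trivial_limit_at_top_linorder] by fastforce
qed

lemma continuous_on_galerkin:
  assumes N: "N \<ge> 0" and u: "u \<in> V N"
  shows "continuous_on ({a..b} \<times> {a..b}) (\<lambda>(t, s). g N t s u)"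
  unfolding continuous_on_def
proof safe
  fix t0 s0 assume 0: "t0 \<in> {a..b}" "s0 \<in> {a..b}"
  obtain K where K: "K \<ge> 0" "\<And>s t t' u. s \<in> {a..b} \<Longrightarrow> t \<in> {a..b} \<Longrightarrow> t' \<in> {a..b} \<Longrightarrow> u \<in> V N \<Longrightarrow>
    norm (g N t s u - g N t' s u) \<le> K * norm u * \<bar>t - t'\<bar>" using galerkin_lipschitz[OF N] by blast
  let ?F = "at (t0, s0) within {a..b} \<times> {a..b}"
  have le: "norm (g N t s u - g N t0 s0 u) \<le> K * norm u * \<bar>s - s0\<bar> + K * norm u * \<bar>t - t0\<bar>"
    if ts: "t \<in> {a..b}" "s \<in> {a..b}" for t s
  proof -
    \<comment> \<open>Continuity in the initial time is reduced to continuity in the final time: by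
      the composition law and isometry the common evolution from s to t can be removed.\<close>
    have "norm (g N t s u - g N t s0 u) = norm (g N t s u - g N t s (g N s s0 u))"
      using galerkin_comp[OF N 0(2) ts(2,1) u] by simp
    also have "\<dots> = norm (u - g N s s0 u)"
      by (rule norm_galerkin_diff[OF N ts(2,1) u galerkin_solution(2)[OF N 0(2) u ts(2)]])
    also have "\<dots> = norm (g N s s0 u - g N s0 s0 u)"
      using galerkin_solution(1)[OF N 0(2) u] by (simp add: norm_minus_commute)
    also have "\<dots> \<le> K * norm u * \<bar>s - s0\<bar>" by (rule K(2)[OF 0(2) ts(2) 0(2) u])
    finally show ?thesis
      using norm_triangle_ineq[of "g N t s u - g N t s0 u" "g N t s0 u - g N t0 s0 u"]
        K(2)[OF 0(2) ts(1) 0(1) u] by simp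
  qed
  have "((\<lambda>p. K * norm u * \<bar>snd p - s0\<bar> + K * norm u * \<bar>fst p - t0\<bar>) \<longlongrightarrow>
      K * norm u * \<bar>snd (t0, s0) - s0\<bar> + K * norm u * \<bar>fst (t0, s0) - t0\<bar>) ?F"
    by (intro tendsto_intros)
  then have lim: "((\<lambda>p. K * norm u * \<bar>snd p - s0\<bar> + K * norm u * \<bar>fst p - t0\<bar>) \<longlongrightarrow> 0) ?F" by simp
  have ev: "\<forall>\<^sub>F p in ?F. p \<in> {a..b} \<times> {a..b}" by (simp add: eventually_at_filter)
  have "((\<lambda>p. (case p of (t, s) \<Rightarrow> g N t s u) - g N t0 s0 u) \<longlongrightarrow> 0) ?F"
    by (rule Lim_null_comparison[OF eventually_mono[OF ev] lim]) (use le in auto)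
  then show "((\<lambda>(t, s). g N t s u) \<longlongrightarrow> g N t0 s0 u) ?F" by (simp add: LIM_zero_iff)
qed

text \<open>Two uniform limits in succession: the rate in N settles vectors of order \<mu> +
  \<sigma>, and isometry of the limit extends continuity to all vectors by cutting off at K.\<close>

lemma continuous_on_full_propagator:
  "continuous_on ({a..b} \<times> {a..b}) (\<lambda>(t, s). U t s u)"
proof -
  have sob: "continuous_on ({a..b} \<times> {a..b}) (\<lambda>(t, s). U t s v)" if v: "v \<in> sob H0 (\<mu> + \<sigma>)" for v
  proof (rule uniform_limit_theorem[OF _ _ trivial_limit_at_top_linorder])
    show "\<forall>\<^sub>F N in at_top. continuous_on ({a..b} \<times> {a..b}) (\<lambda>(t, s). g N t s (cutoff H0 N v))"
      using eventually_ge_at_top[of 0] by (rule eventually_mono) (intro continuous_on_galerkin cutoff_in_V)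
    obtain C where C: "C \<ge> 0" "\<And>N s t u. 0 \<le> N \<Longrightarrow> s \<in> {a..b} \<Longrightarrow> t \<in> {a..b} \<Longrightarrow>
      u \<in> sob H0 (\<mu> + \<sigma>) \<Longrightarrow> norm (g N t s (cutoff H0 N u) - U t s u)
        \<le> C * (1 + N) powr (- \<sigma>) * sob_norm H0 (\<mu> + \<sigma>) u" using full_propagator_rate by blast
    show "uniform_limit ({a..b} \<times> {a..b}) (\<lambda>N (t, s). g N t s (cutoff H0 N v)) (\<lambda>(t, s). U t s v) at_top"
    proof (rule uniform_limitI)
      fix \<epsilon> :: real assume \<epsilon>: "\<epsilon> > 0"
      have "\<forall>\<^sub>F N in at_top. dist (C * (1 + N) powr (- \<sigma>) * sob_norm H0 (\<mu> + \<sigma>) v) 0 < \<epsilon>"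
        by (rule tendstoD[OF rate_tendsto_zero \<epsilon>])
      then have "\<forall>\<^sub>F N in at_top. dist (C * (1 + N) powr (- \<sigma>) * sob_norm H0 (\<mu> + \<sigma>) v) 0 < \<epsilon> \<and> N \<ge> 0"
        by (intro eventually_conj eventually_ge_at_top)
      then show "\<forall>\<^sub>F N in at_top. \<forall>p\<in>{a..b} \<times> {a..b}.
          dist (case p of (t, s) \<Rightarrow> g N t s (cutoff H0 N v)) (case p of (t, s) \<Rightarrow> U t s v) < \<epsilon>"
      proof (rule eventually_mono, safe)
        fix N t s assume N: "dist (C * (1 + N) powr (- \<sigma>) * sob_norm H0 (\<mu> + \<sigma>) v) 0 < \<epsilon>" "0 \<le> N"
          and ts: "t \<in> {a..b}" "s \<in> {a..b}"
        show "dist (g N t s (cutoff H0 N v)) (U t s v) < \<epsilon>"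
          using C(2)[OF N(2) ts(2,1) v] N(1) by (simp add: dist_norm)
      qed
    qed
  qed
  show ?thesis
  proof (rule uniform_limit_theorem[OF _ _ trivial_limit_at_top_linorder])
    show "\<forall>\<^sub>F K in at_top. continuous_on ({a..b} \<times> {a..b}) (\<lambda>(t, s). U t s (cutoff H0 K u))"
      using \<mu> \<sigma> by (intro always_eventually allI sob cutoff_in_sob) auto
    show "uniform_limit ({a..b} \<times> {a..b}) (\<lambda>K (t, s). U t s (cutoff H0 K u)) (\<lambda>(t, s). U t s u) at_top"
    proof (rule uniform_limitI)
      fix \<epsilon> :: real assume \<epsilon>: "\<epsilon> > 0"
      have "\<forall>\<^sub>F K in at_top. dist (cutoff H0 K u) u < \<epsilon>" by (rule tendstoD[OF cutoff_tendsto \<epsilon>])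
      then show "\<forall>\<^sub>F K in at_top. \<forall>p\<in>{a..b} \<times> {a..b}.
          dist (case p of (t, s) \<Rightarrow> U t s (cutoff H0 K u)) (case p of (t, s) \<Rightarrow> U t s u) < \<epsilon>"
        by (rule eventually_mono) (auto simp: dist_norm full_propagator_dist)
    qed
  qed
qed

lemma unitary_full_propagator: "unitary_propagator {a..b} U"
proof -
  have "unitary (U t s)" if st: "t \<in> {a..b}" "s \<in> {a..b}" for t s
  proof -
    have "surj (U t s)"
      by (rule surjI[where f = "U s t"]) (simp add: full_propagator_comp[OF st(1,2,1)] full_propagator_refl[OF st(1)])
    then show ?thesis
      unfolding unitary_def clinear_on_def
      using full_propagator_add[OF st(2,1)] full_propagator_scaleC[OF st(2,1)] full_propagator_cinner[OF st(2,1)]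
      by blast
  qed
  moreover have "U s s = id" if "s \<in> {a..b}" for s using full_propagator_refl[OF that] by auto
  moreover have "U t r \<circ> U r s = U t s" if "t \<in> {a..b}" "r \<in> {a..b}" "s \<in> {a..b}" for t r s
    using full_propagator_comp[OF that(3,2,1)] by auto
  ultimately show ?thesis
    unfolding unitary_propagator_def using continuous_on_full_propagator by blast
qed

lemma galerkin_step_full_error:
  "\<exists>C>0. \<forall>N>0. \<forall>M\<ge>1. \<forall>u\<in>sob H0 (\<mu> + \<sigma>). \<forall>s\<in>{a..b}. \<forall>t\<in>{a..b}.
      norm (galerkin_step H0 H N M t s (cutoff H0 N u) - U t s u)
      \<le> C * ((1 + N) powr (- \<sigma>) + (1 + N) powr \<mu> * real M powr (- \<alpha>)) * sob_norm H0 (\<mu> + \<sigma>) u"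
proof -
  obtain C where C: "C \<ge> 0" "\<And>N s t u. 0 \<le> N \<Longrightarrow> s \<in> {a..b} \<Longrightarrow> t \<in> {a..b} \<Longrightarrow>
    u \<in> sob H0 (\<mu> + \<sigma>) \<Longrightarrow> norm (g N t s (cutoff H0 N u) - U t s u)
      \<le> C * (1 + N) powr (- \<sigma>) * sob_norm H0 (\<mu> + \<sigma>) u" using full_propagator_rate by blast
  define D where "D = L * (b - a) powr \<alpha> * (b - a)"
  have D: "D \<ge> 0" using L ab by (simp add: D_def)
  \<comment> \<open>C bounds the truncation error and D the time-stepping error; the added 1 makes
    the constant strictly positive when both vanish.\<close>
  have "norm (galerkin_step H0 H N M t s (cutoff H0 N u) - U t s u)
      \<le> (C + D + 1) * ((1 + N) powr (- \<sigma>) + (1 + N) powr \<mu> * real M powr (- \<alpha>)) * sob_norm H0 (\<mu> + \<sigma>) u"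
    if N: "N > 0" and M: "M \<ge> 1" and u: "u \<in> sob H0 (\<mu> + \<sigma>)" and s: "s \<in> {a..b}" and t: "t \<in> {a..b}"
    for N M u s t
  proof -
    let ?x = "(1 + N) powr (- \<sigma>)" and ?y = "(1 + N) powr \<mu> * real M powr (- \<alpha>)"
      and ?R = "sob_norm H0 (\<mu> + \<sigma>) u" and ?p = "cutoff H0 N u"
    have N0: "N \<ge> 0" using N by simp
    have "norm ?p \<le> ?R"
      using norm_cutoff_le[of N u] norm_le_sob_norm[OF _ u] \<mu> \<sigma> by simp
    then have "D * ?y * norm ?p \<le> D * ?y * ?R" using D by (intro mult_left_mono) auto
    moreover have "norm (galerkin_step H0 H N M t s ?p - g N t s ?p) \<le> D * ?y * norm ?p"
      using galerkin_step_error[OF N0 M s t cutoff_in_V, of u] by (simp add: D_def)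
    moreover have "norm (g N t s ?p - U t s u) \<le> C * ?x * ?R" by (rule C(2)[OF N0 s t u])
    ultimately have "norm (galerkin_step H0 H N M t s ?p - U t s u) \<le> D * ?y * ?R + C * ?x * ?R"
      using norm_triangle_ineq[of "galerkin_step H0 H N M t s ?p - g N t s ?p" "g N t s ?p - U t s u"] by simp
    also have "\<dots> \<le> (C + D + 1) * ?y * ?R + (C + D + 1) * ?x * ?R"
      using C(1) D by (intro add_mono mult_right_mono sob_norm_nonneg) auto
    finally show ?thesis by (simp add: algebra_simps)
  qed
  then show ?thesis using C(1) D by (intro exI[of _ "C + D + 1"]) auto
qed

lemma galerkin_step_uniform_limit:
  assumes M: "filterlim (\<lambda>N. real (M N) / (1 + N) powr (\<mu> / \<alpha>)) at_top at_top"
    and u: "u \<in> sob H0 (\<mu> + \<sigma>)"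
  shows "uniform_limit ({a..b} \<times> {a..b}) (\<lambda>N (t, s). galerkin_step H0 H N (M N) t s (cutoff H0 N u))
    (\<lambda>(t, s). U t s u) at_top"
proof (rule uniform_limitI)
  fix \<epsilon> :: real assume \<epsilon>: "\<epsilon> > 0"
  obtain C where C: "\<forall>N>0. \<forall>M\<ge>1. \<forall>u\<in>sob H0 (\<mu> + \<sigma>). \<forall>s\<in>{a..b}. \<forall>t\<in>{a..b}.
      norm (galerkin_step H0 H N M t s (cutoff H0 N u) - U t s u)
      \<le> C * ((1 + N) powr (- \<sigma>) + (1 + N) powr \<mu> * real M powr (- \<alpha>)) * sob_norm H0 (\<mu> + \<sigma>) u"
    using galerkin_step_full_error by (elim exE conjE)
  let ?b = "\<lambda>N. C * ((1 + N) powr (- \<sigma>) + (1 + N) powr \<mu> * real (M N) powr (- \<alpha>)) * sob_norm H0 (\<mu> + \<sigma>) u"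
  \<comment> \<open>Here the exponent \<mu>/\<alpha> of the coupling condition arises: the
    time-stepping rate is the power -\<alpha> of the ratio assumed to diverge.\<close>
  have eq: "(real (M N) / (1 + N) powr (\<mu> / \<alpha>)) powr (- \<alpha>) = (1 + N) powr \<mu> * real (M N) powr (- \<alpha>)"
    if "N > 0" for N
    using that \<alpha> by (simp add: powr_divide powr_powr powr_minus field_simps)
  have "((\<lambda>N. (real (M N) / (1 + N) powr (\<mu> / \<alpha>)) powr (- \<alpha>)) \<longlongrightarrow> 0) at_top"
    using \<alpha> by (intro tendsto_neg_powr M) auto
  then have "((\<lambda>N. (1 + N) powr \<mu> * real (M N) powr (- \<alpha>)) \<longlongrightarrow> 0) at_top"
    by (rule Lim_transform_eventually[OF _ eventually_mono[OF eventually_gt_at_top[of 0] eq]])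
  moreover have "((\<lambda>N. (1 + N) powr (- \<sigma>)) \<longlongrightarrow> 0) at_top" using rate_tendsto_zero[of 1 1] by simp
  ultimately have "(?b \<longlongrightarrow> C * (0 + 0) * sob_norm H0 (\<mu> + \<sigma>) u) at_top"
    by (intro tendsto_mult tendsto_add tendsto_const)
  then have "\<forall>\<^sub>F N in at_top. dist (?b N) 0 < \<epsilon>" using tendstoD[OF _ \<epsilon>, of ?b 0 at_top] by simp
  moreover have "\<forall>\<^sub>F N in at_top. real (M N) / (1 + N) powr (\<mu> / \<alpha>) \<ge> 1"
    using M by (simp add: filterlim_at_top)
  moreover have "\<forall>\<^sub>F N::real in at_top. N > 0" by (rule eventually_gt_at_top)
  ultimately show "\<forall>\<^sub>F N in at_top. \<forall>p\<in>{a..b} \<times> {a..b}.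
      dist (case p of (t, s) \<Rightarrow> galerkin_step H0 H N (M N) t s (cutoff H0 N u)) (case p of (t, s) \<Rightarrow> U t s u) < \<epsilon>"
  proof eventually_elim
    case (elim N)
    \<comment> \<open>The error bound concerns at least one step. A ratio of at least 1 excludes M N
      = 0, which the hypothesis does only for large N.\<close>
    have "M N \<noteq> 0" using elim(2) by (cases "M N = 0") auto
    then have M1: "M N \<ge> 1" by simp
    have "dist (galerkin_step H0 H N (M N) t s (cutoff H0 N u)) (U t s u) < \<epsilon>"
      if "t \<in> {a..b}" "s \<in> {a..b}" for t s
      using C[rule_format, OF elim(3) M1 u that(2,1)] elim(1) by (simp add: dist_norm)
    then show ?case by auto
  qed
qed

end

theorem corollary3p26:
  fixes H0 :: "'a::complex_hilbert uop"
    and H :: "real \<Rightarrow> 'a \<Rightarrow> 'a"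
    and a b \<mu> \<sigma> \<alpha> :: real
  assumes "\<exists>S::'a set. countable S \<and> closure S = UNIV"
    and "self_adjoint_op H0" and "positive_op H0" and "compact_resolvent H0"
    and "a \<le> b" and "0 \<le> \<mu>" and "0 < \<sigma>" and "0 < \<alpha>" and "\<alpha> \<le> 1"
    and "\<forall>r\<ge>0. norm_continuous_sob H0 {a..b} (r + \<mu>) r H"
    and "\<exists>c. c absolutely_integrable_on {a..b} \<and> (\<forall>t\<in>{a..b}. 0 \<le> c t)
           \<and> (\<forall>v\<in>sob_inf H0. AE t in lebesgue. t \<in> {a..b} \<longrightarrow>
                cmod (\<i> * (cinner (H t v) (Lambda_pow H0 (2 * (\<mu> + \<sigma>)) v)
                          - cinner (Lambda_pow H0 (2 * (\<mu> + \<sigma>)) v) (H t v)))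
                \<le> c t * (sob_norm H0 (\<mu> + \<sigma>) v)\<^sup>2)"
    and "\<forall>t\<in>{a..b}. \<forall>u\<in>sob_inf H0. \<forall>v\<in>sob_inf H0. cinner (H t u) v = cinner u (H t v)"
    and "holder_continuous_sob \<alpha> H0 {a..b} \<mu> 0 H"
  shows "(\<forall>t\<in>{a..b}. \<forall>s\<in>{a..b}. \<forall>u.
            ((\<lambda>N. galerkin H0 H {a..b} N t s (cutoff H0 N u))
               \<longlongrightarrow> full_propagator H0 H {a..b} t s u) at_top)
       \<and> unitary_propagator {a..b} (full_propagator H0 H {a..b})
       \<and> (\<exists>C>0. \<forall>N>0. \<forall>M\<ge>1. \<forall>u\<in>sob H0 (\<mu> + \<sigma>). \<forall>s\<in>{a..b}. \<forall>t\<in>{a..b}.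
            norm (galerkin_step H0 H N M t s (cutoff H0 N u) - full_propagator H0 H {a..b} t s u)
            \<le> C * ((1 + N) powr (- \<sigma>) + (1 + N) powr \<mu> * real M powr (- \<alpha>))
                * sob_norm H0 (\<mu> + \<sigma>) u)
       \<and> (\<forall>M :: real \<Rightarrow> nat.
            filterlim (\<lambda>N. real (M N) / (1 + N) powr (\<mu> / \<alpha>)) at_top at_top \<longrightarrow>
            (\<forall>u\<in>sob H0 (\<mu> + \<sigma>).
               uniform_limit ({a..b} \<times> {a..b})
                 (\<lambda>N (t, s). galerkin_step H0 H N (M N) t s (cutoff H0 N u))
                 (\<lambda>(t, s). full_propagator H0 H {a..b} t s u) at_top))"
proof -
  obtain c where c: "c absolutely_integrable_on {a..b}" "\<forall>t\<in>{a..b}. 0 \<le> c t"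
    "\<forall>v\<in>sob_inf H0. AE t in lebesgue. t \<in> {a..b} \<longrightarrow>
                cmod (\<i> * (cinner (H t v) (Lambda_pow H0 (2 * (\<mu> + \<sigma>)) v)
                          - cinner (Lambda_pow H0 (2 * (\<mu> + \<sigma>)) v) (H t v)))
                \<le> c t * (sob_norm H0 (\<mu> + \<sigma>) v)\<^sup>2"
    using assms(11) by blast
  obtain L where L: "\<forall>t\<in>{a..b}. \<forall>t'\<in>{a..b}. sob_opnorm H0 \<mu> 0 (\<lambda>u. H t' u - H t u) \<le> L * \<bar>t' - t\<bar> powr \<alpha>"
    and bnd: "\<forall>t\<in>{a..b}. bounded_sob H0 \<mu> 0 (H t)"
    using assms(13) unfolding holder_continuous_sob_def by blast
  \<comment> \<open>The Hoelder constant comes without a sign; its absolute value is nonnegative and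
    still a Hoelder constant.\<close>
  interpret truncated_evolution H0 H a b \<mu> \<sigma> \<alpha> "\<bar>L\<bar>" c
  proof
    fix t t' assume "t \<in> {a..b}" "t' \<in> {a..b}"
    then have "sob_opnorm H0 \<mu> 0 (\<lambda>u. H t' u - H t u) \<le> L * \<bar>t' - t\<bar> powr \<alpha>" using L by blast
    also have "\<dots> \<le> \<bar>L\<bar> * \<bar>t' - t\<bar> powr \<alpha>" by (intro mult_right_mono) auto
    finally show "sob_opnorm H0 \<mu> 0 (\<lambda>u. H t' u - H t u) \<le> \<bar>L\<bar> * \<bar>t' - t\<bar> powr \<alpha>" .
  next
    show "norm_continuous_sob H0 {a..b} (\<sigma> + \<mu>) \<sigma> H" using assms(7,10) by simp
  qed (use assms(2-8,12) c bnd in auto)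
  show ?thesis
    using full_propagator_tendsto unitary_full_propagator galerkin_step_full_error
      galerkin_step_uniform_limit by blast
qed

end
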